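(* Let $k,N\in\mathbb{N}$, $\lambda_1,\dots,\lambda_k>0$, $\Lambda=\lambda_1+\dots+\lambda_k$. Let $M$ be the generalized counting process with parameters $\lambda_1,\dots,\lambda_k$, independent of the inverse process $\mathcal{L}^\nu=\mathcal{L}^{\nu_1,\dots,\nu_N}$ of $\sum_{j=1}^N\mu_j^{1/\nu_j}H_j^{\nu_j}(t)$, and let $\tilde p_n^\nu(t)=\mathsf{P}\{M(\mathcal{L}^\nu(t))=n\}$. (1) If $\mu_j>0$ and $\nu_j\in(0,1)$ for $j=1,\dots,N$, then $$\sum_{j=1}^N\mu_j\frac{d^{\nu_j}}{dt^{\nu_j}}\tilde p_n^\nu(t)=-\Lambda\tilde p_n^\nu(t)+\sum_{j=1}^{\min\{n,k\}}\lambda_j\tilde p_{n-j}^\nu(t),\quad n\ge0,$$ with $\tilde p_0^\nu(0)=1$, $\tilde p_n^\nu(0)=0$ for $n\ge1$, where the fractional derivatives are in the Caputo–Djrbashian sense. (2) Suppose $\nu_j=j\nu$, $j=1,\dots,N$, for some $0<\nu\le\frac1N$, and $\mu_1,\dots,\mu_N\ge0$ are such that, identically in $x$, $$\sum_{j=1}^N\mu_jx^j+\Lambda=\prod_{j=1}^L(x-\eta_j)^{m_j},\qquad\eta_j\in\mathbb{R},\quad\sum_{j=1}^Lm_j=N,$$ with positive integers $m_1,\dots,m_L$. Then for $n=0,1,\dots$ and $t\ge0$ $$\tilde p_n^\nu(t)=\sum_{r=0}^n\ \sum_{\substack{\alpha_1+\dots+\alpha_k=r\\ \alpha_1+2\alpha_2+\dots+k\alpha_k=n}}\binom{r}{\alpha_1,\dots,\alpha_k}\left(\frac{\lambda_1}{\Lambda}\right)^{\alpha_1}\cdots\left(\frac{\lambda_k}{\Lambda}\right)^{\alpha_k}p_r^\nu(t),$$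 where the inner sum runs over nonnegative integers $\alpha_1,\dots,\alpha_k$ and $$p_r^\nu(t)=\Lambda^r\sum_{j=1}^N\mu_jt^{\delta_j-1}E_{\nu,\delta_j}^{\gamma_1,\dots,\gamma_L}(\eta_1t^\nu,\dots,\eta_Lt^\nu),\qquad\gamma_j=m_j(r+1),\quad\delta_j=\nu(N(r+1)-j)+1.$$
   Context: The generalized counting process $M(t)$, $t\ge0$, with parameters $\lambda_1,\dots,\lambda_k>0$ is the counting process ($\mathbb{N}_0$-valued) with $M(0)=0$ a.s., stationary and independent increments, $\mathsf{P}\{M(h)=j\}=\lambda_jh+o(h)$ for $j=1,\dots,k$, and $\mathsf{P}\{M(h)>k\}=o(h)$ as $h\downarrow 0$. For $\beta\in(0,1)$, a stable subordinator $H^{\beta}$ is a nondecreasing Lévy process with $\mathsf{E}e^{-sH^{\beta}(t)}=e^{-ts^{\beta}}$, $s>0$; for $\beta=1$ set $H^1(t)=t$. $H_1^{\nu_1},\dots,H_N^{\nu_N}$ are independent stable subordinators of orders $\nu_1,\dots,\nu_N$ (terms with $\mu_j=0$ vanish). The inverse process is $$\mathcal{L}^\nu(t)=\inf\Big\{s>0:\sum_{j=1}^N\mu_j^{1/\nu_j}H_j^{\nu_j}(s)\ge t\Big\},\quad t>0,\qquad \mathcal{L}^\nu(0)=0.$$ The Caputo–Djrbashian derivative of order $\beta\in(0,1)$ is $\frac{d^{\beta}}{dt^{\beta}}u(t)=\frac{1}{\Gamma(1-\beta)}\int_0^t \frac{u'(s)}{(t-s)^{\beta}}\,ds$. The multivariate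 Mittag-Leffler function is $$E_{\alpha,\beta}^{\gamma_1,\dots,\gamma_m}(z_1,\dots,z_m)=\sum_{k_1=0}^\infty\cdots\sum_{k_m=0}^\infty\frac{(\gamma_1)_{k_1}\cdots(\gamma_m)_{k_m}}{\Gamma\big(\alpha\sum_{j=1}^mk_j+\beta\big)}\frac{z_1^{k_1}}{k_1!}\cdots\frac{z_m^{k_m}}{k_m!},$$ with $(\gamma)_0=1$, $(\gamma)_r=\gamma(\gamma+1)\cdots(\gamma+r-1)$. $\binom{r}{\alpha_1,\dots,\alpha_k}=\frac{r!}{\alpha_1!\cdots\alpha_k!}$. *)

theory Defs
  imports "HOL-Probability.Probability"
begin

text \<open>Processes are indexed by \<open>real\<close>; only the times \<open>t \<ge> 0\<close> are ever constrained or used.\<close>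

definition stationary_increments :: "'a measure \<Rightarrow> (real \<Rightarrow> 'a \<Rightarrow> real) \<Rightarrow> bool" where
  "stationary_increments P X \<longleftrightarrow>
     (\<forall>s\<ge>0. \<forall>t\<ge>0. \<forall>h\<ge>0.
        distr P borel (\<lambda>\<omega>. X (s + h) \<omega> - X s \<omega>) = distr P borel (\<lambda>\<omega>. X (t + h) \<omega> - X t \<omega>))"

definition independent_increments :: "'a measure \<Rightarrow> (real \<Rightarrow> 'a \<Rightarrow> real) \<Rightarrow> bool" where
  "independent_increments P X \<longleftrightarrow>
     (\<forall>(n::nat) (\<tau>::nat \<Rightarrow> real). 0 \<le> \<tau> 0 \<longrightarrow> strict_mono_on {..n} \<tau> \<longrightarrow>
        prob_space.indep_vars P (\<lambda>_. borel) (\<lambda>i \<omega>. X (\<tau> (Suc i)) \<omega> - X (\<tau> i) \<omega>) {..<n})"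

text \<open>For a counting process, a path has its values in the discrete space \<open>nat\<close>, so that
  right-continuity means that it is locally constant to the right.\<close>

definition counting_process :: "'a measure \<Rightarrow> (real \<Rightarrow> 'a \<Rightarrow> nat) \<Rightarrow> bool" where
  "counting_process P M \<longleftrightarrow>
     (\<forall>t\<ge>0. M t \<in> measurable P (count_space UNIV)) \<and>
     (\<forall>\<omega>\<in>space P. mono_on {0..} (\<lambda>t. M t \<omega>) \<and> (\<forall>t\<ge>0. continuous (at_right t) (\<lambda>s. M s \<omega>)))"

definition generalized_counting_process ::
    "'a measure \<Rightarrow> nat \<Rightarrow> (nat \<Rightarrow> real) \<Rightarrow> (real \<Rightarrow> 'a \<Rightarrow> nat) \<Rightarrow> bool" where
  "generalized_counting_process P k lam M \<longleftrightarrow>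
     counting_process P M \<and>
     (AE \<omega> in P. M 0 \<omega> = 0) \<and>
     stationary_increments P (\<lambda>t \<omega>. real (M t \<omega>)) \<and>
     independent_increments P (\<lambda>t \<omega>. real (M t \<omega>)) \<and>
     (\<forall>j\<in>{1..k}. (\<lambda>h. \<P>(\<omega> in P. M h \<omega> = j) - lam j * h) \<in> o[at_right 0](\<lambda>h. h)) \<and>
     (\<lambda>h. \<P>(\<omega> in P. M h \<omega> > k)) \<in> o[at_right 0](\<lambda>h. h)"

text \<open>Stochastic continuity is not listed: it follows from right-continuity of the paths and
  stationarity of the increments.\<close>

definition levy_process :: "'a measure \<Rightarrow> (real \<Rightarrow> 'a \<Rightarrow> real) \<Rightarrow> bool" where
  "levy_process P X \<longleftrightarrow>
     (\<forall>t\<ge>0. X t \<in> borel_measurable P) \<and>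
     (AE \<omega> in P. X 0 \<omega> = 0) \<and>
     stationary_increments P X \<and>
     independent_increments P X \<and>
     (\<forall>\<omega>\<in>space P.
        (\<forall>t\<ge>0. continuous (at_right t) (\<lambda>s. X s \<omega>)) \<and>
        (\<forall>t>0. \<exists>l. ((\<lambda>s. X s \<omega>) \<longlongrightarrow> l) (at_left t)))"

definition stable_subordinator :: "'a measure \<Rightarrow> real \<Rightarrow> (real \<Rightarrow> 'a \<Rightarrow> real) \<Rightarrow> bool" where
  "stable_subordinator P \<beta> H \<longleftrightarrow>
     \<beta> = 1 \<and> (\<forall>\<omega>\<in>space P. \<forall>t\<ge>0. H t \<omega> = t)
   \<or> 0 < \<beta> \<and> \<beta> < 1 \<and> levy_process P H \<and>
     (\<forall>\<omega>\<in>space P. mono_on {0..} (\<lambda>t. H t \<omega>)) \<and>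
     (\<forall>t\<ge>0. \<forall>s>0. prob_space.expectation P (\<lambda>\<omega>. exp (- s * H t \<omega>)) = exp (- t * s powr \<beta>))"

text \<open>Restricted to \<open>[0, \<infinity>)\<close>, so that it is an element of the space of \<open>PiM {0..} (\<lambda>_. borel)\<close>;
  independence of processes is independence of these random elements.\<close>

definition trajectory :: "(real \<Rightarrow> 'a \<Rightarrow> real) \<Rightarrow> 'a \<Rightarrow> real \<Rightarrow> real" where
  "trajectory X \<omega> = (\<lambda>t\<in>{0..}. X t \<omega>)"

text \<open>The infimum is taken in \<open>ennreal\<close>, where the empty set has infimum \<open>\<infinity>\<close>; \<open>enn2real\<close> turns
  this into 0. If some \<open>mu j\<close> is positive, this concerns only a null event. Summands with
  \<open>mu j = 0\<close> vanish because \<open>0 powr a = 0\<close>.\<close>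

definition inverse_process ::
    "nat \<Rightarrow> (nat \<Rightarrow> real) \<Rightarrow> (nat \<Rightarrow> real) \<Rightarrow> (nat \<Rightarrow> real \<Rightarrow> 'a \<Rightarrow> real) \<Rightarrow> real \<Rightarrow> 'a \<Rightarrow> real" where
  "inverse_process N mu nu H t \<omega> =
     (if t = 0 then 0
      else enn2real (INF s \<in> {s. 0 < s \<and> (\<Sum>j=1..N. mu j powr (1 / nu j) * H j s \<omega>) \<ge> t}. ennreal s))"

definition caputo_derivative :: "real \<Rightarrow> (real \<Rightarrow> real) \<Rightarrow> real \<Rightarrow> real" where
  "caputo_derivative \<beta> u t =
     1 / Gamma (1 - \<beta>) * (LINT s:{0<..<t}|lborel. deriv u s / (t - s) powr \<beta>)"

text \<open>Existence of the derivative and of the integral, so that the value above is not one of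
  the defaults of \<open>deriv\<close> and of the Bochner integral.\<close>

definition caputo_differentiable :: "real \<Rightarrow> (real \<Rightarrow> real) \<Rightarrow> real \<Rightarrow> bool" where
  "caputo_differentiable \<beta> u t \<longleftrightarrow>
     (\<forall>s\<in>{0<..<t}. u field_differentiable at s) \<and>
     set_integrable lborel {0<..<t} (\<lambda>s. deriv u s / (t - s) powr \<beta>)"

text \<open>For \<open>a > 0\<close> the multiple series converges absolutely, so it is written as an unordered
  sum over the multi-indices \<open>\<kappa> = (\<kappa>\<^sub>1, \<dots>, \<kappa>\<^sub>m)\<close>.\<close>

definition mittag_leffler :: "real \<Rightarrow> real \<Rightarrow> nat \<Rightarrow> (nat \<Rightarrow> real) \<Rightarrow> (nat \<Rightarrow> real) \<Rightarrow> real" where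
  "mittag_leffler a b m \<gamma> z =
     (\<Sum>\<^sub>\<infinity>\<kappa>\<in>{1..m} \<rightarrow>\<^sub>E UNIV.
        (\<Prod>j=1..m. pochhammer (\<gamma> j) (\<kappa> j)) / Gamma (a * (\<Sum>j=1..m. real (\<kappa> j)) + b)
        * (\<Prod>j=1..m. z j ^ \<kappa> j / fact (\<kappa> j)))"

definition multinomial :: "nat \<Rightarrow> nat \<Rightarrow> (nat \<Rightarrow> nat) \<Rightarrow> real" where
  "multinomial k r \<alpha> = fact r / (\<Prod>j=1..k. fact (\<alpha> j))"

definition weighted_compositions :: "nat \<Rightarrow> nat \<Rightarrow> nat \<Rightarrow> (nat \<Rightarrow> nat) set" where
  "weighted_compositions k r n =
     {\<alpha> \<in> {1..k} \<rightarrow>\<^sub>E UNIV. (\<Sum>j=1..k. \<alpha> j) = r \<and> (\<Sum>j=1..k. j * \<alpha> j) = n}"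

lemma finite_weighted_compositions: "finite (weighted_compositions k r n)"
proof (rule finite_subset)
  show "weighted_compositions k r n \<subseteq> {1..k} \<rightarrow>\<^sub>E {..r}"
  proof
    fix \<alpha> assume \<alpha>: "\<alpha> \<in> weighted_compositions k r n"
    have "\<alpha> j \<le> r" if "j \<in> {1..k}" for j
      using \<alpha> that member_le_sum[of j "{1..k}" \<alpha>] by (auto simp: weighted_compositions_def)
    then show "\<alpha> \<in> {1..k} \<rightarrow>\<^sub>E {..r}"
      using \<alpha> by (auto simp: weighted_compositions_def PiE_def)
  qed
qed (simp add: finite_PiE)

text \<open>Powers \<open>x\<^sup>a\<close> with \<open>x, a \<ge> 0\<close> and the convention \<open>0\<^sup>0 = 1\<close>, whereas \<open>0 powr 0 = 0\<close>.\<close>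

definition rpow :: "real \<Rightarrow> real \<Rightarrow> real" where
  "rpow x a = (if a = 0 then 1 else x powr a)"

text \<open>With \<open>\<phi>(s) = \<Sum>j. mu j * s powr (j * v)\<close> and \<open>\<phi> + Lam\<close> factorised as in the polynomial
  identity, this is the inverse Laplace transform of \<open>Lam ^ r * \<phi>(s) / (s * (\<phi>(s) + Lam) ^ (r + 1))\<close>.\<close>

definition p_explicit ::
    "real \<Rightarrow> nat \<Rightarrow> (nat \<Rightarrow> real) \<Rightarrow> real \<Rightarrow> nat \<Rightarrow> (nat \<Rightarrow> nat) \<Rightarrow> (nat \<Rightarrow> real) \<Rightarrow> nat \<Rightarrow> real \<Rightarrow> real"
  where
  "p_explicit Lam N mu v L m eta r t =
     (let \<gamma> = (\<lambda>l. real (m l) * (real r + 1));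
          \<delta> = (\<lambda>j. v * (real N * (real r + 1) - real j) + 1)
      in Lam ^ r * (\<Sum>j=1..N. mu j * rpow t (\<delta> j - 1)
                      * mittag_leffler v (\<delta> j) L \<gamma> (\<lambda>l. eta l * t powr v)))"

end

theory Submission
  imports Defs
begin

text \<open>Write \<open>S(s) = \<Sum>j. mu j powr (1 / nu j) * H j s\<close>, a subordinator with Laplace exponent
  \<open>\<phi>(z) = \<Sum>j. mu j * z powr nu j\<close>, and \<open>T\<close> for its inverse, so that, almost surely, \<open>T t \<le> a\<close> holds
  exactly when \<open>S a \<ge> t\<close>. Everything is decided by Laplace transforms in time.

  Let \<open>\<tau>\<close> be an exponential time of rate \<open>z\<close>, independent of \<open>S\<close>. Then
  \<open>P(T \<tau> > a) = P(S a < \<tau>) = E exp(- z * S a) = exp(- a * \<phi>(z))\<close>, hence \<open>T \<tau>\<close> is exponential of rate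
  \<open>\<phi>(z)\<close> (\<open>regular_inverse_exponential\<close>). For \<open>q\<^sub>n(s) = P(M s = n)\<close> with Laplace transform \<open>Q\<^sub>n\<close>,
  independence gives \<open>p\<^sub>n(t) = E q\<^sub>n(T t)\<close> (\<open>time_change\<close>), so that \<open>p\<^sub>n\<close> has the Laplace transform
  \<open>\<phi>(z) / z * Q\<^sub>n(\<phi>(z))\<close> (\<open>tc_prob_has_laplace\<close>). The semigroup property of the counting process
  together with the rates of its jumps in a short time gives
  \<open>(y + Lam) * Q\<^sub>n(y) = [n = 0] + \<Sum>j. lam j * Q\<^bsub>n-j\<^esub>(y)\<close> (\<open>state_laplace_recursion\<close>).

  Both claims then become identities between Laplace transforms, and two left-continuous functions with
  the same transform agree at all positive times (\<open>laplace_eq_imp_eq\<close>); \<open>p\<^sub>n\<close> is left-continuous because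
  \<open>q\<^sub>n\<close> is continuous and the inverse \<open>T\<close> of a right-continuous path is left-continuous. What remains is to
  have enough control of the functions on the other side. All of them are convergent series of powers of \<open>t\<close> with real exponents:
  if \<open>F(z) = \<Sum>i. c i * z powr (- a i)\<close> converges absolutely for large \<open>z\<close>, then \<open>F(z) / z\<close> is the
  transform of \<open>\<Sum>i. c i * t powr a i / Gamma (a i + 1)\<close>, a series that converges for every \<open>t > 0\<close> and
  admits differentiation and fractional differentiation term by term (locale \<open>frac_power_series\<close>).

  For the fractional equation, \<open>1 / (\<phi>(z) + Lam)\<close> has such an expansion, by a Neumann series, whose exponents
  \<open>a i\<close> are at least the largest order \<open>\<beta>\<close> among the \<open>nu j\<close>
  (\<open>has_frac_expansion_inverse_multi_term\<close>). By the recursion the same holds for all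
  \<open>Q\<^sub>n(\<phi>(z))\<close>, and then for \<open>\<phi>(z) * Q\<^sub>n(\<phi>(z)) - q\<^sub>n(0)\<close>. So \<open>p\<^sub>n - q\<^sub>n(0)\<close> is a fractional power series
  with exponents at least \<open>\<beta>\<close>. That is exactly what makes \<open>p\<^sub>n\<close> differentiable at positive times, its
  derivative integrable against the Caputo kernel, and the Caputo derivative of order \<open>nu j \<le> \<beta>\<close> a series
  of the same kind. The recursion for \<open>Q\<^sub>n\<close>, multiplied by \<open>\<phi>(z) / z\<close>, is the transformed equation.

  For the explicit formula, the recursion is solved by
  \<open>Q\<^sub>n(y) = \<Sum>r. C(n, r) * Lam ^ r / (y + Lam) ^ (r + 1)\<close>, where \<open>C(n, r)\<close> is the sum of the multinomial
  weights in the theorem (\<open>state_laplace_closed_form\<close>). With \<open>nu j = j * v\<close> the number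
  \<open>\<phi>(z) + Lam\<close> is the given product at \<open>x = z powr v\<close>, and expanding
  each factor \<open>(1 - eta l * z powr (- v)) powr (- \<gamma> l)\<close> by the binomial series turns
  \<open>\<phi>(z) / (\<phi>(z) + Lam) ^ (r + 1)\<close> into the
  expansion that belongs to the Mittag-Leffler functions (\<open>p_explicit_transform\<close>).\<close>

section \<open>Laplace transforms and their uniqueness\<close>

text \<open>A relation between \<open>f\<close>, \<open>z\<close> and the value, so that absolute convergence of the integral is part of it.\<close>

definition has_laplace :: "(real \<Rightarrow> real) \<Rightarrow> real \<Rightarrow> real \<Rightarrow> bool" where
  "has_laplace f z y \<longleftrightarrow>
     has_bochner_integral lborel (\<lambda>t. indicator {0<..} t * (exp (- z * t) * f t)) y"

lemma has_laplace_add: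
  "has_laplace f z x \<Longrightarrow> has_laplace g z y \<Longrightarrow> has_laplace (\<lambda>t. f t + g t) z (x + y)"
  unfolding has_laplace_def
  by (drule (1) has_bochner_integral_add) (simp add: algebra_simps)

lemma has_laplace_cmult: "has_laplace f z x \<Longrightarrow> has_laplace (\<lambda>t. c * f t) z (c * x)"
  unfolding has_laplace_def
  using has_bochner_integral_mult_right[of c lborel "\<lambda>t. indicator {0<..} t * (exp (- z * t) * f t)" x]
  by (simp add: mult_ac)

lemma has_laplace_diff:
  "has_laplace f z x \<Longrightarrow> has_laplace g z y \<Longrightarrow> has_laplace (\<lambda>t. f t - g t) z (x - y)"
  using has_laplace_add[of f z x "\<lambda>t. -1 * g t" "-1 * y"] has_laplace_cmult[of g z y "-1"] by simp

lemma has_laplace_sum: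
  "(\<And>i. i \<in> A \<Longrightarrow> has_laplace (f i) z (x i)) \<Longrightarrow>
     has_laplace (\<lambda>t. \<Sum>i\<in>A. f i t) z (\<Sum>i\<in>A. x i)"
proof (induction A rule: infinite_finite_induct)
  case (insert i A)
  then show ?case by (auto intro: has_laplace_add)
qed (auto simp: has_laplace_def)

lemma has_laplace_cong:
  "(\<And>t. t > 0 \<Longrightarrow> f t = g t) \<Longrightarrow> has_laplace f z x \<longleftrightarrow> has_laplace g z x"
  unfolding has_laplace_def by (intro has_bochner_integral_cong) (auto simp: indicator_def)

text \<open>Lerch's uniqueness argument. At \<open>z = z0 + 1 + n\<close> the transform is the integral of
  \<open>h(t) = exp(- (z0 + 1) * t) * f t\<close> against the \<open>n\<close>-th power of \<open>x = exp(- t)\<close>. By the theorem of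
  Weierstrass, \<open>h\<close> is therefore orthogonal to every continuous function of \<open>x\<close>. If \<open>f t0 > 0\<close>, then by
  left-continuity \<open>f\<close> is positive on an interval that ends at \<open>t0\<close>, and a bump function supported there gives a
  contradiction. One-sided continuity is all that is known of the time-changed state probabilities beforehand.\<close>

lemma laplace_zero_imp_nonpos:
  assumes lap: "\<And>z. z > z0 \<Longrightarrow> has_laplace f z 0"
    and left: "(f \<longlongrightarrow> f t0) (at_left t0)" and t0: "t0 > 0"
  shows "f t0 \<le> 0"
proof (rule ccontr)
  assume "\<not> f t0 \<le> 0"
  then have "f t0 > 0" by simp
  with left have "\<forall>\<^sub>F t in at_left t0. f t > 0"
    by (rule order_tendstoD)
  then obtain b where b: "b < t0" "\<And>t. b < t \<Longrightarrow> t < t0 \<Longrightarrow> f t > 0"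
    by (auto simp: eventually_at_left_field)
  define a where "a = max b 0"
  have a: "a < t0" "a \<ge> 0" "\<And>t. a < t \<Longrightarrow> t < t0 \<Longrightarrow> f t > 0"
    using b t0 by (auto simp: a_def)
  define h where "h t = indicator {0<..} t * (exp (- (z0 + 1) * t) * f t)" for t
  have h_int: "integrable lborel h"
    using lap[of "z0 + 1"] unfolding has_laplace_def h_def[abs_def] has_bochner_integral_iff by simp
  have mono: "has_bochner_integral lborel (\<lambda>t. h t * exp (- t) ^ n) 0" for n :: nat
  proof -
    have "has_laplace f (z0 + 1 + real n) 0" by (rule lap) simp
    moreover have "indicator {0<..} t * (exp (- (z0 + 1 + real n) * t) * f t) = h t * exp (- t) ^ n" for t
    proof -
      have "exp (- (z0 + 1 + real n) * t) = exp (- (z0 + 1) * t) * exp (- t) ^ n"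
        by (simp add: exp_of_nat_mult[symmetric] exp_add[symmetric] algebra_simps)
      then show ?thesis by (simp add: h_def)
    qed
    ultimately show ?thesis by (simp add: has_laplace_def)
  qed
  \<comment> \<open>A continuous function that is positive at \<open>exp (- t)\<close> exactly for \<open>a < t < t0\<close>.\<close>
  define \<psi> :: "real \<Rightarrow> real" where "\<psi> x = max 0 ((x - exp (- t0)) * (exp (- a) - x))" for x
  have \<psi>_cont: "continuous_on A \<psi>" for A
    unfolding \<psi>_def by (intro continuous_intros)
  then have \<psi>_meas [measurable]: "\<psi> \<in> borel_measurable borel"
    by (intro borel_measurable_continuous_onI)
  have \<psi>_bound: "\<bar>\<psi> x\<bar> \<le> 1" if "0 \<le> x" "x \<le> 1" for x
  proof -
    have "(x - exp (- t0)) * (exp (- a) - x) \<le> 1" if "x \<ge> exp (- t0)" "x \<le> exp (- a)"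
    proof -
      have "exp (- a) \<le> 1" using a by simp
      then show ?thesis using that \<open>0 \<le> x\<close> \<open>x \<le> 1\<close>
        by (intro mult_le_one) (auto intro: order_trans[OF _ \<open>x \<le> 1\<close>] add_increasing2 simp: algebra_simps)
    qed
    moreover have "(x - exp (- t0)) * (exp (- a) - x) \<le> 0" if "\<not> (x \<ge> exp (- t0) \<and> x \<le> exp (- a))"
    proof -
      have *: "exp (- t0) < exp (- a)" using a by simp
      then have "x - exp (- t0) \<le> 0 \<and> exp (- a) - x \<ge> 0 \<or> x - exp (- t0) \<ge> 0 \<and> exp (- a) - x \<le> 0"
        using that by linarith
      then show ?thesis by (auto simp: mult_le_0_iff)
    qed
    ultimately have "(x - exp (- t0)) * (exp (- a) - x) \<le> 1"
      by (meson order_trans zero_le_one)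
    then show ?thesis by (simp add: \<psi>_def)
  qed
  have h_meas [measurable]: "h \<in> borel_measurable lborel"
    using h_int by simp
  have int: "integrable lborel (\<lambda>t. h t * \<psi> (exp (- t)))"
  proof (rule Bochner_Integration.integrable_bound[OF h_int])
    show "AE t in lborel. norm (h t * \<psi> (exp (- t))) \<le> norm (h t)"
    proof (rule AE_I2)
      fix t :: real
      have "h t = 0 \<or> \<bar>\<psi> (exp (- t))\<bar> \<le> 1"
        using \<psi>_bound[of "exp (- t)"] by (cases "t > 0") (auto simp: h_def)
      then show "norm (h t * \<psi> (exp (- t))) \<le> norm (h t)"
        by (auto simp: abs_mult mult_left_le)
    qed
  qed measurable
  have "\<bar>LINT t|lborel. h t * \<psi> (exp (- t))\<bar> \<le> e * (LINT t|lborel. \<bar>h t\<bar>)" if "e > 0" for e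
  proof -
    obtain g where g: "real_polynomial_function g" "\<And>x. x \<in> {0..1} \<Longrightarrow> \<bar>\<psi> x - g x\<bar> < e"
      using Stone_Weierstrass_real_polynomial_function[of "{0..1::real}" \<psi> e] \<psi>_cont \<open>e > 0\<close> by auto
    obtain A n where A: "g = (\<lambda>x. \<Sum>i\<le>n. A i * x ^ i)"
      using g(1) by (auto simp: real_polynomial_function_iff_sum)
    have "has_bochner_integral lborel (\<lambda>t. \<Sum>i\<le>n. A i * (h t * exp (- t) ^ i)) (\<Sum>i\<le>n. A i * 0)"
      by (intro has_bochner_integral_sum has_bochner_integral_mult_right mono)
    then have g0: "has_bochner_integral lborel (\<lambda>t. h t * g (exp (- t))) 0"
      by (simp add: A sum_distrib_left mult_ac)
    have "(LINT t|lborel. h t * \<psi> (exp (- t))) =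
            (LINT t|lborel. h t * \<psi> (exp (- t)) - h t * g (exp (- t)))"
      using int g0 by (simp add: has_bochner_integral_iff)
    also have "\<bar>\<dots>\<bar> \<le> (LINT t|lborel. \<bar>h t * \<psi> (exp (- t)) - h t * g (exp (- t))\<bar>)"
      by (rule integral_abs_bound)
    also have "\<dots> \<le> (LINT t|lborel. e * \<bar>h t\<bar>)"
    proof (rule integral_mono)
      fix t :: real
      have "h t = 0 \<or> \<bar>\<psi> (exp (- t)) - g (exp (- t))\<bar> \<le> e"
        using g(2)[of "exp (- t)"] by (cases "t > 0") (auto simp: h_def less_imp_le)
      then have "\<bar>h t\<bar> * \<bar>\<psi> (exp (- t)) - g (exp (- t))\<bar> \<le> \<bar>h t\<bar> * e"
        by (elim disjE) (simp_all add: mult_left_mono)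
      then show "\<bar>h t * \<psi> (exp (- t)) - h t * g (exp (- t))\<bar> \<le> e * \<bar>h t\<bar>"
        by (simp add: right_diff_distrib[symmetric] abs_mult mult.commute)
    qed (use int g0 h_int in \<open>auto simp: has_bochner_integral_iff\<close>)
    finally show ?thesis by simp
  qed
  then have "\<bar>LINT t|lborel. h t * \<psi> (exp (- t))\<bar> \<le> 0"
  proof -
    assume *: "\<And>e. e > 0 \<Longrightarrow> \<bar>LINT t|lborel. h t * \<psi> (exp (- t))\<bar> \<le> e * (LINT t|lborel. \<bar>h t\<bar>)"
    define K where "K = (LINT t|lborel. \<bar>h t\<bar>)"
    have K: "K \<ge> 0" unfolding K_def by simp
    show ?thesis
    proof (rule field_le_epsilon)
      fix e :: real assume "e > 0"
      have "e / (K + 1) * K \<le> e" using K \<open>e > 0\<close> by (simp add: field_simps)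
      moreover have "e / (K + 1) > 0" using K \<open>e > 0\<close> by simp
      ultimately show "\<bar>LINT t|lborel. h t * \<psi> (exp (- t))\<bar> \<le> 0 + e"
        using *[of "e / (K + 1)"] unfolding K_def by linarith
    qed
  qed
  then have zero: "(LINT t|lborel. h t * \<psi> (exp (- t))) = 0" by simp
  have \<psi>_pos: "\<psi> (exp (- t)) > 0 \<longleftrightarrow> a < t \<and> t < t0" for t
    using a by (auto simp: \<psi>_def zero_less_mult_iff less_max_iff_disj)
  have nonneg: "h t * \<psi> (exp (- t)) \<ge> 0" for t
  proof (cases "a < t \<and> t < t0")
    case True
    then show ?thesis using a(3)[of t] \<psi>_pos[of t] by (auto simp: h_def)
  next
    case False
    then have "\<psi> (exp (- t)) = 0" using \<psi>_pos[of t] unfolding \<psi>_def by linarith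
    then show ?thesis by simp
  qed
  have "AE t in lborel. h t * \<psi> (exp (- t)) = 0"
    using integral_nonneg_eq_0_iff_AE[OF int] nonneg zero by simp
  then have "AE t in lborel. t \<notin> {a<..<t0}"
  proof eventually_elim
    case (elim t)
    show ?case
    proof
      assume "t \<in> {a<..<t0}"
      then have "f t > 0" "\<psi> (exp (- t)) > 0" "t > 0"
        using a(2,3) \<psi>_pos[of t] by auto
      then show False using elim by (simp add: h_def)
    qed
  qed
  then have "emeasure lborel {a<..<t0} = 0"
    by (subst (asm) AE_iff_measurable[of "{a<..<t0}"]) auto
  then show False using a by simp
qed

lemma laplace_eq_imp_eq:
  assumes f: "\<And>z. z > z0 \<Longrightarrow> has_laplace f z (F z)"
    and g: "\<And>z. z > z0 \<Longrightarrow> has_laplace g z (F z)"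
    and left: "(f \<longlongrightarrow> f t) (at_left t)" "(g \<longlongrightarrow> g t) (at_left t)" and t: "t > 0"
  shows "f t = g t"
proof (rule antisym)
  have "has_laplace (\<lambda>t. f t - g t) z 0" "has_laplace (\<lambda>t. g t - f t) z 0" if "z > z0" for z
    using has_laplace_diff[OF f[OF that] g[OF that]] has_laplace_diff[OF g[OF that] f[OF that]]
    by simp_all
  then have "f t - g t \<le> 0" "g t - f t \<le> 0"
    using left t laplace_zero_imp_nonpos[of z0 "\<lambda>t. f t - g t" t]
      laplace_zero_imp_nonpos[of z0 "\<lambda>t. g t - f t" t]
    by (simp_all add: tendsto_diff)
  then show "f t \<le> g t" "g t \<le> f t" by simp_all
qed

section \<open>Fractional power series\<close>

text \<open>With this normalisation the Laplace transform is \<open>z powr (- a) / z\<close>, and differentiation lowers \<open>a\<close> by 1,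
  also at \<open>a = 0\<close>, where \<open>rGamma\<close> has a zero.\<close>

definition frac_monomial :: "real \<Rightarrow> real \<Rightarrow> real" where
  "frac_monomial a t = t powr a * rGamma (a + 1)"

lemma rGamma_times_Gamma: "x > 0 \<Longrightarrow> rGamma x * Gamma x = (1 :: real)"
  using Gamma_real_pos[of x] less_imp_neq[of 0 "Gamma x"] left_inverse[of "Gamma x"]
  by (simp only: rGamma_inverse_Gamma) simp

lemma frac_monomial_nonneg: "a \<ge> -1 \<Longrightarrow> frac_monomial a t \<ge> 0"
  by (cases "a = -1") (auto simp: frac_monomial_def rGamma_inverse_Gamma Gamma_real_pos less_imp_le)

text \<open>The part of the Gamma integral over \<open>u \<ge> x\<close>, where \<open>u powr a \<ge> x powr a\<close>, is already that large.\<close>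

lemma Gamma_ge_powr_exp:
  fixes a x :: real
  assumes a: "a \<ge> 0" and x: "x > 0"
  shows "x powr a * exp (- x) \<le> Gamma (a + 1)"
proof -
  have 1: "((\<lambda>u. u powr a / exp u) has_integral Gamma (a + 1)) {0..}"
    using Gamma_integral_real[of "a + 1"] a by simp
  have "((\<lambda>u. x powr a * exp (- 1 * u)) has_integral x powr a * (exp (- 1 * x) / 1)) {x..}"
    by (intro has_integral_mult_right has_integral_exp_minus_to_infinity) simp
  then have "((\<lambda>u. if u \<in> {x..} then x powr a * exp (- u) else 0) has_integral x powr a * exp (- x)) {0..}"
    using x by (subst has_integral_restrict) auto
  from this 1 show ?thesis
    by (rule has_integral_le) (auto simp: exp_minus field_simps intro: powr_mono2 a less_imp_le[OF x])
qed

text \<open>This bound carries all convergence questions: a series of fractional monomials converges for all \<open>t > 0\<close>, and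
  grows at most like \<open>exp (z * t)\<close>, as soon as the corresponding expansion converges absolutely at a single \<open>z\<close>.
  No asymptotics of the Gamma function enter.\<close>

lemma frac_monomial_le:
  assumes a: "a \<ge> 0" and z: "z > 0" and t: "t > 0"
  shows "frac_monomial a t \<le> z powr (- a) * exp (z * t)"
proof -
  have G: "Gamma (a + 1) > 0" using a by (intro Gamma_real_pos) simp
  have "(z * t) powr a * exp (- (z * t)) \<le> Gamma (a + 1)"
    by (rule Gamma_ge_powr_exp) (use assms in auto)
  then show ?thesis
    using G z t by (simp add: frac_monomial_def rGamma_inverse_Gamma powr_mult powr_minus exp_minus field_simps)
qed

text \<open>Euler's integral for \<open>Gamma (a + 1)\<close> after the substitution \<open>t \<mapsto> z * t\<close>.\<close>

lemma frac_monomial_has_laplace: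
  assumes a: "a > -1" and z: "z > 0"
  shows "has_laplace (frac_monomial a) z (z powr (- a) / z)"
proof -
  have "has_bochner_integral lborel (\<lambda>t. indicator {0..} t * (t powr a / exp t)) (Gamma (a + 1))"
  proof (rule has_bochner_integral_nn_integral)
    show "(\<integral>\<^sup>+ t. ennreal (indicator {0..} t * (t powr a / exp t)) \<partial>lborel) = ennreal (Gamma (a + 1))"
      using nn_integral_has_integral_lebesgue[OF _ Gamma_integral_real[of "a + 1"]] a by simp
  qed (use a in \<open>auto simp: less_imp_le Gamma_real_pos\<close>)
  then have "has_bochner_integral lborel
      (\<lambda>t. indicator {0..} (0 + z * t) * ((0 + z * t) powr a / exp (0 + z * t))) (Gamma (a + 1) /\<^sub>R \<bar>z\<bar>)"
    using z by (subst (asm) lborel_has_bochner_integral_real_affine_iff[where c = z and t = 0]) auto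
  then have "has_bochner_integral lborel
      (\<lambda>t. (z powr (- a) * rGamma (a + 1)) *
           (indicator {0..} (0 + z * t) * ((0 + z * t) powr a / exp (0 + z * t))))
      ((z powr (- a) * rGamma (a + 1)) * (Gamma (a + 1) /\<^sub>R \<bar>z\<bar>))"
    by (rule has_bochner_integral_mult_right)
  moreover have "(z powr (- a) * rGamma (a + 1)) * (Gamma (a + 1) /\<^sub>R \<bar>z\<bar>) = z powr (- a) / z"
  proof -
    have "rGamma (a + 1) * Gamma (a + 1) = 1"
      by (rule rGamma_times_Gamma) (use a in simp)
    then have "rGamma (a + 1) * Gamma (a + 1) * (z powr (- a) / z) = z powr (- a) / z" by simp
    then show ?thesis using z by (simp add: divide_inverse mult_ac)
  qed
  moreover have "(z powr (- a) * rGamma (a + 1)) *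
           (indicator {0..} (0 + z * t) * ((0 + z * t) powr a / exp (0 + z * t))) =
      indicator {0<..} t * (exp (- z * t) * frac_monomial a t)" for t
    using z by (cases "t > 0"; cases "t = 0")
      (auto simp: frac_monomial_def indicator_def zero_le_mult_iff powr_mult powr_minus exp_minus field_simps)
  ultimately show ?thesis by (simp add: has_laplace_def)
qed

lemma frac_monomial_has_field_derivative:
  assumes "t > 0"
  shows "(frac_monomial a has_field_derivative frac_monomial (a - 1) t) (at t)"
proof -
  have "((\<lambda>t. t powr a * rGamma (a + 1)) has_field_derivative a * t powr (a - 1) * rGamma (a + 1)) (at t)"
    using assms by (auto intro!: derivative_eq_intros)
  moreover have "a * t powr (a - 1) * rGamma (a + 1) = frac_monomial (a - 1) t"
    using rGamma_plus1[of a] by (simp add: frac_monomial_def mult_ac)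
  ultimately show ?thesis by (simp add: frac_monomial_def[abs_def])
qed

lemma frac_monomial_diff_1:
  assumes "t > 0"
  shows "frac_monomial (a - 1) t = a * frac_monomial a t / t"
  using rGamma_plus1[of a] assms by (simp add: frac_monomial_def powr_diff mult_ac)

text \<open>Euler's Beta integral on \<open>[0, t]\<close>. It says that the Caputo derivative of order \<open>\<nu>\<close> lowers the exponent \<open>a\<close>
  of a fractional monomial by \<open>\<nu>\<close>.\<close>

lemma frac_monomial_beta_integral:
  assumes a: "a > 0" and \<nu>: "\<nu> < 1" and t: "t > 0"
  shows "has_bochner_integral lborel
           (\<lambda>s. indicator {0<..<t} s * (frac_monomial (a - 1) s / (t - s) powr \<nu>))
           (Gamma (1 - \<nu>) * frac_monomial (a - \<nu>) t)"
proof -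
  define b where "b = 1 - \<nu>"
  have b: "b > 0" using \<nu> by (simp add: b_def)
  have "has_bochner_integral lborel
      (\<lambda>s. indicator {0..1} s * (s powr (a - 1) * (1 - s) powr (b - 1))) (Beta a b)"
  proof (rule has_bochner_integral_nn_integral)
    show "(\<integral>\<^sup>+ s. ennreal (indicator {0..1} s * (s powr (a - 1) * (1 - s) powr (b - 1))) \<partial>lborel) =
            ennreal (Beta a b)"
      by (rule nn_integral_has_integral_lebesgue[OF _ has_integral_Beta_real[OF a b]]) auto
  qed (use a b in \<open>auto simp: Beta_def less_imp_le Gamma_real_pos\<close>)
  then have "has_bochner_integral lborel
      (\<lambda>s. indicator {0..1} (0 + 1 / t * s) * ((0 + 1 / t * s) powr (a - 1) * (1 - (0 + 1 / t * s)) powr (b - 1)))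
      (Beta a b /\<^sub>R \<bar>1 / t\<bar>)"
    using t by (subst (asm) lborel_has_bochner_integral_real_affine_iff[where c = "1 / t" and t = 0]) auto
  then have "has_bochner_integral lborel
      (\<lambda>s. (t powr (a - 1) * t powr (b - 1) * rGamma a) *
         (indicator {0..1} (0 + 1 / t * s) * ((0 + 1 / t * s) powr (a - 1) * (1 - (0 + 1 / t * s)) powr (b - 1))))
      ((t powr (a - 1) * t powr (b - 1) * rGamma a) * (Beta a b /\<^sub>R \<bar>1 / t\<bar>))"
    by (rule has_bochner_integral_mult_right)
  moreover have "(t powr (a - 1) * t powr (b - 1) * rGamma a) * (Beta a b /\<^sub>R \<bar>1 / t\<bar>) =
      Gamma (1 - \<nu>) * frac_monomial (a - \<nu>) t"
  proof -
    have "t powr (a - 1) * t powr (b - 1) * t = t powr (a - \<nu>)"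
      using t by (simp add: b_def powr_diff powr_minus field_simps)
    moreover have "rGamma a * Beta a b = Gamma b * rGamma (a + b)"
    proof -
      have "rGamma a * Gamma a = 1"
        by (rule rGamma_times_Gamma[OF a])
      then have "rGamma a * Gamma a * (Gamma b * rGamma (a + b)) = Gamma b * rGamma (a + b)" by simp
      then show ?thesis by (simp add: Beta_def rGamma_inverse_Gamma divide_inverse mult_ac)
    qed
    ultimately have "(t powr (a - 1) * t powr (b - 1) * t) * (rGamma a * Beta a b) =
        t powr (a - \<nu>) * (Gamma b * rGamma (a + b))" by simp
    moreover have "a + b = a - \<nu> + 1" by (simp add: b_def)
    ultimately show ?thesis using t by (simp add: frac_monomial_def b_def[symmetric] mult_ac)
  qed
  moreover have "(t powr (a - 1) * t powr (b - 1) * rGamma a) *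
      (indicator {0..1} (0 + 1 / t * s) * ((0 + 1 / t * s) powr (a - 1) * (1 - (0 + 1 / t * s)) powr (b - 1))) =
      indicator {0<..<t} s * (frac_monomial (a - 1) s / (t - s) powr \<nu>)" for s
  proof (cases "0 < s \<and> s < t")
    case True
    have "t powr (b - 1) * (1 - s / t) powr (b - 1) = (t - s) powr (b - 1)"
    proof -
      have "t - s = t * (1 - s / t)" using t by (simp add: field_simps)
      then show ?thesis using True by (simp add: powr_mult)
    qed
    moreover have "t powr (a - 1) * (s / t) powr (a - 1) = s powr (a - 1)"
      using t True by (simp add: powr_divide)
    moreover have "(t - s) powr (b - 1) = 1 / (t - s) powr \<nu>"
      by (simp add: b_def powr_minus_divide)
    ultimately have "(t powr (a - 1) * (s / t) powr (a - 1)) * (t powr (b - 1) * (1 - s / t) powr (b - 1)) * rGamma a =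
        s powr (a - 1) * (1 / (t - s) powr \<nu>) * rGamma a" by simp
    then show ?thesis using True by (simp add: frac_monomial_def mult_ac)
  next
    case False
    then have "s / t < 0 \<or> s / t > 1 \<or> s = 0 \<or> s = t" "\<not> (0 < s \<and> s < t)"
      using t by (auto simp: field_simps)
    then show ?thesis using t by (auto simp: indicator_def)
  qed
  ultimately show ?thesis by simp
qed

lemma frac_monomial_measurable [measurable]: "frac_monomial b \<in> borel_measurable borel"
  unfolding frac_monomial_def[abs_def] by measurable

lemma bounded_has_laplace:
  fixes f :: "real \<Rightarrow> real"
  assumes y: "y > 0" and [measurable]: "f \<in> borel_measurable borel" and f: "\<And>t. \<bar>f t\<bar> \<le> 1"
  shows "has_laplace f y (LINT t|lborel. indicator {0<..} t * (exp (- y * t) * f t))"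
proof -
  have "has_laplace (frac_monomial 0) y (y powr (- 0) / y)"
    by (rule frac_monomial_has_laplace) (use y in auto)
  then have *: "integrable lborel (\<lambda>t. indicator {0<..} t * (exp (- y * t) * frac_monomial 0 t))"
    by (simp add: has_laplace_def has_bochner_integral_iff)
  have "integrable lborel (\<lambda>t. indicator {0<..} t * (exp (- y * t) * f t))"
  proof (rule Bochner_Integration.integrable_bound[OF *])
    have "norm (indicator {0<..} t * (exp (- y * t) * f t))
        \<le> norm (indicator {0<..} t * (exp (- y * t) * frac_monomial 0 t))" for t :: real
      using f[of t] by (simp add: indicator_def frac_monomial_def abs_mult)
    then show "AE t in lborel. norm (indicator {0<..} t * (exp (- y * t) * f t))
        \<le> norm (indicator {0<..} t * (exp (- y * t) * frac_monomial 0 t))"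
      by simp
  qed measurable
  then show ?thesis by (simp add: has_laplace_def has_bochner_integral_iff)
qed

locale frac_power_series =
  fixes c a :: "nat \<Rightarrow> real" and z0 :: real
  assumes z0: "z0 > 0" and a_nonneg: "a i \<ge> 0"
    and summable_coeffs: "summable (\<lambda>i. \<bar>c i\<bar> * z0 powr (- a i))"
begin

definition series :: "real \<Rightarrow> real" where "series t = (\<Sum>i. c i * frac_monomial (a i) t)"

lemma norm_term_le: "t > 0 \<Longrightarrow> norm (c i * frac_monomial (a i) t) \<le> \<bar>c i\<bar> * z0 powr (- a i) * exp (z0 * t)"
  using frac_monomial_le[OF a_nonneg z0, of t i] frac_monomial_nonneg[of "a i" t] a_nonneg[of i]
  by (auto simp: abs_mult mult.assoc intro!: mult_left_mono)

lemma summable_terms: "t > 0 \<Longrightarrow> summable (\<lambda>i. norm (c i * frac_monomial (a i) t))"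
  by (rule summable_comparison_test'[OF summable_mult2[OF summable_coeffs, of "exp (z0 * t)"], of 0])
     (use norm_term_le in simp)

lemma powr_coeff_le: "z \<ge> z0 \<Longrightarrow> \<bar>c i\<bar> * z powr (- a i) \<le> \<bar>c i\<bar> * z0 powr (- a i)"
  using z0 a_nonneg[of i] by (intro mult_left_mono powr_mono2') auto

lemma summable_powr: "z \<ge> z0 \<Longrightarrow> summable (\<lambda>i. \<bar>c i\<bar> * z powr (- a i))"
  by (rule summable_comparison_test'[OF summable_coeffs, of 0]) (use powr_coeff_le in simp)

lemma summable_signed: "z \<ge> z0 \<Longrightarrow> summable (\<lambda>i. c i * z powr (- a i))"
  by (rule summable_norm_cancel) (use summable_powr[of z] in \<open>simp add: abs_mult\<close>)

text \<open>Integration term by term: for \<open>z > z0\<close> the integrals of the absolute values of the terms are summable.\<close>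

lemma has_laplace_series:
  assumes z: "z > z0"
  shows "has_laplace series z ((\<Sum>i. c i * z powr (- a i)) / z)"
proof -
  define f where "f i t = indicator {0<..} t * (exp (- z * t) * (c i * frac_monomial (a i) t))" for i t
  have f: "has_bochner_integral lborel (f i) (c i * (z powr (- a i) / z))" for i
    using has_laplace_cmult[OF frac_monomial_has_laplace[of "a i" z], of "c i"] a_nonneg[of i] z z0
    by (auto simp: has_laplace_def f_def[abs_def])
  have nf: "norm (f i t) = indicator {0<..} t * (exp (- z * t) * (\<bar>c i\<bar> * frac_monomial (a i) t))" for i t
    using frac_monomial_nonneg[of "a i" t] a_nonneg[of i] by (auto simp: f_def abs_mult indicator_def)
  have nf_int: "has_bochner_integral lborel (\<lambda>t. norm (f i t)) (\<bar>c i\<bar> * (z powr (- a i) / z))" for i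
    using has_laplace_cmult[OF frac_monomial_has_laplace[of "a i" z], of "\<bar>c i\<bar>"] a_nonneg[of i] z z0
    unfolding nf by (auto simp: has_laplace_def)
  have 1: "AE t in lborel. summable (\<lambda>i. norm (f i t))"
  proof (rule AE_I2)
    fix t :: real
    show "summable (\<lambda>i. norm (f i t))"
    proof (cases "t > 0")
      case True
      have "norm (f i t) = exp (- z * t) * norm (c i * frac_monomial (a i) t)" for i
        using True frac_monomial_nonneg[of "a i" t] a_nonneg[of i] unfolding nf by (simp add: abs_mult)
      then show ?thesis using summable_mult[OF summable_terms[OF True], of "exp (- z * t)"] by simp
    qed (simp add: f_def)
  qed
  have 2: "summable (\<lambda>i. LINT t|lborel. norm (f i t))"
  proof -
    have "(LINT t|lborel. norm (f i t)) = \<bar>c i\<bar> * z powr (- a i) / z" for i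
      using nf_int[of i] by (simp add: has_bochner_integral_iff)
    then show ?thesis using summable_divide[OF summable_powr[of z]] z by simp
  qed
  have int: "integrable lborel (f i)" for i using f by (simp add: has_bochner_integral_iff)
  have "has_bochner_integral lborel (\<lambda>t. \<Sum>i. f i t) (\<Sum>i. c i * (z powr (- a i) / z))"
    unfolding has_bochner_integral_iff
    using integrable_suminf[OF int 1 2] integral_suminf[OF int 1 2] f
    by (simp add: has_bochner_integral_iff)
  moreover have "(\<Sum>i. f i t) = indicator {0<..} t * (exp (- z * t) * series t)" for t
  proof (cases "t > 0")
    case True
    then show ?thesis
      using suminf_mult[OF summable_norm_cancel[OF summable_terms[OF True]], of "exp (- z * t)"]
      by (simp add: f_def series_def)
  qed (simp add: f_def)
  moreover have "(\<Sum>i. c i * (z powr (- a i) / z)) = (\<Sum>i. c i * z powr (- a i)) / z"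
    using suminf_divide[OF summable_signed[of z], of z] z by simp
  ultimately show ?thesis by (simp add: has_laplace_def)
qed

text \<open>Differentiation costs a factor \<open>a i\<close>, which is not bounded. It is absorbed by applying
  \<open>frac_monomial_le\<close> at \<open>exp 1 * z0\<close> in place of \<open>z0\<close>, as \<open>a * exp (- a) \<le> 1\<close>.\<close>

lemma norm_deriv_term_le:
  assumes t: "t > 0"
  obtains K where "\<And>i x. x \<in> {t / 2<..<2 * t} \<Longrightarrow>
    norm (c i * frac_monomial (a i - 1) x) \<le> \<bar>c i\<bar> * z0 powr (- a i) * K"
proof -
  define S where "S = {t / 2<..<2 * t}"
  define z1 where "z1 = exp 1 * z0"
  define K where "K = exp (z1 * (2 * t)) / (t / 2)"
  have z1: "z1 > 0" using z0 by (simp add: z1_def)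
  have bound: "norm (c i * frac_monomial (a i - 1) x) \<le> \<bar>c i\<bar> * z0 powr (- a i) * K" if x: "x \<in> S" for i x
  proof -
    have x0: "x > 0" "x \<ge> t / 2" "x \<le> 2 * t" using x t by (auto simp: S_def)
    have "a i * exp (- a i) \<le> 1"
    proof -
      have "a i \<le> exp (a i)" using exp_ge_add_one_self[of "a i"] by linarith
      then show ?thesis by (simp add: exp_minus field_simps)
    qed
    then have z1_le: "a i * z1 powr (- a i) \<le> z0 powr (- a i)"
      using z0 by (simp add: z1_def powr_mult powr_def[of "exp 1"] mult.assoc[symmetric] mult_le_cancel_right1)
    have "a i * frac_monomial (a i) x \<le> a i * (z1 powr (- a i) * exp (z1 * x))"
      by (intro mult_left_mono frac_monomial_le a_nonneg z1 x0)
    also have "\<dots> = (a i * z1 powr (- a i)) * exp (z1 * x)" by simp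
    also have "\<dots> \<le> z0 powr (- a i) * exp (z1 * (2 * t))"
      using x0 z1 by (intro mult_mono z1_le) auto
    finally have "a i * frac_monomial (a i) x / x \<le> z0 powr (- a i) * exp (z1 * (2 * t)) / (t / 2)"
      using x0 t by (intro frac_le) auto
    then have "frac_monomial (a i - 1) x \<le> z0 powr (- a i) * K"
      using x0 by (simp add: frac_monomial_diff_1 K_def)
    then have "\<bar>c i\<bar> * frac_monomial (a i - 1) x \<le> \<bar>c i\<bar> * (z0 powr (- a i) * K)"
      by (rule mult_left_mono) simp
    then show ?thesis
      using frac_monomial_nonneg[of "a i - 1" x] a_nonneg[of i] by (simp add: abs_mult mult.assoc)
  qed
  show ?thesis by (rule that[of K]) (use bound in \<open>simp add: S_def\<close>)
qed

lemma summable_deriv_terms: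
  assumes t: "t > 0"
  shows "summable (\<lambda>i. norm (c i * frac_monomial (a i - 1) t))"
proof -
  obtain K where K: "\<And>i x. x \<in> {t / 2<..<2 * t} \<Longrightarrow>
    norm (c i * frac_monomial (a i - 1) x) \<le> \<bar>c i\<bar> * z0 powr (- a i) * K"
    using norm_deriv_term_le[OF t] by blast
  show ?thesis
    by (rule summable_comparison_test'[OF summable_mult2[OF summable_coeffs, of K], of 0])
       (use K[of t] t in simp)
qed

lemma series_has_field_derivative:
  assumes t: "t > 0"
  shows "(series has_field_derivative (\<Sum>i. c i * frac_monomial (a i - 1) t)) (at t)"
proof -
  define S where "S = {t / 2<..<2 * t}"
  obtain K where bound: "\<And>i x. x \<in> S \<Longrightarrow>
    norm (c i * frac_monomial (a i - 1) x) \<le> \<bar>c i\<bar> * z0 powr (- a i) * K"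
    using norm_deriv_term_le[OF t] unfolding S_def by blast
  have "((\<lambda>x. \<Sum>i. c i * frac_monomial (a i) x) has_field_derivative
          (\<Sum>i. c i * frac_monomial (a i - 1) t)) (at t)"
  proof (rule has_field_derivative_series'(2)[where S = S and ?x0.0 = t])
    show "convex S" by (simp add: S_def)
    show "((\<lambda>x. c n * frac_monomial (a n) x) has_field_derivative c n * frac_monomial (a n - 1) x) (at x within S)"
      if "x \<in> S" for n x
      using that t by (intro DERIV_cmult has_field_derivative_at_within[OF frac_monomial_has_field_derivative])
        (auto simp: S_def)
    show "uniformly_convergent_on S (\<lambda>n x. \<Sum>i<n. c i * frac_monomial (a i - 1) x)"
      by (rule Weierstrass_m_test'[OF bound]) (auto intro: summable_mult2 summable_coeffs)
    show "summable (\<lambda>n. c n * frac_monomial (a n) t)"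
      by (rule summable_norm_cancel[OF summable_terms[OF t]])
    show "t \<in> S" "t \<in> interior S" using t by (auto simp: S_def interior_open)
  qed
  then show ?thesis by (simp add: series_def[abs_def])
qed

lemma series_isCont: "t > 0 \<Longrightarrow> isCont series t"
  using series_has_field_derivative by (rule DERIV_isCont)

lemma shift_exponents:
  assumes "\<And>i. \<nu> \<le> a i"
  shows "frac_power_series c (\<lambda>i. a i - \<nu>) z0"
proof
  have eq: "\<bar>c i\<bar> * z0 powr (- (a i - \<nu>)) = z0 powr \<nu> * (\<bar>c i\<bar> * z0 powr (- a i))" for i
    using z0 by (simp add: powr_diff powr_minus field_simps)
  show "summable (\<lambda>i. \<bar>c i\<bar> * z0 powr (- (a i - \<nu>)))"
    unfolding eq by (rule summable_mult[OF summable_coeffs])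
qed (use z0 assms in auto)

text \<open>The Caputo derivative can be taken term by term. The exponents \<open>a i - \<nu>\<close> of the result are nonnegative,
  so it is again a fractional power series; this is why all exponents have to be at least \<open>\<nu>\<close>.\<close>

lemma caputo_series:
  assumes a_ge: "\<And>i. a i \<ge> b" and \<nu>: "0 < \<nu>" "\<nu> < 1" "\<nu> \<le> b" and t: "t > 0"
    and u: "\<And>s. s > 0 \<Longrightarrow> u s = C + series s"
  shows "caputo_differentiable \<nu> u t"
    and "caputo_derivative \<nu> u t = frac_power_series.series c (\<lambda>i. a i - \<nu>) t"
proof -
  define g where "g i s = indicator {0<..<t} s * (c i * frac_monomial (a i - 1) s / (t - s) powr \<nu>)" for i s
  have a_pos: "a i > 0" for i using a_ge[of i] \<nu> by linarith
  have u_deriv: "(u has_field_derivative (\<Sum>i. c i * frac_monomial (a i - 1) s)) (at s)" if "s > 0" for s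
  proof (rule has_field_derivative_transform_within_open[where S = "{0<..}"])
    show "((\<lambda>s. C + series s) has_field_derivative (\<Sum>i. c i * frac_monomial (a i - 1) s)) (at s)"
      using series_has_field_derivative[OF that] by (auto intro!: derivative_eq_intros)
  qed (use that u in auto)
  have g: "has_bochner_integral lborel (g i) (c i * (Gamma (1 - \<nu>) * frac_monomial (a i - \<nu>) t))" for i
    using has_bochner_integral_mult_right[OF frac_monomial_beta_integral[OF a_pos[of i] \<nu>(2) t], of "c i"]
    by (simp add: g_def[abs_def] mult_ac)
  have ng: "norm (g i s) = \<bar>c i\<bar> * (indicator {0<..<t} s * (frac_monomial (a i - 1) s / (t - s) powr \<nu>))" for i s
    using frac_monomial_nonneg[of "a i - 1" s] a_pos[of i] by (auto simp: g_def abs_mult indicator_def)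
  have ng_int: "has_bochner_integral lborel (\<lambda>s. norm (g i s)) (\<bar>c i\<bar> * (Gamma (1 - \<nu>) * frac_monomial (a i - \<nu>) t))" for i
    using has_bochner_integral_mult_right[OF frac_monomial_beta_integral[OF a_pos[of i] \<nu>(2) t], of "\<bar>c i\<bar>"]
    unfolding ng by simp
  have summ: "summable (\<lambda>i. norm (c i * frac_monomial (a i - 1) s))" if "s > 0" for s
    using summable_deriv_terms[OF that] .
  have 1: "AE s in lborel. summable (\<lambda>i. norm (g i s))"
  proof (rule AE_I2)
    fix s :: real
    show "summable (\<lambda>i. norm (g i s))"
    proof (cases "0 < s \<and> s < t")
      case True
      then have "norm (g i s) = norm (c i * frac_monomial (a i - 1) s) / (t - s) powr \<nu>" for i
        by (simp add: g_def abs_mult)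
      then show ?thesis using summable_divide[OF summ[of s], of "(t - s) powr \<nu>"] True by simp
    qed (auto simp: g_def)
  qed
  interpret D: frac_power_series c "\<lambda>i. a i - \<nu>" z0
    by (rule shift_exponents) (rule order_trans[OF \<nu>(3) a_ge])
  have 2: "summable (\<lambda>i. LINT s|lborel. norm (g i s))"
  proof -
    have "(LINT s|lborel. norm (g i s)) = Gamma (1 - \<nu>) * norm (c i * frac_monomial (a i - \<nu>) t)" for i
      using ng_int[of i] frac_monomial_nonneg[of "a i - \<nu>" t] a_ge[of i] \<nu>
      by (simp add: has_bochner_integral_iff abs_mult mult_ac)
    then show ?thesis using summable_mult[OF D.summable_terms[OF t]] by simp
  qed
  have int: "integrable lborel (g i)" for i using g by (simp add: has_bochner_integral_iff)
  have sum_g: "(\<Sum>i. g i s) = indicator {0<..<t} s * (deriv u s / (t - s) powr \<nu>)" for s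
  proof (cases "0 < s \<and> s < t")
    case True
    then show ?thesis
      using DERIV_imp_deriv[OF u_deriv[of s]] suminf_divide[OF summable_norm_cancel[OF summ[of s]], of "(t - s) powr \<nu>"]
      by (simp add: g_def)
  qed (auto simp: g_def)
  have int_sum: "integrable lborel (\<lambda>s. indicator {0<..<t} s * (deriv u s / (t - s) powr \<nu>))"
    using integrable_suminf[OF int 1 2] by (simp add: sum_g)
  moreover have "u field_differentiable at s" if "s \<in> {0<..<t}" for s
    using u_deriv[of s] that by (auto simp: field_differentiable_def)
  ultimately show "caputo_differentiable \<nu> u t"
    by (simp add: caputo_differentiable_def set_integrable_def)
  have "(LINT s|lborel. indicator {0<..<t} s * (deriv u s / (t - s) powr \<nu>)) =
          (\<Sum>i. Gamma (1 - \<nu>) * (c i * frac_monomial (a i - \<nu>) t))"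
    using integral_suminf[OF int 1 2] g by (simp add: sum_g has_bochner_integral_iff mult_ac)
  also have "\<dots> = Gamma (1 - \<nu>) * D.series t"
    using suminf_mult[OF summable_norm_cancel[OF D.summable_terms[OF t]]] by (simp add: D.series_def)
  finally show "caputo_derivative \<nu> u t = D.series t"
    using less_imp_neq[OF Gamma_real_pos[of "1 - \<nu>"]] \<nu>
    by (simp add: caputo_derivative_def set_lebesgue_integral_def del: Gamma_eq_zero_iff)
qed

end

section \<open>Expansions in fractional powers at infinity\<close>

lemma infsum_nat_eq_suminf: "f summable_on (UNIV :: nat set) \<Longrightarrow> infsum f UNIV = (\<Sum>n. f n :: real)"
  using has_sum_imp_sums[OF has_sum_infsum] sums_unique by blast

text \<open>Expansions arise with different countable index sets: pairs in products, multi-indices in Mittag-Leffler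
  functions. An enumeration, padded with zero coefficients, makes them series over \<open>nat\<close>. It depends on
  \<open>a\<close> and \<open>c\<close> only, so that the same coefficients serve for every function \<open>g\<close> of the exponent.\<close>

lemma enumerate_expansion:
  fixes c a :: "'i \<Rightarrow> real"
  assumes I: "countable I" and a: "\<And>i. i \<in> I \<Longrightarrow> a i \<ge> b"
  obtains c' a' :: "nat \<Rightarrow> real"
  where "\<And>n. a' n \<ge> b"
    and "\<And>g. (\<lambda>i. \<bar>c i\<bar> * g (a i) :: real) summable_on I \<Longrightarrow> summable (\<lambda>n. \<bar>c' n\<bar> * g (a' n)) \<and>
          infsum (\<lambda>i. \<bar>c i\<bar> * g (a i)) I = (\<Sum>n. \<bar>c' n\<bar> * g (a' n))"
    and "\<And>g. (\<lambda>i. c i * g (a i) :: real) summable_on I \<Longrightarrow>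
          infsum (\<lambda>i. c i * g (a i)) I = (\<Sum>n. c' n * g (a' n))"
proof
  define e where "e = to_nat_on I"
  have inj: "inj_on e I" unfolding e_def by (rule inj_on_to_nat_on[OF I])
  define c' where "c' n = (if n \<in> e ` I then c (inv_into I e n) else 0)" for n
  define a' where "a' n = (if n \<in> e ` I then a (inv_into I e n) else b)" for n
  have c'e: "c' (e i) = c i" "a' (e i) = a i" if "i \<in> I" for i
    using that inj by (auto simp: c'_def a'_def)
  have main: "(\<lambda>n. h (c' n) (a' n)) summable_on UNIV \<and> infsum (\<lambda>i. h (c i) (a i)) I = (\<Sum>n. h (c' n) (a' n))"
    if h: "(\<lambda>i. h (c i) (a i)) summable_on I" "\<And>x. h 0 x = 0" for h :: "real \<Rightarrow> real \<Rightarrow> real"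
  proof -
    have "((\<lambda>i. h (c i) (a i)) has_sum infsum (\<lambda>i. h (c i) (a i)) I) I"
      using h(1) by (rule has_sum_infsum)
    then have "(((\<lambda>n. h (c' n) (a' n)) \<circ> e) has_sum infsum (\<lambda>i. h (c i) (a i)) I) I"
      by (subst has_sum_cong[where g = "\<lambda>i. h (c i) (a i)"]) (auto simp: c'e)
    then have "((\<lambda>n. h (c' n) (a' n)) has_sum infsum (\<lambda>i. h (c i) (a i)) I) (e ` I)"
      by (subst has_sum_reindex[OF inj])
    then have "((\<lambda>n. h (c' n) (a' n)) has_sum infsum (\<lambda>i. h (c i) (a i)) I) UNIV"
      by (subst has_sum_cong_neutral[where S = UNIV and T = "e ` I" and g = "\<lambda>n. h (c' n) (a' n)"])
         (auto simp: c'_def h(2))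
    then show ?thesis
      using infsum_nat_eq_suminf[of "\<lambda>n. h (c' n) (a' n)"] infsumI[of "\<lambda>n. h (c' n) (a' n)"]
      by (auto simp: summable_on_def)
  qed
  show "a' n \<ge> b" for n
    using a by (auto simp: a'_def inv_into_into)
  show "summable (\<lambda>n. \<bar>c' n\<bar> * g (a' n)) \<and>
          infsum (\<lambda>i. \<bar>c i\<bar> * g (a i)) I = (\<Sum>n. \<bar>c' n\<bar> * g (a' n))"
    if "(\<lambda>i. \<bar>c i\<bar> * g (a i) :: real) summable_on I" for g
    using main[of "\<lambda>x y. \<bar>x\<bar> * g y"] that summable_on_imp_summable by auto
  show "infsum (\<lambda>i. c i * g (a i)) I = (\<Sum>n. c' n * g (a' n))"
    if "(\<lambda>i. c i * g (a i) :: real) summable_on I" for g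
    using main[of "\<lambda>x y. x * g y"] that by auto
qed

text \<open>\<open>B\<close> bounds the weighted \<open>l\<^sup>1\<close> norm of the coefficients at \<open>z0\<close>. In this norm the functions with an
  expansion form a Banach algebra, and \<open>b\<close> is a lower bound of the exponents.\<close>

definition has_frac_expansion :: "real \<Rightarrow> real \<Rightarrow> real \<Rightarrow> (real \<Rightarrow> real) \<Rightarrow> bool" where
  "has_frac_expansion b z0 B F \<longleftrightarrow>
     (\<exists>c a :: nat \<Rightarrow> real. (\<forall>i. a i \<ge> b) \<and> summable (\<lambda>i. \<bar>c i\<bar> * z0 powr (- a i)) \<and>
        (\<Sum>i. \<bar>c i\<bar> * z0 powr (- a i)) \<le> B \<and> (\<forall>z\<ge>z0. F z = (\<Sum>i. c i * z powr (- a i))))"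

lemma has_frac_expansion_mono:
  "has_frac_expansion b z0 B F \<Longrightarrow> b' \<le> b \<Longrightarrow> B \<le> B' \<Longrightarrow> (\<And>z. z \<ge> z0 \<Longrightarrow> G z = F z) \<Longrightarrow>
     has_frac_expansion b' z0 B' G"
  unfolding has_frac_expansion_def
proof (elim exE conjE)
  fix c a :: "nat \<Rightarrow> real"
  assume "b' \<le> b" "B \<le> B'" "\<And>z. z \<ge> z0 \<Longrightarrow> G z = F z" "\<forall>i. a i \<ge> b"
    "summable (\<lambda>i. \<bar>c i\<bar> * z0 powr (- a i))" "(\<Sum>i. \<bar>c i\<bar> * z0 powr (- a i)) \<le> B"
    "\<forall>z\<ge>z0. F z = (\<Sum>i. c i * z powr (- a i))"
  then show "\<exists>c a. (\<forall>i. a i \<ge> b') \<and> summable (\<lambda>i. \<bar>c i\<bar> * z0 powr (- a i)) \<and>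
        (\<Sum>i. \<bar>c i\<bar> * z0 powr (- a i)) \<le> B' \<and> (\<forall>z\<ge>z0. G z = (\<Sum>i. c i * z powr (- a i)))"
    by (intro exI[of _ c] exI[of _ a]) (auto intro: order_trans)
qed

lemma has_frac_expansion_nonneg: "has_frac_expansion b z0 B F \<Longrightarrow> B \<ge> 0"
  unfolding has_frac_expansion_def
proof (elim exE conjE)
  fix c a :: "nat \<Rightarrow> real"
  assume "summable (\<lambda>i. \<bar>c i\<bar> * z0 powr (- a i))" "(\<Sum>i. \<bar>c i\<bar> * z0 powr (- a i)) \<le> B"
  moreover from this(1) have "(\<Sum>i. \<bar>c i\<bar> * z0 powr (- a i)) \<ge> 0"
    by (rule suminf_nonneg) simp
  ultimately show "B \<ge> 0" by linarith
qed

lemma has_frac_expansion_abs_le: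
  assumes F: "has_frac_expansion b z0 B F" and b: "b \<ge> 0" and z: "z0 > 0" "z \<ge> z0"
  shows "\<bar>F z\<bar> \<le> B"
proof -
  obtain c a :: "nat \<Rightarrow> real" where ca: "\<And>i. a i \<ge> b" "summable (\<lambda>i. \<bar>c i\<bar> * z0 powr (- a i))"
      "(\<Sum>i. \<bar>c i\<bar> * z0 powr (- a i)) \<le> B" "\<And>z. z \<ge> z0 \<Longrightarrow> F z = (\<Sum>i. c i * z powr (- a i))"
    using F unfolding has_frac_expansion_def by blast
  interpret frac_power_series c a z0
    using ca b z order_trans[OF b] by unfold_locales auto
  have "\<bar>F z\<bar> \<le> (\<Sum>i. \<bar>c i\<bar> * z powr (- a i))"
    unfolding ca(4)[OF z(2)] using summable_rabs[of "\<lambda>i. c i * z powr (- a i)"] summable_powr[OF z(2)]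
    by (simp add: abs_mult)
  also have "\<dots> \<le> (\<Sum>i. \<bar>c i\<bar> * z0 powr (- a i))"
    by (intro suminf_le powr_coeff_le summable_powr z) auto
  finally show ?thesis using ca(3) by simp
qed

text \<open>Completeness of the Banach algebra: an absolutely convergent series of expansions is one expansion,
  indexed by pairs. Sums, products and Neumann series are all obtained from this.\<close>

lemma has_frac_expansion_suminf:
  fixes F :: "nat \<Rightarrow> real \<Rightarrow> real"
  assumes F: "\<And>k. has_frac_expansion b z0 (B k) (F k)" and B: "summable B"
    and b: "b \<ge> 0" and z0: "z0 > 0"
  shows "has_frac_expansion b z0 (\<Sum>k. B k) (\<lambda>z. \<Sum>k. F k z)"
proof -
  have ex: "\<forall>k. \<exists>c a :: nat \<Rightarrow> real. (\<forall>i. a i \<ge> b) \<and> summable (\<lambda>i. \<bar>c i\<bar> * z0 powr (- a i)) \<and>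
        (\<Sum>i. \<bar>c i\<bar> * z0 powr (- a i)) \<le> B k \<and> (\<forall>z\<ge>z0. F k z = (\<Sum>i. c i * z powr (- a i)))"
    using F by (simp add: has_frac_expansion_def)
  obtain c where "\<forall>k. \<exists>a :: nat \<Rightarrow> real. (\<forall>i. a i \<ge> b) \<and> summable (\<lambda>i. \<bar>c k i\<bar> * z0 powr (- a i)) \<and>
        (\<Sum>i. \<bar>c k i\<bar> * z0 powr (- a i)) \<le> B k \<and> (\<forall>z\<ge>z0. F k z = (\<Sum>i. c k i * z powr (- a i)))"
    using choice[OF ex] by (elim exE)
  from choice[OF this] obtain a where ca: "\<forall>k. (\<forall>i. a k i \<ge> b) \<and> summable (\<lambda>i. \<bar>c k i\<bar> * z0 powr (- a k i)) \<and>
        (\<Sum>i. \<bar>c k i\<bar> * z0 powr (- a k i)) \<le> B k \<and> (\<forall>z\<ge>z0. F k z = (\<Sum>i. c k i * z powr (- a k i)))"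
    by (elim exE)
  have a: "\<And>k i. a k i \<ge> b"
    and summ: "\<And>k. summable (\<lambda>i. \<bar>c k i\<bar> * z0 powr (- a k i))"
    and le: "\<And>k. (\<Sum>i. \<bar>c k i\<bar> * z0 powr (- a k i)) \<le> B k"
    and F_eq: "\<And>k z. z \<ge> z0 \<Longrightarrow> F k z = (\<Sum>i. c k i * z powr (- a k i))"
    using ca by blast+
  define C A where "C = (\<lambda>(k, i). c k i)" and "A = (\<lambda>(k, i). a k i)"
  have son: "(\<lambda>i. \<bar>c k i\<bar> * z0 powr (- a k i)) summable_on UNIV" for k
    using summ[of k] by (simp add: summable_on_UNIV_nonneg_real_iff)
  have isum: "(\<Sum>\<^sub>\<infinity>i. \<bar>c k i\<bar> * z0 powr (- a k i)) = (\<Sum>i. \<bar>c k i\<bar> * z0 powr (- a k i))" for k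
    by (rule infsum_nat_eq_suminf[OF son])
  have nonneg: "(\<Sum>i. \<bar>c k i\<bar> * z0 powr (- a k i)) \<ge> 0" for k
    by (intro suminf_nonneg summ) auto
  have summ_k: "summable (\<lambda>k. \<Sum>i. \<bar>c k i\<bar> * z0 powr (- a k i))"
    by (rule summable_comparison_test'[OF B, of 0]) (use nonneg le in auto)
  have abs: "(\<lambda>x. \<bar>C x\<bar> * z0 powr (- A x)) summable_on UNIV"
  proof -
    have "(\<lambda>x. norm (\<bar>C x\<bar> * z0 powr (- A x))) summable_on (SIGMA k:UNIV. UNIV)"
      unfolding Infinite_Sum.abs_summable_on_Sigma_iff
      using son summ_k nonneg by (simp add: C_def A_def isum abs_mult summable_on_UNIV_nonneg_real_iff)
    then show ?thesis by (simp add: abs_mult)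
  qed
  have total: "infsum (\<lambda>x. \<bar>C x\<bar> * z0 powr (- A x)) UNIV = (\<Sum>k. \<Sum>i. \<bar>c k i\<bar> * z0 powr (- a k i))"
  proof -
    have "infsum (\<lambda>x. \<bar>C x\<bar> * z0 powr (- A x)) (SIGMA k:UNIV. UNIV) =
            (\<Sum>\<^sub>\<infinity>k. \<Sum>\<^sub>\<infinity>i. \<bar>c k i\<bar> * z0 powr (- a k i))"
      using infsum_Sigma_banach[of "\<lambda>x. \<bar>C x\<bar> * z0 powr (- A x)" UNIV "\<lambda>_. UNIV"] abs
      by (simp add: C_def A_def)
    then show ?thesis
      using infsum_nat_eq_suminf[of "\<lambda>k. \<Sum>i. \<bar>c k i\<bar> * z0 powr (- a k i)"] summ_k nonneg
      by (simp add: isum summable_on_UNIV_nonneg_real_iff)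
  qed
  obtain c' a' :: "nat \<Rightarrow> real" where a': "\<And>n. a' n \<ge> b"
    and 1: "\<And>g. (\<lambda>i. \<bar>C i\<bar> * g (A i) :: real) summable_on UNIV \<Longrightarrow> summable (\<lambda>n. \<bar>c' n\<bar> * g (a' n)) \<and>
          infsum (\<lambda>i. \<bar>C i\<bar> * g (A i)) UNIV = (\<Sum>n. \<bar>c' n\<bar> * g (a' n))"
    and 2: "\<And>g. (\<lambda>i. C i * g (A i) :: real) summable_on UNIV \<Longrightarrow>
          infsum (\<lambda>i. C i * g (A i)) UNIV = (\<Sum>n. c' n * g (a' n))"
    by (rule enumerate_expansion[of "UNIV :: (nat \<times> nat) set" b A C]) (auto simp: A_def a)
  show ?thesis
    unfolding has_frac_expansion_def
  proof (intro exI conjI allI impI)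
    show "a' n \<ge> b" for n by (rule a')
    show "summable (\<lambda>n. \<bar>c' n\<bar> * z0 powr (- a' n))"
      using 1[of "\<lambda>x. z0 powr (- x)"] abs by simp
    have "(\<Sum>n. \<bar>c' n\<bar> * z0 powr (- a' n)) = (\<Sum>k. \<Sum>i. \<bar>c k i\<bar> * z0 powr (- a k i))"
      using 1[of "\<lambda>x. z0 powr (- x)"] abs total by simp
    also have "\<dots> \<le> (\<Sum>k. B k)"
      by (rule suminf_le[OF le summ_k B])
    finally show "(\<Sum>n. \<bar>c' n\<bar> * z0 powr (- a' n)) \<le> (\<Sum>k. B k)" .
    fix z assume z: "z \<ge> z0"
    have abs_z: "(\<lambda>x. C x * z powr (- A x)) summable_on UNIV"
    proof (rule abs_summable_summable, rule Infinite_Sum.abs_summable_on_comparison_test'[OF abs])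
      fix x
      have "A x \<ge> 0" using order_trans[OF b a] by (cases x) (simp add: A_def)
      then show "norm (C x * z powr (- A x)) \<le> \<bar>C x\<bar> * z0 powr (- A x)"
        unfolding real_norm_def abs_mult
        using z0 z by (intro mult_mono) (simp_all add: powr_mono2')
    qed
    have son_z: "(\<lambda>i. c k i * z powr (- a k i)) summable_on UNIV" for k
      using summable_on_SigmaD1[where x = k and f = "\<lambda>k i. c k i * z powr (- a k i)" and A = UNIV and B = "\<lambda>_. UNIV"] abs_z
      by (simp add: C_def A_def case_prod_unfold)
    have Fk: "F k z = (\<Sum>\<^sub>\<infinity>i. c k i * z powr (- a k i))" for k
      using F_eq[OF z] infsum_nat_eq_suminf[OF son_z] by simp
    have "(\<lambda>k. \<Sum>\<^sub>\<infinity>i. c k i * z powr (- a k i)) summable_on UNIV"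
      using summable_on_Sigma_banach[of "\<lambda>k i. c k i * z powr (- a k i)" UNIV "\<lambda>_. UNIV"] abs_z
      by (simp add: C_def A_def case_prod_unfold)
    then have "(\<Sum>k. F k z) = (\<Sum>\<^sub>\<infinity>k. F k z)"
      unfolding Fk by (rule infsum_nat_eq_suminf[symmetric])
    also have "\<dots> = infsum (\<lambda>x. C x * z powr (- A x)) UNIV"
      using infsum_Sigma_banach[of "\<lambda>x. C x * z powr (- A x)" UNIV "\<lambda>_. UNIV"] abs_z
      by (simp add: C_def A_def Fk)
    also have "\<dots> = (\<Sum>n. c' n * z powr (- a' n))"
      by (rule 2[OF abs_z])
    finally show "(\<Sum>k. F k z) = (\<Sum>n. c' n * z powr (- a' n))" .
  qed
qed

lemma has_frac_expansion_monomial_mult: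
  assumes G: "has_frac_expansion b z0 B G" and a: "a \<ge> 0" and b: "b \<ge> 0" and z0: "z0 > 0"
  shows "has_frac_expansion (a + b) z0 (\<bar>c\<bar> * z0 powr (- a) * B) (\<lambda>z. c * z powr (- a) * G z)"
proof -
  obtain c' a' :: "nat \<Rightarrow> real" where ca: "\<And>i. a' i \<ge> b" "summable (\<lambda>i. \<bar>c' i\<bar> * z0 powr (- a' i))"
      "(\<Sum>i. \<bar>c' i\<bar> * z0 powr (- a' i)) \<le> B" "\<And>z. z \<ge> z0 \<Longrightarrow> G z = (\<Sum>i. c' i * z powr (- a' i))"
    using G unfolding has_frac_expansion_def by blast
  interpret frac_power_series c' a' z0
    using ca b z0 order_trans[OF b] by unfold_locales auto
  have eq: "\<bar>c * c' i\<bar> * z0 powr (- (a + a' i)) = \<bar>c\<bar> * z0 powr (- a) * (\<bar>c' i\<bar> * z0 powr (- a' i))" for i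
    using z0 by (simp add: abs_mult powr_add[symmetric])
  show ?thesis
    unfolding has_frac_expansion_def
  proof (rule exI[of _ "\<lambda>i. c * c' i"], rule exI[of _ "\<lambda>i. a + a' i"], intro conjI allI impI)
    show "a + b \<le> a + a' i" for i using ca(1) by simp
    show "summable (\<lambda>i. \<bar>c * c' i\<bar> * z0 powr (- (a + a' i)))"
      unfolding eq by (rule summable_mult[OF ca(2)])
    show "(\<Sum>i. \<bar>c * c' i\<bar> * z0 powr (- (a + a' i))) \<le> \<bar>c\<bar> * z0 powr (- a) * B"
      unfolding eq suminf_mult[OF ca(2)] by (intro mult_left_mono ca(3)) auto
    fix z assume z: "z \<ge> z0"
    have eq': "c * c' i * z powr (- (a + a' i)) = c * z powr (- a) * (c' i * z powr (- a' i))" for i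
      using z0 z by (simp add: powr_add[symmetric])
    show "c * z powr (- a) * G z = (\<Sum>i. c * c' i * z powr (- (a + a' i)))"
      unfolding eq' ca(4)[OF z] by (rule suminf_mult[OF summable_signed[OF z], symmetric])
  qed
qed

lemma has_frac_expansion_1:
  assumes "z0 > 0" shows "has_frac_expansion 0 z0 1 (\<lambda>_. 1)"
proof -
  have eq: "(\<lambda>i::nat. \<bar>if i = 0 then 1 else 0\<bar> * z0 powr (- 0)) = (\<lambda>i. if i = 0 then 1 else 0)"
    using assms by auto
  have "(\<Sum>i::nat. (if i = 0 then 1 else 0) * z powr (- 0)) = 1" if "z \<ge> z0" for z :: real
    using that assms suminf_finite[of "{0::nat}" "\<lambda>i. (if i = 0 then 1 else 0) * z powr (- 0)"] by simp
  moreover have "summable (\<lambda>i::nat. if i = 0 then 1 else 0 :: real)"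
    "(\<Sum>i::nat. if i = 0 then 1 else 0 :: real) = 1"
    using suminf_finite[of "{0::nat}" "\<lambda>i. if i = 0 then 1 else 0 :: real"]
      summable_finite[of "{0::nat}" "\<lambda>i. if i = 0 then 1 else 0 :: real"] by simp_all
  ultimately show ?thesis
    unfolding has_frac_expansion_def
    by (intro exI[of _ "\<lambda>i. if i = 0 then 1 else 0"] exI[of _ "\<lambda>_. 0"]) (simp add: eq)
qed

lemma has_frac_expansion_monomial:
  assumes "z0 > 0" "a \<ge> 0"
  shows "has_frac_expansion a z0 (\<bar>c\<bar> * z0 powr (- a)) (\<lambda>z. c * z powr (- a))"
  using has_frac_expansion_monomial_mult[OF has_frac_expansion_1[OF assms(1)] assms(2) _ assms(1), of c] by simp

lemma has_frac_expansion_cmult: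
  assumes "has_frac_expansion b z0 B G" "b \<ge> 0" "z0 > 0"
  shows "has_frac_expansion b z0 (\<bar>c\<bar> * B) (\<lambda>z. c * G z)"
  by (rule has_frac_expansion_mono[OF has_frac_expansion_monomial_mult[OF assms(1), of 0 c]]) (use assms in auto)

text \<open>The product is the sum, over the terms of \<open>F\<close>, of monomials times \<open>G\<close>.\<close>

lemma has_frac_expansion_mult:
  assumes F: "has_frac_expansion b z0 B F" and G: "has_frac_expansion b' z0 B' G"
    and b: "b \<ge> 0" "b' \<ge> 0" and z0: "z0 > 0"
  shows "has_frac_expansion (b + b') z0 (B * B') (\<lambda>z. F z * G z)"
proof -
  obtain c a :: "nat \<Rightarrow> real" where ca: "\<And>i. a i \<ge> b" "summable (\<lambda>i. \<bar>c i\<bar> * z0 powr (- a i))"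
      "(\<Sum>i. \<bar>c i\<bar> * z0 powr (- a i)) \<le> B" "\<And>z. z \<ge> z0 \<Longrightarrow> F z = (\<Sum>i. c i * z powr (- a i))"
    using F unfolding has_frac_expansion_def by blast
  interpret frac_power_series c a z0
    using ca b z0 order_trans[OF b(1)] by unfold_locales auto
  have "has_frac_expansion (b + b') z0 (\<Sum>k. \<bar>c k\<bar> * z0 powr (- a k) * B') (\<lambda>z. \<Sum>k. c k * z powr (- a k) * G z)"
  proof (rule has_frac_expansion_suminf)
    show "has_frac_expansion (b + b') z0 (\<bar>c k\<bar> * z0 powr (- a k) * B') (\<lambda>z. c k * z powr (- a k) * G z)" for k
      by (rule has_frac_expansion_mono[OF has_frac_expansion_monomial_mult[OF G a_nonneg b(2) z0]])
         (use ca(1) in auto)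
  qed (use b z0 in \<open>auto intro: summable_mult2 ca\<close>)
  then show ?thesis
  proof (rule has_frac_expansion_mono)
    have "(\<Sum>k. \<bar>c k\<bar> * z0 powr (- a k) * B') = (\<Sum>k. \<bar>c k\<bar> * z0 powr (- a k)) * B'"
      by (rule suminf_mult2[symmetric, OF ca(2)])
    also have "\<dots> \<le> B * B'"
      by (rule mult_right_mono[OF ca(3) has_frac_expansion_nonneg[OF G]])
    finally show "(\<Sum>k. \<bar>c k\<bar> * z0 powr (- a k) * B') \<le> B * B'" .
    fix z assume z: "z \<ge> z0"
    show "F z * G z = (\<Sum>k. c k * z powr (- a k) * G z)"
      unfolding ca(4)[OF z] by (rule suminf_mult2[OF summable_signed[OF z]])
  qed simp
qed

lemma has_frac_expansion_add:
  assumes F: "has_frac_expansion b z0 B F" and G: "has_frac_expansion b z0 B' G"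
    and b: "b \<ge> 0" and z0: "z0 > 0"
  shows "has_frac_expansion b z0 (B + B') (\<lambda>z. F z + G z)"
proof -
  define H where "H k = (if k = 0 then F else if k = 1 then G else (\<lambda>_. 0))" for k :: nat
  define C where "C k = (if k = 0 then B else if k = 1 then B' else 0)" for k :: nat
  have 0: "has_frac_expansion b z0 0 (\<lambda>_. 0)"
    using has_frac_expansion_cmult[OF F b z0, of 0] by simp
  have C: "C sums (\<Sum>k<2. C k)"
    by (rule sums_finite) (auto simp: C_def)
  have H: "(\<lambda>k. H k z) sums (\<Sum>k<2. H k z)" for z
    by (rule sums_finite) (auto simp: H_def)
  have "has_frac_expansion b z0 (\<Sum>k. C k) (\<lambda>z. \<Sum>k. H k z)"
  proof (rule has_frac_expansion_suminf)
    show "has_frac_expansion b z0 (C k) (H k)" for k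
      using F G 0 by (simp add: C_def H_def)
    show "summable C" using C by (rule sums_summable)
  qed (use b z0 in auto)
  moreover have "(\<Sum>k. C k) = B + B'"
  proof -
    have "(\<Sum>k<2. C k) = B + B'" by (simp add: C_def numeral_2_eq_2)
    then show ?thesis by (rule trans[OF sums_unique[OF C, symmetric]])
  qed
  moreover have "(\<Sum>k. H k z) = F z + G z" for z
  proof -
    have "(\<Sum>k<2. H k z) = F z + G z" by (simp add: H_def numeral_2_eq_2)
    then show ?thesis by (rule trans[OF sums_unique[OF H[of z], symmetric]])
  qed
  ultimately show ?thesis by simp
qed

lemma has_frac_expansion_sum:
  assumes "finite J" "\<And>j. j \<in> J \<Longrightarrow> has_frac_expansion b z0 (B j) (F j)" "b \<ge> 0" "z0 > 0"
  shows "has_frac_expansion b z0 (\<Sum>j\<in>J. B j) (\<lambda>z. \<Sum>j\<in>J. F j z)"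
  using assms(1,2)
proof (induction J rule: finite_induct)
  case empty
  have "has_frac_expansion b z0 (\<bar>0\<bar> * z0 powr (- b)) (\<lambda>z. 0 * z powr (- b))"
    by (rule has_frac_expansion_monomial) (use assms in auto)
  then show ?case by simp
next
  case (insert j J)
  then show ?case using has_frac_expansion_add[of b z0 "B j" "F j" "\<Sum>j\<in>J. B j" "\<lambda>z. \<Sum>j\<in>J. F j z"] assms by simp
qed

lemma has_frac_expansion_power:
  assumes "has_frac_expansion 0 z0 B X" "z0 > 0"
  shows "has_frac_expansion 0 z0 (B ^ k) (\<lambda>z. X z ^ k)"
proof (induction k)
  case (Suc k)
  then show ?case using has_frac_expansion_mult[OF assms(1) Suc] assms by simp
qed (use has_frac_expansion_1[OF assms(2)] in simp)

text \<open>The Neumann series \<open>\<Sum>k. (- X) ^ k\<close>.\<close>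

lemma has_frac_expansion_inverse_1_plus:
  assumes X: "has_frac_expansion 0 z0 B X" and B: "B < 1" and z0: "z0 > 0"
  shows "has_frac_expansion 0 z0 (1 / (1 - B)) (\<lambda>z. 1 / (1 + X z))"
proof -
  have B0: "B \<ge> 0" by (rule has_frac_expansion_nonneg[OF X])
  have "has_frac_expansion 0 z0 (\<bar>-1\<bar> * B) (\<lambda>z. -1 * X z)"
    by (rule has_frac_expansion_cmult[OF X _ z0]) simp
  then have "has_frac_expansion 0 z0 (\<Sum>k. B ^ k) (\<lambda>z. \<Sum>k. (- X z) ^ k)"
    using B B0 z0 by (intro has_frac_expansion_suminf has_frac_expansion_power summable_geometric) auto
  moreover have "(\<Sum>k. (- X z) ^ k) = 1 / (1 + X z)" if "z \<ge> z0" for z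
    using has_frac_expansion_abs_le[OF X _ z0 that] B suminf_geometric[of "- X z"] by simp
  moreover have "(\<Sum>k. B ^ k) = 1 / (1 - B)"
    using B B0 by (intro suminf_geometric) simp
  ultimately show ?thesis by (auto elim!: has_frac_expansion_mono)
qed

text \<open>Factor out the highest power \<open>z powr \<beta>\<close>, with the total coefficient \<open>m\<close> of all the terms that have this
  order. The rest is \<open>1 + X\<close>, where \<open>X\<close> consists of negative powers of \<open>z\<close> with positive coefficients. So the
  norm of \<open>X\<close> at \<open>z0\<close> is \<open>X z0\<close>, which is less than 1 for large \<open>z0\<close>.\<close>

lemma has_frac_expansion_inverse_multi_term:
  fixes mu nu :: "'j \<Rightarrow> real"
  assumes J: "finite J" "J \<noteq> {}" and mu: "\<And>j. j \<in> J \<Longrightarrow> mu j > 0"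
    and nu: "\<And>j. j \<in> J \<Longrightarrow> nu j > 0" and Lam: "Lam > 0"
  obtains \<beta> z0 B where "\<beta> > 0" "z0 > 0" "\<And>j. j \<in> J \<Longrightarrow> nu j \<le> \<beta>"
    "has_frac_expansion \<beta> z0 B (\<lambda>z. 1 / ((\<Sum>j\<in>J. mu j * z powr nu j) + Lam))"
proof -
  define \<beta> where "\<beta> = Max (nu ` J)"
  have \<beta>_ge: "nu j \<le> \<beta>" if "j \<in> J" for j using J that by (simp add: \<beta>_def)
  have "\<beta> \<in> nu ` J" unfolding \<beta>_def using J by (intro Max_in) auto
  then obtain j0 where j0: "j0 \<in> J" "nu j0 = \<beta>" by auto
  have \<beta>: "\<beta> > 0" using nu[OF j0(1)] j0 by simp
  define J1 J2 where "J1 = {j \<in> J. nu j = \<beta>}" and "J2 = {j \<in> J. nu j < \<beta>}"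
  have J12: "J = J1 \<union> J2" "J1 \<inter> J2 = {}" "finite J1" "finite J2"
    using J \<beta>_ge by (auto simp: J1_def J2_def order_le_less)
  define m where "m = (\<Sum>j\<in>J1. mu j)"
  have m: "m > 0"
    unfolding m_def using J12 j0 mu by (intro sum_pos) (auto simp: J1_def)
  define X where "X z = (\<Sum>j\<in>J2. mu j / m * z powr (- (\<beta> - nu j))) + Lam / m * z powr (- \<beta>)" for z
  have "(X \<longlongrightarrow> (\<Sum>j\<in>J2. mu j / m * 0) + Lam / m * 0) at_top"
    unfolding X_def[abs_def]
    by (intro tendsto_intros tendsto_neg_powr filterlim_ident) (use \<beta> in \<open>auto simp: J2_def\<close>)
  then have "(X \<longlongrightarrow> 0) at_top" by simp
  then have "\<forall>\<^sub>F z in at_top. X z < 1" by (rule order_tendstoD) simp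
  then have "\<forall>\<^sub>F z in at_top. X z < 1 \<and> z > 0"
    using eventually_gt_at_top[of 0] by (rule eventually_conj)
  then obtain z0 where z0: "X z0 < 1" "z0 > 0"
    by (metis (no_types, lifting) eventually_at_top_linorder order_refl)
  have "has_frac_expansion 0 z0 ((\<Sum>j\<in>J2. mu j / m * z0 powr (- (\<beta> - nu j))) + Lam / m * z0 powr (- \<beta>)) X"
    unfolding X_def[abs_def]
  proof (intro has_frac_expansion_add has_frac_expansion_sum)
    show "has_frac_expansion 0 z0 (mu j / m * z0 powr (- (\<beta> - nu j))) (\<lambda>z. mu j / m * z powr (- (\<beta> - nu j)))"
      if "j \<in> J2" for j
      by (rule has_frac_expansion_mono[OF has_frac_expansion_monomial[OF z0(2), of "\<beta> - nu j" "mu j / m"]])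
         (use that m mu[of j] in \<open>auto simp: J2_def\<close>)
    show "has_frac_expansion 0 z0 (Lam / m * z0 powr (- \<beta>)) (\<lambda>z. Lam / m * z powr (- \<beta>))"
      by (rule has_frac_expansion_mono[OF has_frac_expansion_monomial[OF z0(2), of \<beta> "Lam / m"]])
         (use m \<beta> Lam in auto)
  qed (use J12 z0 in auto)
  then have X: "has_frac_expansion 0 z0 (X z0) X" by (simp add: X_def)
  have "has_frac_expansion (\<beta> + 0) z0 (\<bar>1 / m\<bar> * z0 powr (- \<beta>) * (1 / (1 - X z0)))
          (\<lambda>z. 1 / m * z powr (- \<beta>) * (1 / (1 + X z)))"
    by (intro has_frac_expansion_monomial_mult has_frac_expansion_inverse_1_plus X z0) (use \<beta> in auto)
  moreover have "1 / m * z powr (- \<beta>) * (1 / (1 + X z)) = 1 / ((\<Sum>j\<in>J. mu j * z powr nu j) + Lam)"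
    if z: "z \<ge> z0" for z
  proof -
    have z_pos: "z > 0" using z z0 by simp
    have "m * z powr \<beta> * X z = (\<Sum>j\<in>J2. mu j * z powr nu j) + Lam"
    proof -
      have "m * z powr \<beta> * X z =
          (\<Sum>j\<in>J2. mu j * (z powr \<beta> * z powr (- (\<beta> - nu j)))) + Lam * (z powr \<beta> * z powr (- \<beta>))"
        using m by (simp add: X_def distrib_left sum_distrib_left mult_ac)
      also have "\<dots> = (\<Sum>j\<in>J2. mu j * z powr nu j) + Lam"
        using z_pos by (simp add: powr_add[symmetric])
      finally show ?thesis .
    qed
    moreover have "(\<Sum>j\<in>J. mu j * z powr nu j) = m * z powr \<beta> + (\<Sum>j\<in>J2. mu j * z powr nu j)"
    proof -
      have "(\<Sum>j\<in>J. mu j * z powr nu j) = (\<Sum>j\<in>J1. mu j * z powr nu j) + (\<Sum>j\<in>J2. mu j * z powr nu j)"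
        unfolding J12(1) using J12(2-4) by (intro sum.union_disjoint) auto
      also have "(\<Sum>j\<in>J1. mu j * z powr nu j) = m * z powr \<beta>"
        unfolding m_def sum_distrib_right by (rule sum.cong) (auto simp: J1_def)
      finally show ?thesis .
    qed
    ultimately have "(\<Sum>j\<in>J. mu j * z powr nu j) + Lam = m * z powr \<beta> * (1 + X z)"
      by (simp add: distrib_left)
    then show ?thesis using z_pos by (simp add: powr_minus divide_inverse)
  qed
  ultimately have "has_frac_expansion \<beta> z0 (\<bar>1 / m\<bar> * z0 powr (- \<beta>) * (1 / (1 - X z0)))
      (\<lambda>z. 1 / ((\<Sum>j\<in>J. mu j * z powr nu j) + Lam))"
    by (auto elim!: has_frac_expansion_mono)
  with \<beta> z0 \<beta>_ge show ?thesis by (intro that[of \<beta> z0]) auto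
qed

section \<open>State probabilities of the generalized counting process\<close>

lemma sum_atMost_split_0: "(\<Sum>j\<le>n. f j) = f 0 + (\<Sum>j=1..n. f j)" for f :: "nat \<Rightarrow> real"
  by (simp add: atMost_atLeast0 sum.atLeast_Suc_atMost)

locale generalized_counting = prob_space P for P :: "'a measure" +
  fixes k :: nat and lam :: "nat \<Rightarrow> real" and M :: "real \<Rightarrow> 'a \<Rightarrow> nat"
  assumes gcp: "generalized_counting_process P k lam M"
begin

text \<open>Constant on negative times, which makes it continuous on the whole line.\<close>

definition state_prob :: "nat \<Rightarrow> real \<Rightarrow> real" where "state_prob n s = \<P>(\<omega> in P. M (max 0 s) \<omega> = n)"

lemma M_measurable [measurable]: "t \<ge> 0 \<Longrightarrow> M t \<in> measurable P (count_space UNIV)"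
  using gcp by (simp add: generalized_counting_process_def counting_process_def)

lemma M_events: "t \<ge> 0 \<Longrightarrow> {\<omega> \<in> space P. R (M t \<omega>)} \<in> sets P"
  by measurable

lemma M_mono: "\<omega> \<in> space P \<Longrightarrow> 0 \<le> s \<Longrightarrow> s \<le> t \<Longrightarrow> M s \<omega> \<le> M t \<omega>"
  using gcp by (auto simp: generalized_counting_process_def counting_process_def mono_on_def)

lemma M_0: "AE \<omega> in P. M 0 \<omega> = 0"
  using gcp by (simp add: generalized_counting_process_def)

lemma state_prob_bounds: "0 \<le> state_prob n s" "state_prob n s \<le> 1"
  by (auto simp: state_prob_def)

lemma state_prob_0: "state_prob n 0 = (if n = 0 then 1 else 0)"
proof (cases "n = 0")
  case True
  then show ?thesis using M_0 by (auto simp: state_prob_def intro!: prob_Collect_eq_1[THEN iffD2] M_events)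
next
  case False
  then have "AE \<omega> in P. \<not> M 0 \<omega> = n" using M_0 by (auto elim!: eventually_mono)
  then show ?thesis
    using False prob_Collect_eq_0[OF M_events[of 0 "\<lambda>m. m = n"]] by (simp add: state_prob_def)
qed

lemma increment_law:
  assumes s: "s \<ge> 0" and h: "h \<ge> 0"
  shows "\<P>(\<omega> in P. real (M (s + h) \<omega>) - real (M s \<omega>) = real j) = state_prob j h"
proof -
  have [measurable]: "(\<lambda>\<omega>. real (M t \<omega>)) \<in> borel_measurable P" if "t \<ge> 0" for t
    using that by measurable
  have "distr P borel (\<lambda>\<omega>. real (M (s + h) \<omega>) - real (M s \<omega>)) =
          distr P borel (\<lambda>\<omega>. real (M (0 + h) \<omega>) - real (M 0 \<omega>))"
    using gcp s h unfolding generalized_counting_process_def stationary_increments_def by blast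
  then have "measure (distr P borel (\<lambda>\<omega>. real (M (s + h) \<omega>) - real (M s \<omega>))) {real j} =
      measure (distr P borel (\<lambda>\<omega>. real (M (0 + h) \<omega>) - real (M 0 \<omega>))) {real j}"
    by simp
  then have "prob ((\<lambda>\<omega>. real (M (s + h) \<omega>) - real (M s \<omega>)) -` {real j} \<inter> space P) =
      prob ((\<lambda>\<omega>. real (M (0 + h) \<omega>) - real (M 0 \<omega>)) -` {real j} \<inter> space P)"
    using s h by (subst (asm) (1 2) measure_distr) measurable
  moreover have "(\<lambda>\<omega>. real (M (s + h) \<omega>) - real (M s \<omega>)) -` {real j} \<inter> space P =
      {\<omega> \<in> space P. real (M (s + h) \<omega>) - real (M s \<omega>) = real j}" by auto
  moreover have "(\<lambda>\<omega>. real (M (0 + h) \<omega>) - real (M 0 \<omega>)) -` {real j} \<inter> space P =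
      {\<omega> \<in> space P. real (M h \<omega>) - real (M 0 \<omega>) = real j}" by auto
  ultimately have "\<P>(\<omega> in P. real (M (s + h) \<omega>) - real (M s \<omega>) = real j) =
      \<P>(\<omega> in P. real (M h \<omega>) - real (M 0 \<omega>) = real j)" by simp
  also have "\<dots> = \<P>(\<omega> in P. M h \<omega> = j)"
    using M_0 h by (intro prob_eq_AE) (auto elim!: eventually_mono)
  finally show ?thesis using h by (simp add: state_prob_def)
qed

text \<open>The increments over \<open>[0, s]\<close> and \<open>[s, s + h]\<close> are independent, and the second one has the law of \<open>M h\<close>.\<close>

lemma state_prob_semigroup:
  assumes s: "s \<ge> 0" and h: "h \<ge> 0"
  shows "state_prob n (s + h) = (\<Sum>j\<le>n. state_prob j h * state_prob (n - j) s)"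
proof (cases "s = 0 \<or> h = 0")
  case True
  then show ?thesis
  proof
    assume "s = 0"
    have "(\<Sum>j\<le>n. state_prob j h * state_prob (n - j) 0) = (\<Sum>j\<in>{n}. state_prob j h * state_prob (n - j) 0)"
      by (rule sum.mono_neutral_right) (auto simp: state_prob_0)
    then show ?thesis using \<open>s = 0\<close> by (simp add: state_prob_0)
  next
    assume "h = 0"
    have "(\<Sum>j\<le>n. state_prob j 0 * state_prob (n - j) s) = (\<Sum>j\<in>{0}. state_prob j 0 * state_prob (n - j) s)"
      by (rule sum.mono_neutral_right) (auto simp: state_prob_0)
    then show ?thesis using \<open>h = 0\<close> by (simp add: state_prob_0)
  qed
next
  case False
  then have s0: "s > 0" and h0: "h > 0" using s h by auto
  have [measurable]: "(\<lambda>\<omega>. real (M t \<omega>)) \<in> borel_measurable P" if "t \<ge> 0" for t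
    using that by measurable
  define \<tau> where "\<tau> i = (if i = 0 then 0 else if i = Suc 0 then s else s + h)" for i :: nat
  have "strict_mono_on {..2} \<tau>"
    using s0 h0 by (auto simp: strict_mono_on_def \<tau>_def)
  moreover have "0 \<le> \<tau> 0" by (simp add: \<tau>_def)
  moreover have "independent_increments P (\<lambda>t \<omega>. real (M t \<omega>))"
    using gcp by (simp add: generalized_counting_process_def)
  ultimately have indep: "indep_vars (\<lambda>_. borel) (\<lambda>i \<omega>. real (M (\<tau> (Suc i)) \<omega>) - real (M (\<tau> i) \<omega>)) {..<2}"
    unfolding independent_increments_def by blast
  define E where "E j = {\<omega> \<in> space P. real (M s \<omega>) - real (M 0 \<omega>) = real (n - j) \<and>
      real (M (s + h) \<omega>) - real (M s \<omega>) = real j}" for j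
  have E_sets: "E j \<in> sets P" for j
    unfolding E_def using s h add_nonneg_nonneg[OF s h] by measurable
  have E_prob: "prob (E j) = state_prob j h * state_prob (n - j) s" for j
  proof -
    define A where "A i = (if i = 0 then {real (n - j)} else {real j})" for i :: nat
    have "prob (\<Inter>i\<in>{..<2}. (\<lambda>\<omega>. real (M (\<tau> (Suc i)) \<omega>) - real (M (\<tau> i) \<omega>)) -` A i \<inter> space P) =
        (\<Prod>i\<in>{..<2}. prob ((\<lambda>\<omega>. real (M (\<tau> (Suc i)) \<omega>) - real (M (\<tau> i) \<omega>)) -` A i \<inter> space P))"
      by (rule indep_varsD_finite[OF indep]) (auto simp: A_def lessThan_empty_iff)
    moreover have "(\<Inter>i\<in>{..<2}. (\<lambda>\<omega>. real (M (\<tau> (Suc i)) \<omega>) - real (M (\<tau> i) \<omega>)) -` A i \<inter> space P) = E j"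
      by (auto simp: E_def A_def \<tau>_def numeral_2_eq_2 lessThan_Suc)
    moreover have "(\<lambda>\<omega>. real (M (\<tau> (Suc 0)) \<omega>) - real (M (\<tau> 0) \<omega>)) -` A 0 \<inter> space P =
        {\<omega> \<in> space P. real (M (0 + s) \<omega>) - real (M 0 \<omega>) = real (n - j)}"
      by (auto simp: A_def \<tau>_def)
    moreover have "(\<lambda>\<omega>. real (M (\<tau> (Suc 1)) \<omega>) - real (M (\<tau> 1) \<omega>)) -` A 1 \<inter> space P =
        {\<omega> \<in> space P. real (M (s + h) \<omega>) - real (M s \<omega>) = real j}"
      by (auto simp: A_def \<tau>_def)
    ultimately show ?thesis
      using increment_law[of 0 s "n - j"] increment_law[OF s h, of j] s
      by (simp add: numeral_2_eq_2 lessThan_Suc)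
  qed
  have "state_prob n (s + h) = prob (\<Union>j\<le>n. E j)"
    unfolding state_prob_def
  proof (rule finite_measure_eq_AE)
    show "AE \<omega> in P. \<omega> \<in> {\<omega> \<in> space P. M (max 0 (s + h)) \<omega> = n} \<longleftrightarrow> \<omega> \<in> (\<Union>j\<le>n. E j)"
      using M_0 AE_space
    proof eventually_elim
      case (elim \<omega>)
      have "M s \<omega> \<le> M (s + h) \<omega>" using M_mono[of \<omega> s "s + h"] elim s h by simp
      then show ?case
        using elim s h by (auto simp: E_def of_nat_diff max_def intro!: bexI[of _ "M (s + h) \<omega> - M s \<omega>"])
    qed
  qed (use s h E_sets in \<open>auto intro!: M_events\<close>)
  also have "\<dots> = (\<Sum>j\<le>n. prob (E j))"
  proof (rule finite_measure_finite_Union)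
    show "disjoint_family_on E {..n}" by (auto simp: disjoint_family_on_def E_def)
  qed (use E_sets in auto)
  finally show ?thesis by (simp add: E_prob)
qed

lemma state_prob_0_eq:
  assumes "h \<ge> 0"
  shows "state_prob 0 h = 1 - (\<Sum>j=1..k. state_prob j h) - \<P>(\<omega> in P. M h \<omega> > k)"
proof -
  have "prob (\<Union>j\<in>{0..k}. {\<omega> \<in> space P. M h \<omega> = j}) = (\<Sum>j=0..k. prob {\<omega> \<in> space P. M h \<omega> = j})"
    by (rule finite_measure_finite_Union) (use assms in \<open>auto simp: disjoint_family_on_def intro!: M_events\<close>)
  also have "(\<Union>j\<in>{0..k}. {\<omega> \<in> space P. M h \<omega> = j}) = space P - {\<omega> \<in> space P. M h \<omega> > k}"
    by (auto simp: not_less)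
  also have "prob \<dots> = 1 - \<P>(\<omega> in P. M h \<omega> > k)"
    by (rule prob_compl) (rule M_events[OF assms])
  finally show ?thesis using assms by (simp add: state_prob_def sum.atLeast_Suc_atMost)
qed

lemma sum_state_prob_le:
  assumes "h \<ge> 0"
  shows "(\<Sum>j=1..n. state_prob j h) \<le> 1 - state_prob 0 h"
proof -
  have "(\<Sum>j=0..n. prob {\<omega> \<in> space P. M h \<omega> = j}) = prob (\<Union>j\<in>{0..n}. {\<omega> \<in> space P. M h \<omega> = j})"
    by (rule finite_measure_finite_Union[symmetric]) (use assms in \<open>auto simp: disjoint_family_on_def intro!: M_events\<close>)
  also have "\<dots> \<le> 1" by simp
  finally show ?thesis using assms by (simp add: state_prob_def sum.atLeast_Suc_atMost)
qed

lemma tail_rate: "((\<lambda>h. \<P>(\<omega> in P. M h \<omega> > k) / h) \<longlongrightarrow> 0) (at_right 0)"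
  using gcp smalloD_tendsto[of "\<lambda>h. \<P>(\<omega> in P. M h \<omega> > k)" "at_right 0" "\<lambda>h. h"]
  by (simp add: generalized_counting_process_def)

lemma jump_rate:
  assumes "j \<ge> 1"
  shows "((\<lambda>h. state_prob j h / h) \<longlongrightarrow> (if j \<le> k then lam j else 0)) (at_right 0)"
proof (cases "j \<le> k")
  case True
  have "(\<lambda>h. \<P>(\<omega> in P. M h \<omega> = j) - lam j * h) \<in> o[at_right 0](\<lambda>h. h)"
    using gcp True assms by (simp add: generalized_counting_process_def)
  then have "((\<lambda>h. (\<P>(\<omega> in P. M h \<omega> = j) - lam j * h) / h) \<longlongrightarrow> 0) (at_right 0)"
    by (rule smalloD_tendsto)
  then have "((\<lambda>h. (\<P>(\<omega> in P. M h \<omega> = j) - lam j * h) / h + lam j) \<longlongrightarrow> 0 + lam j) (at_right 0)"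
    by (intro tendsto_intros)
  moreover have "\<forall>\<^sub>F h in at_right 0. (\<P>(\<omega> in P. M h \<omega> = j) - lam j * h) / h + lam j = state_prob j h / h"
    using eventually_at_right_less[of 0] by eventually_elim (simp add: state_prob_def field_simps)
  ultimately have "((\<lambda>h. state_prob j h / h) \<longlongrightarrow> 0 + lam j) (at_right 0)"
    by (rule Lim_transform_eventually)
  then show ?thesis using True by simp
next
  case False
  show ?thesis
  proof (rule tendsto_sandwich[where f = "\<lambda>_. 0" and h = "\<lambda>h. \<P>(\<omega> in P. M h \<omega> > k) / h"])
    show "((\<lambda>h. \<P>(\<omega> in P. M h \<omega> > k) / h) \<longlongrightarrow> (if j \<le> k then lam j else 0)) (at_right 0)"
      using tail_rate False by simp
    show "\<forall>\<^sub>F h in at_right 0. 0 \<le> state_prob j h / h"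
      using eventually_at_right_less[of 0] by eventually_elim (simp add: state_prob_bounds)
    show "\<forall>\<^sub>F h in at_right 0. state_prob j h / h \<le> \<P>(\<omega> in P. M h \<omega> > k) / h"
      using eventually_at_right_less[of 0]
    proof eventually_elim
      case (elim h)
      have "prob {\<omega> \<in> space P. M h \<omega> = j} \<le> prob {\<omega> \<in> space P. M h \<omega> > k}"
        by (rule finite_measure_mono) (use False elim in \<open>auto intro!: M_events\<close>)
      then show ?case using elim by (simp add: state_prob_def divide_right_mono)
    qed
  qed (use False in auto)
qed

lemma holding_rate: "((\<lambda>h. (1 - state_prob 0 h) / h) \<longlongrightarrow> (\<Sum>j=1..k. lam j)) (at_right 0)"
proof -
  have "((\<lambda>h. (\<Sum>j=1..k. state_prob j h / h) + \<P>(\<omega> in P. M h \<omega> > k) / h) \<longlongrightarrow>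
      (\<Sum>j=1..k. if j \<le> k then lam j else 0) + 0) (at_right 0)"
    by (intro tendsto_intros tail_rate jump_rate) auto
  moreover have "\<forall>\<^sub>F h in at_right 0. (\<Sum>j=1..k. state_prob j h / h) + \<P>(\<omega> in P. M h \<omega> > k) / h = (1 - state_prob 0 h) / h"
    using eventually_at_right_less[of 0]
    by eventually_elim (simp add: state_prob_0_eq sum_divide_distrib[symmetric] add_divide_distrib[symmetric])
  ultimately have "((\<lambda>h. (1 - state_prob 0 h) / h) \<longlongrightarrow> (\<Sum>j=1..k. if j \<le> k then lam j else 0) + 0) (at_right 0)"
    by (rule Lim_transform_eventually)
  also have "(\<Sum>j=1..k. if j \<le> k then lam j else 0) = (\<Sum>j=1..k. lam j)"
    by (rule sum.cong) auto
  finally show ?thesis by simp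
qed

lemma state_prob_0_tendsto_1: "(state_prob 0 \<longlongrightarrow> 1) (at_right 0)"
proof -
  have "((\<lambda>h. 1 - h * ((1 - state_prob 0 h) / h)) \<longlongrightarrow> 1 - 0 * (\<Sum>j=1..k. lam j)) (at_right 0)"
    by (intro tendsto_intros holding_rate)
  moreover have "\<forall>\<^sub>F h in at_right 0. 1 - h * ((1 - state_prob 0 h) / h) = state_prob 0 h"
    using eventually_at_right_less[of 0] by eventually_elim simp
  ultimately have "(state_prob 0 \<longlongrightarrow> 1 - 0 * (\<Sum>j=1..k. lam j)) (at_right 0)"
    by (rule Lim_transform_eventually)
  then show ?thesis by simp
qed

text \<open>A change of state between \<open>s\<close> and \<open>s + h\<close> requires a jump, and this bound by its probability is uniform
  in \<open>s\<close>. It turns continuity at 0 into continuity everywhere.\<close>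

lemma state_prob_increment_le:
  assumes s: "s \<ge> 0" and h: "h \<ge> 0"
  shows "\<bar>state_prob n (s + h) - state_prob n s\<bar> \<le> 1 - state_prob 0 h"
proof -
  have "state_prob n (s + h) - state_prob n s = (\<Sum>j=1..n. state_prob j h * state_prob (n - j) s) - (1 - state_prob 0 h) * state_prob n s"
    unfolding state_prob_semigroup[OF s h] sum_atMost_split_0 by (simp add: algebra_simps)
  moreover have "0 \<le> (\<Sum>j=1..n. state_prob j h * state_prob (n - j) s)"
    by (intro sum_nonneg mult_nonneg_nonneg state_prob_bounds)
  moreover have "(\<Sum>j=1..n. state_prob j h * state_prob (n - j) s) \<le> (\<Sum>j=1..n. state_prob j h)"
    by (intro sum_mono mult_left_le state_prob_bounds)
  moreover have "0 \<le> (1 - state_prob 0 h) * state_prob n s" "(1 - state_prob 0 h) * state_prob n s \<le> 1 - state_prob 0 h"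
    using state_prob_bounds by (auto intro!: mult_nonneg_nonneg mult_left_le)
  ultimately show ?thesis using sum_state_prob_le[OF h, of n] by linarith
qed

lemma state_prob_isCont: "isCont (state_prob n) x"
proof -
  have "(state_prob 0 \<longlongrightarrow> 1) (at_left 0)"
  proof (rule tendsto_eventually)
    show "\<forall>\<^sub>F s in at_left 0. state_prob 0 s = 1"
    proof (rule eventually_at_leftI[of "-1"])
      fix s :: real assume "s \<in> {-1<..<0}"
      then have "state_prob 0 s = state_prob 0 0" by (simp add: state_prob_def max_def)
      then show "state_prob 0 s = 1" by (simp add: state_prob_0)
    qed simp
  qed
  then have "(state_prob 0 \<longlongrightarrow> state_prob 0 0) (at 0)"
    using state_prob_0_tendsto_1 by (simp add: filterlim_at_split state_prob_0)
  then have "(state_prob 0 \<longlongrightarrow> state_prob 0 0) (nhds 0)"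
    by (rule tendsto_at_iff_tendsto_nhds[THEN iffD1])
  then have "(state_prob 0 \<longlongrightarrow> 1) (nhds 0)"
    by (simp only: state_prob_0 if_True simp_thms)
  moreover have "((\<lambda>y. \<bar>max 0 y - max 0 x\<bar>) \<longlongrightarrow> \<bar>max 0 x - max 0 x\<bar>) (at x)"
    by (intro tendsto_intros)
  then have "((\<lambda>y. \<bar>max 0 y - max 0 x\<bar>) \<longlongrightarrow> 0) (at x)" by simp
  ultimately have "((\<lambda>y. state_prob 0 \<bar>max 0 y - max 0 x\<bar>) \<longlongrightarrow> 1) (at x)"
    by (rule filterlim_compose)
  then have lim: "((\<lambda>y. 1 - state_prob 0 \<bar>max 0 y - max 0 x\<bar>) \<longlongrightarrow> 1 - 1) (at x)"
    by (intro tendsto_diff tendsto_const)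
  have "((\<lambda>y. state_prob n y - state_prob n x) \<longlongrightarrow> 0) (at x)"
  proof (rule Lim_null_comparison)
    show "((\<lambda>y. 1 - state_prob 0 \<bar>max 0 y - max 0 x\<bar>) \<longlongrightarrow> 0) (at x)" using lim by simp
    show "\<forall>\<^sub>F y in at x. norm (state_prob n y - state_prob n x) \<le> 1 - state_prob 0 \<bar>max 0 y - max 0 x\<bar>"
    proof (rule always_eventually, rule allI)
      fix y
      have "norm (state_prob n (max 0 y) - state_prob n (max 0 x)) \<le> 1 - state_prob 0 \<bar>max 0 y - max 0 x\<bar>"
      proof (cases "max 0 x \<le> max 0 y")
        case True
        then show ?thesis
          using state_prob_increment_le[of "max 0 x" "max 0 y - max 0 x" n] by simp
      next
        case False
        then have "\<bar>max 0 y - max 0 x\<bar> = max 0 x - max 0 y" "max 0 x - max 0 y \<ge> 0" by linarith+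
        then show ?thesis
          using state_prob_increment_le[OF max.cobounded1[of 0 y], of "max 0 x - max 0 y" n]
          by (simp only: real_norm_def abs_minus_commute add_diff_cancel_left' add_diff_eq)
      qed
      then show "norm (state_prob n y - state_prob n x) \<le> 1 - state_prob 0 \<bar>max 0 y - max 0 x\<bar>"
        by (simp add: state_prob_def)
    qed
  qed
  then show ?thesis unfolding isCont_def by (subst Lim_null)
qed

lemma state_prob_measurable [measurable]: "state_prob n \<in> borel_measurable borel"
  by (intro borel_measurable_continuous_onI continuous_at_imp_continuous_on ballI state_prob_isCont)

definition state_laplace :: "nat \<Rightarrow> real \<Rightarrow> real" where
  "state_laplace n y = (LINT t|lborel. indicator {0<..} t * (exp (- y * t) * state_prob n t))"

lemma state_prob_has_laplace: "y > 0 \<Longrightarrow> has_laplace (state_prob n) y (state_laplace n y)"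
  unfolding state_laplace_def by (rule bounded_has_laplace) (auto simp: state_prob_bounds abs_of_nonneg)

text \<open>The transform of \<open>t \<mapsto> state_prob n (t + h)\<close> is computed twice: by the semigroup property, and by cutting off
  the initial piece \<open>[0, h]\<close> of the integral. Dividing by \<open>h\<close> and letting \<open>h \<rightarrow> 0\<close> gives the recursion. In this way
  the forward equations are used in transformed form, without being established pointwise.\<close>

lemma state_laplace_recursion:
  assumes y: "y > 0"
  shows "(y + (\<Sum>j=1..k. lam j)) * state_laplace n y = (if n = 0 then 1 else 0) + (\<Sum>j=1..min n k. lam j * state_laplace (n - j) y)"
proof -
  define g where "g t = exp (- y * t) * state_prob n t" for t
  define I where "I h = integral {0..h} g" for h
  have "continuous_on A (state_prob n)" for A
    by (intro continuous_at_imp_continuous_on ballI state_prob_isCont)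
  then have g_cont: "continuous_on A g" for A
    unfolding g_def by (intro continuous_on_mult continuous_on_exp continuous_on_id continuous_on_const) auto
  have g_int: "integrable lborel (\<lambda>t. indicator {0<..} t * g t)" and laplace_g: "state_laplace n y = (LINT t|lborel. indicator {0<..} t * g t)"
    using state_prob_has_laplace[OF y, of n] by (auto simp: has_laplace_def has_bochner_integral_iff g_def)
  have shift: "state_laplace n y - I h = exp (- y * h) * (\<Sum>j\<le>n. state_prob j h * state_laplace (n - j) y)" if h: "h > 0" for h
  proof -
    have "has_laplace (\<lambda>t. \<Sum>j\<le>n. state_prob j h * state_prob (n - j) t) y (\<Sum>j\<le>n. state_prob j h * state_laplace (n - j) y)"
      by (intro has_laplace_sum has_laplace_cmult state_prob_has_laplace y)
    then have "has_laplace (\<lambda>t. state_prob n (t + h)) y (\<Sum>j\<le>n. state_prob j h * state_laplace (n - j) y)"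
      by (subst has_laplace_cong[where g = "\<lambda>t. \<Sum>j\<le>n. state_prob j h * state_prob (n - j) t"]) (use h in \<open>simp_all add: state_prob_semigroup\<close>)
    then have "has_laplace (\<lambda>t. exp (- y * h) * state_prob n (t + h)) y (exp (- y * h) * (\<Sum>j\<le>n. state_prob j h * state_laplace (n - j) y))"
      by (rule has_laplace_cmult)
    moreover have "indicator {0<..} t * (exp (- y * t) * (exp (- y * h) * state_prob n (t + h))) =
        indicator {h<..} (h + 1 * t) * g (h + 1 * t)" for t
      by (simp add: g_def indicator_def algebra_simps exp_add[symmetric] mult_exp_exp)
    ultimately have "has_bochner_integral lborel (\<lambda>t. indicator {h<..} (h + 1 * t) * g (h + 1 * t))
        ((exp (- y * h) * (\<Sum>j\<le>n. state_prob j h * state_laplace (n - j) y)) /\<^sub>R \<bar>1\<bar>)"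
      by (simp add: has_laplace_def)
    then have tail: "has_bochner_integral lborel (\<lambda>t. indicator {h<..} t * g t)
        (exp (- y * h) * (\<Sum>j\<le>n. state_prob j h * state_laplace (n - j) y))"
      by (subst lborel_has_bochner_integral_real_affine_iff[where c = 1 and t = h]) auto
    have "set_integrable lborel {0..h} g"
      by (rule borel_integrable_atLeastAtMost'[OF g_cont])
    then have "has_bochner_integral lborel (\<lambda>t. indicator {0..h} t * g t) (I h)"
      using set_borel_integral_eq_integral[of "{0..h}" g]
      by (simp add: has_bochner_integral_iff I_def set_integrable_def set_lebesgue_integral_def)
    then have "has_bochner_integral lborel (\<lambda>t. indicator {0<..h} t * g t) (I h)"
      by (rule has_bochner_integral_discrete_difference[where X = "{0}", THEN iffD1, rotated 4])
         (auto simp: indicator_def)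
    from has_bochner_integral_add[OF this tail]
    have "has_bochner_integral lborel (\<lambda>t. indicator {0<..h} t * g t + indicator {h<..} t * g t)
        (I h + exp (- y * h) * (\<Sum>j\<le>n. state_prob j h * state_laplace (n - j) y))" .
    moreover have "indicator {0<..h} t * g t + indicator {h<..} t * g t = indicator {0<..} t * g t" for t
      using h by (auto simp: indicator_def)
    ultimately show ?thesis by (simp add: has_bochner_integral_iff laplace_g)
  qed
  have "(I has_real_derivative g 0) (at 0 within {0..1})"
    unfolding I_def by (rule integral_has_real_derivative) (auto intro: g_cont)
  then have "((\<lambda>h. (I h - I 0) / (h - 0)) \<longlongrightarrow> g 0) (at 0 within {0..1})"
    by (simp add: has_field_derivative_iff)
  then have lim1: "((\<lambda>h. I h / h) \<longlongrightarrow> state_prob n 0) (at_right 0)"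
    by (simp add: I_def g_def at_within_Icc_at_right)
  have e: "((\<lambda>h. exp (- y * h)) \<longlongrightarrow> exp (- y * 0)) (at_right 0)"
    by (intro tendsto_intros)
  have "((\<lambda>h. exp (- y * h)) has_real_derivative (- y)) (at 0)"
    by (auto intro!: derivative_eq_intros)
  then have "((\<lambda>h. (exp (- y * h) - exp (- y * 0)) / (h - 0)) \<longlongrightarrow> - y) (at_right 0)"
    unfolding has_field_derivative_iff by (rule filterlim_mono) (auto simp: at_within_le_at)
  then have e': "((\<lambda>h. (exp (- y * h) - 1) / h) \<longlongrightarrow> - y) (at_right 0)" by simp
  have "((\<lambda>h. (- ((exp (- y * h) - 1) / h) + exp (- y * h) * ((1 - state_prob 0 h) / h)) * state_laplace n y
            - exp (- y * h) * (\<Sum>j=1..n. state_prob j h / h * state_laplace (n - j) y)) \<longlongrightarrow>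
         (- (- y) + exp (- y * 0) * (\<Sum>j=1..k. lam j)) * state_laplace n y
            - exp (- y * 0) * (\<Sum>j=1..n. (if j \<le> k then lam j else 0) * state_laplace (n - j) y)) (at_right 0)"
    by (intro tendsto_intros e e' holding_rate jump_rate) auto
  moreover have "\<forall>\<^sub>F h in at_right 0. (- ((exp (- y * h) - 1) / h) + exp (- y * h) * ((1 - state_prob 0 h) / h)) * state_laplace n y
            - exp (- y * h) * (\<Sum>j=1..n. state_prob j h / h * state_laplace (n - j) y) = I h / h"
    using eventually_at_right_less[of 0]
  proof eventually_elim
    case (elim h)
    have "I h = state_laplace n y - exp (- y * h) * (state_prob 0 h * state_laplace n y + (\<Sum>j=1..n. state_prob j h * state_laplace (n - j) y))"
      using shift[OF elim] unfolding sum_atMost_split_0 by simp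
    moreover have "(\<Sum>j=1..n. state_prob j h / h * state_laplace (n - j) y) = (\<Sum>j=1..n. state_prob j h * state_laplace (n - j) y) / h"
      by (simp add: sum_divide_distrib)
    moreover have "(- ((e - 1) / h) + e * ((1 - a) / h)) * b - e * (S / h) = (b - e * (a * b + S)) / h" for e a b S
      using elim by (simp add: field_simps)
    ultimately show ?case by (simp only:)
  qed
  ultimately have "((\<lambda>h. I h / h) \<longlongrightarrow> (y + (\<Sum>j=1..k. lam j)) * state_laplace n y
            - (\<Sum>j=1..n. (if j \<le> k then lam j else 0) * state_laplace (n - j) y)) (at_right 0)"
    using Lim_transform_eventually by fastforce
  from tendsto_unique[OF _ this lim1]
  have "(y + (\<Sum>j=1..k. lam j)) * state_laplace n y = state_prob n 0 + (\<Sum>j=1..n. (if j \<le> k then lam j else 0) * state_laplace (n - j) y)"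
    by simp
  moreover have "(\<Sum>j=1..n. (if j \<le> k then lam j else 0) * state_laplace (n - j) y) = (\<Sum>j=1..min n k. lam j * state_laplace (n - j) y)"
    by (rule sum.mono_neutral_cong_right) auto
  ultimately show ?thesis by (simp add: state_prob_0)
qed

end

section \<open>Evaluation at an independent random time\<close>

text \<open>The map that evaluates a trajectory at a time is not measurable on the product of the trajectory space and
  the time axis, so that independence of \<open>M\<close> and the random time cannot be applied to it directly. For a time with
  countably many values a sum over these values replaces it.\<close>

lemma (in generalized_counting) time_change_discretised:
  fixes K :: "'a \<Rightarrow> nat" and d :: real
  assumes K [measurable]: "K \<in> measurable P (count_space UNIV)" and d: "d > 0"
    and indep: "\<And>i s. s \<ge> 0 \<Longrightarrow> \<P>(\<omega> in P. M s \<omega> = n \<and> K \<omega> = i) = \<P>(\<omega> in P. M s \<omega> = n) * \<P>(\<omega> in P. K \<omega> = i)"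
  shows "{\<omega> \<in> space P. M ((real (K \<omega>) + 1) * d) \<omega> = n} \<in> sets P"
    and "\<P>(\<omega> in P. M ((real (K \<omega>) + 1) * d) \<omega> = n) = expectation (\<lambda>\<omega>. state_prob n ((real (K \<omega>) + 1) * d))"
proof -
  define t where "t i = (real i + 1) * d" for i :: nat
  have t: "t i \<ge> 0" for i using d by (simp add: t_def)
  define A where "A i = {\<omega> \<in> space P. M (t i) \<omega> = n \<and> K \<omega> = i}" for i
  have A [measurable]: "A i \<in> sets P" for i
    unfolding A_def using t[of i] by measurable
  have A_eq: "{\<omega> \<in> space P. M (t (K \<omega>)) \<omega> = n} = (\<Union>i. A i)"
    by (auto simp: A_def)
  show "{\<omega> \<in> space P. M ((real (K \<omega>) + 1) * d) \<omega> = n} \<in> sets P"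
    using A_eq A by (simp add: t_def)
  have "emeasure P (\<Union>i. A i) = (\<Sum>i. emeasure P (A i))"
    by (rule suminf_emeasure[symmetric]) (use A in \<open>auto simp: disjoint_family_on_def A_def\<close>)
  also have "\<dots> = (\<Sum>i. ennreal (state_prob n (t i)) * emeasure P {\<omega> \<in> space P. K \<omega> = i})"
  proof (rule arg_cong[where f = suminf], rule ext)
    fix i
    have "prob (A i) = state_prob n (t i) * \<P>(\<omega> in P. K \<omega> = i)"
      using indep[OF t, of i i] t[of i] by (simp add: A_def state_prob_def max_def)
    then show "emeasure P (A i) = ennreal (state_prob n (t i)) * emeasure P {\<omega> \<in> space P. K \<omega> = i}"
      by (simp add: emeasure_eq_measure ennreal_mult state_prob_bounds)
  qed
  also have "\<dots> = (\<Sum>i. \<integral>\<^sup>+\<omega>. ennreal (state_prob n (t i)) * indicator {\<omega> \<in> space P. K \<omega> = i} \<omega> \<partial>P)"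
    by (simp add: nn_integral_cmult_indicator)
  also have "\<dots> = (\<integral>\<^sup>+\<omega>. (\<Sum>i. ennreal (state_prob n (t i)) * indicator {\<omega> \<in> space P. K \<omega> = i} \<omega>) \<partial>P)"
    by (rule nn_integral_suminf[symmetric]) measurable
  also have "\<dots> = (\<integral>\<^sup>+\<omega>. ennreal (state_prob n (t (K \<omega>))) \<partial>P)"
  proof (rule nn_integral_cong)
    fix \<omega> assume \<omega>: "\<omega> \<in> space P"
    have "(\<Sum>i. ennreal (state_prob n (t i)) * indicator {\<omega> \<in> space P. K \<omega> = i} \<omega>) =
        (\<Sum>i\<in>{K \<omega>}. ennreal (state_prob n (t i)) * indicator {\<omega> \<in> space P. K \<omega> = i} \<omega>)"
      by (rule suminf_finite) auto
    then show "(\<Sum>i. ennreal (state_prob n (t i)) * indicator {\<omega> \<in> space P. K \<omega> = i} \<omega>) = ennreal (state_prob n (t (K \<omega>)))"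
      using \<omega> by simp
  qed
  also have "\<dots> = ennreal (expectation (\<lambda>\<omega>. state_prob n (t (K \<omega>))))"
    unfolding t_def by (rule nn_integral_eq_integral)
      (auto intro!: integrable_const_bound[where B = 1] simp: state_prob_bounds abs_of_nonneg)
  finally show "\<P>(\<omega> in P. M ((real (K \<omega>) + 1) * d) \<omega> = n) = expectation (\<lambda>\<omega>. state_prob n ((real (K \<omega>) + 1) * d))"
    unfolding A_eq[symmetric] t_def
    by (simp add: emeasure_eq_measure integral_nonneg_AE state_prob_bounds)
qed

text \<open>The time \<open>\<tau>\<close> is approximated from above by times on the grids of mesh \<open>d m\<close>. The paths of \<open>M\<close> are locally
  constant to the right, so the events converge; the state probabilities are continuous, so their
  expectations converge, too. Strict inequality \<open>\<tau> < \<sigma> m\<close> lets right-continuity apply, which is why the grid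
  point after \<open>\<tau>\<close> is taken even when \<open>\<tau>\<close> lies on the grid.\<close>

lemma (in generalized_counting) time_change:
  assumes \<tau> [measurable]: "\<tau> \<in> borel_measurable P" and \<tau>_nonneg: "\<And>\<omega>. \<omega> \<in> space P \<Longrightarrow> \<tau> \<omega> \<ge> 0"
    and indep: "\<And>s. s \<ge> 0 \<Longrightarrow> indep_var borel (\<lambda>\<omega>. real (M s \<omega>)) borel \<tau>"
  shows "\<P>(\<omega> in P. M (\<tau> \<omega>) \<omega> = n) = expectation (\<lambda>\<omega>. state_prob n (\<tau> \<omega>))"
proof -
  define K where "K m \<omega> = nat \<lfloor>real (Suc m) * \<tau> \<omega>\<rfloor>" for m \<omega>
  \<comment> \<open>\<open>K m\<close> is the index of the last grid point up to \<open>\<tau>\<close>, so \<open>\<sigma> m\<close> is the next grid point.\<close>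
  define d where "d m = 1 / real (Suc m)" for m
  define \<sigma> where "\<sigma> m \<omega> = (real (K m \<omega>) + 1) * d m" for m \<omega>
  have K [measurable]: "K m \<in> measurable P (count_space UNIV)" for m
    unfolding K_def[abs_def] by measurable
  have d: "d m > 0" for m by (simp add: d_def)
  have indep_K: "\<P>(\<omega> in P. M s \<omega> = n \<and> K m \<omega> = i) = \<P>(\<omega> in P. M s \<omega> = n) * \<P>(\<omega> in P. K m \<omega> = i)"
    if "s \<ge> 0" for s m i
  proof -
    define B where "B = {x. nat \<lfloor>real (Suc m) * x\<rfloor> = i}"
    have "B \<in> sets borel" unfolding B_def by measurable
    then have "prob ((\<lambda>\<omega>. (real (M s \<omega>), \<tau> \<omega>)) -` ({real n} \<times> B) \<inter> space P) =
        prob ((\<lambda>\<omega>. real (M s \<omega>)) -` {real n} \<inter> space P) * prob (\<tau> -` B \<inter> space P)"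
      by (intro indep_varD[OF indep[OF that]]) auto
    moreover have "(\<lambda>\<omega>. (real (M s \<omega>), \<tau> \<omega>)) -` ({real n} \<times> B) \<inter> space P = {\<omega> \<in> space P. M s \<omega> = n \<and> K m \<omega> = i}"
      by (auto simp: B_def K_def)
    moreover have "(\<lambda>\<omega>. real (M s \<omega>)) -` {real n} \<inter> space P = {\<omega> \<in> space P. M s \<omega> = n}" by auto
    moreover have "\<tau> -` B \<inter> space P = {\<omega> \<in> space P. K m \<omega> = i}" by (auto simp: B_def K_def)
    ultimately show ?thesis by simp
  qed
  have \<sigma>_bounds: "\<tau> \<omega> < \<sigma> m \<omega> \<and> \<sigma> m \<omega> \<le> \<tau> \<omega> + d m" if "\<omega> \<in> space P" for m \<omega>
  proof -
    define x where "x = real (Suc m) * \<tau> \<omega>"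
    have "x \<ge> 0" using \<tau>_nonneg[OF that] by (simp add: x_def)
    then have "real (K m \<omega>) = of_int \<lfloor>x\<rfloor>" by (simp add: K_def x_def)
    then have "x < real (K m \<omega>) + 1" "real (K m \<omega>) \<le> x" by linarith+
    then have "x * d m < (real (K m \<omega>) + 1) * d m" "real (K m \<omega>) * d m \<le> x * d m"
      using d[of m] by (simp_all add: mult_strict_right_mono mult_right_mono)
    moreover have "\<tau> \<omega> = x * d m" by (simp add: x_def d_def)
    ultimately show ?thesis by (simp add: \<sigma>_def distrib_right)
  qed
  have \<sigma>_lim: "(\<lambda>m. \<sigma> m \<omega>) \<longlonglongrightarrow> \<tau> \<omega>" if "\<omega> \<in> space P" for \<omega>
  proof (rule tendsto_sandwich[where f = "\<lambda>_. \<tau> \<omega>" and h = "\<lambda>m. \<tau> \<omega> + d m"])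
    have "(\<lambda>m. \<tau> \<omega> + d m) \<longlonglongrightarrow> \<tau> \<omega> + 0"
      unfolding d_def using LIMSEQ_inverse_real_of_nat by (intro tendsto_add tendsto_const) (simp add: inverse_eq_divide)
    then show "(\<lambda>m. \<tau> \<omega> + d m) \<longlonglongrightarrow> \<tau> \<omega>" by simp
    show "\<forall>\<^sub>F m in sequentially. \<tau> \<omega> \<le> \<sigma> m \<omega>" "\<forall>\<^sub>F m in sequentially. \<sigma> m \<omega> \<le> \<tau> \<omega> + d m"
      using \<sigma>_bounds[OF that] by (auto intro!: always_eventually less_imp_le)
  qed simp
  define f where "f m \<omega> = (indicator {\<omega> \<in> space P. M (\<sigma> m \<omega>) \<omega> = n} \<omega> :: real)" for m \<omega>
  define g where "g \<omega> = (indicator {\<omega> \<in> space P. M (\<tau> \<omega>) \<omega> = n} \<omega> :: real)" for \<omega>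
  have disc: "{\<omega> \<in> space P. M (\<sigma> m \<omega>) \<omega> = n} \<in> sets P"
     "\<P>(\<omega> in P. M (\<sigma> m \<omega>) \<omega> = n) = expectation (\<lambda>\<omega>. state_prob n (\<sigma> m \<omega>))" for m
    using time_change_discretised[OF K[of m] d[of m] indep_K[of _ m]] by (simp_all add: \<sigma>_def)
  have f_meas [measurable]: "f m \<in> borel_measurable P" for m
    unfolding f_def[abs_def] using disc(1) by measurable
  have f_lim: "(\<lambda>m. f m \<omega>) \<longlonglongrightarrow> g \<omega>" if \<omega>: "\<omega> \<in> space P" for \<omega>
  proof -
    have "continuous (at_right (\<tau> \<omega>)) (\<lambda>s. M s \<omega>)"
      using gcp \<omega> \<tau>_nonneg[OF \<omega>] by (simp add: generalized_counting_process_def counting_process_def)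
    then have ev: "\<forall>\<^sub>F s in at_right (\<tau> \<omega>). M s \<omega> = M (\<tau> \<omega>) \<omega>"
      by (simp add: continuous_within tendsto_discrete)
    have "filterlim (\<lambda>m. \<sigma> m \<omega>) (at_right (\<tau> \<omega>)) sequentially"
    proof -
      have gt: "\<tau> \<omega> < \<sigma> m \<omega>" for m using \<sigma>_bounds[OF \<omega>] by simp
      show ?thesis using \<sigma>_lim[OF \<omega>] by (simp add: filterlim_at gt less_imp_neq[OF gt, symmetric])
    qed
    then have "\<forall>\<^sub>F m in sequentially. M (\<sigma> m \<omega>) \<omega> = M (\<tau> \<omega>) \<omega>"
      using ev by (rule eventually_compose_filterlim[rotated])
    then have "\<forall>\<^sub>F m in sequentially. f m \<omega> = g \<omega>"
      by eventually_elim (simp add: f_def g_def indicator_def)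
    then show ?thesis by (rule tendsto_eventually)
  qed
  have g_meas [measurable]: "g \<in> borel_measurable P"
    by (rule borel_measurable_LIMSEQ_real[OF f_lim f_meas])
  have "(\<lambda>m. expectation (f m)) \<longlonglongrightarrow> expectation g"
    by (rule integral_dominated_convergence[where w = "\<lambda>_. 1"])
       (use f_lim in \<open>auto simp: f_def\<close>)
  moreover have "expectation (f m) = expectation (\<lambda>\<omega>. state_prob n (\<sigma> m \<omega>))" for m
    using disc[of m] by (simp add: f_def[abs_def])
  ultimately have lim1: "(\<lambda>m. expectation (\<lambda>\<omega>. state_prob n (\<sigma> m \<omega>))) \<longlonglongrightarrow> expectation g" by simp
  have lim2: "(\<lambda>m. expectation (\<lambda>\<omega>. state_prob n (\<sigma> m \<omega>))) \<longlonglongrightarrow> expectation (\<lambda>\<omega>. state_prob n (\<tau> \<omega>))"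
  proof (rule integral_dominated_convergence[where w = "\<lambda>_. 1"])
    show "AE \<omega> in P. (\<lambda>m. state_prob n (\<sigma> m \<omega>)) \<longlonglongrightarrow> state_prob n (\<tau> \<omega>)"
      using isCont_tendsto_compose[OF state_prob_isCont \<sigma>_lim] by (intro AE_I2) auto
  qed (auto simp: \<sigma>_def[abs_def] state_prob_bounds abs_of_nonneg)
  have set: "{\<omega> \<in> space P. M (\<tau> \<omega>) \<omega> = n} \<in> sets P"
  proof -
    have "{\<omega> \<in> space P. M (\<tau> \<omega>) \<omega> = n} = {\<omega> \<in> space P. g \<omega> = 1}"
      by (auto simp: g_def indicator_def)
    also have "\<dots> \<in> sets P" by measurable
    finally show ?thesis .
  qed
  have "expectation g = \<P>(\<omega> in P. M (\<tau> \<omega>) \<omega> = n)"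
    using set by (simp add: g_def[abs_def])
  with LIMSEQ_unique[OF lim1 lim2] show ?thesis by simp
qed

section \<open>Sums of stable subordinators and their inverses\<close>

locale subordinator_sum = prob_space P for P :: "'a measure" +
  fixes N :: nat and mu nu :: "nat \<Rightarrow> real" and H :: "nat \<Rightarrow> real \<Rightarrow> 'a \<Rightarrow> real"
  assumes mu_nonneg: "j \<in> {1..N} \<Longrightarrow> mu j \<ge> 0"
    and mu_pos: "\<exists>j\<in>{1..N}. mu j > 0"
    and H: "j \<in> {1..N} \<Longrightarrow> stable_subordinator P (nu j) (H j)"
    and H_indep: "indep_vars (\<lambda>_. PiM {0..} (\<lambda>_. borel)) (\<lambda>j. trajectory (H j)) {1..N}"
begin

definition subordinator :: "real \<Rightarrow> 'a \<Rightarrow> real" where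
  "subordinator s \<omega> = (\<Sum>j=1..N. mu j powr (1 / nu j) * H j s \<omega>)"

text \<open>The Laplace exponent of \<open>subordinator\<close>.\<close>

definition \<phi> :: "real \<Rightarrow> real" where "\<phi> z = (\<Sum>j=1..N. mu j * z powr nu j)"

abbreviation T :: "real \<Rightarrow> 'a \<Rightarrow> real" where "T \<equiv> inverse_process N mu nu H"

lemma \<phi>_pos: "z > 0 \<Longrightarrow> \<phi> z > 0"
  using mu_pos mu_nonneg unfolding \<phi>_def
  by (auto intro!: sum_pos2 simp: less_imp_le)

lemma nu_pos: "j \<in> {1..N} \<Longrightarrow> nu j > 0"
  using H[of j] by (auto simp: stable_subordinator_def)

lemma H_measurable [measurable]:
  assumes "j \<in> {1..N}" "s \<ge> 0" shows "H j s \<in> borel_measurable P"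
proof -
  have "trajectory (H j) \<in> measurable P (PiM {0..} (\<lambda>_. borel))"
    using H_indep assms by (simp add: indep_vars_def)
  from measurable_compose[OF this measurable_component_singleton[of s "{0..}"]]
  show ?thesis using assms by (simp add: trajectory_def)
qed

lemma subordinator_measurable [measurable]: "s \<ge> 0 \<Longrightarrow> subordinator s \<in> borel_measurable P"
  unfolding subordinator_def[abs_def] by (intro borel_measurable_sum borel_measurable_times borel_measurable_const H_measurable)

lemma H_mono: "j \<in> {1..N} \<Longrightarrow> \<omega> \<in> space P \<Longrightarrow> 0 \<le> s \<Longrightarrow> s \<le> t \<Longrightarrow> H j s \<omega> \<le> H j t \<omega>"
  using H[of j] by (auto simp: stable_subordinator_def mono_on_def)

lemma subordinator_mono: "\<omega> \<in> space P \<Longrightarrow> 0 \<le> s \<Longrightarrow> s \<le> t \<Longrightarrow> subordinator s \<omega> \<le> subordinator t \<omega>"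
  unfolding subordinator_def by (intro sum_mono mult_left_mono H_mono) auto

lemma H_right_cont:
  assumes j: "j \<in> {1..N}" and \<omega>: "\<omega> \<in> space P" and s: "s \<ge> 0"
  shows "((\<lambda>s. H j s \<omega>) \<longlongrightarrow> H j s \<omega>) (at_right s)"
proof (cases "nu j = 1")
  case True
  then have H_eq: "H j t \<omega> = t" if "t \<ge> 0" for t
    using H[OF j] \<omega> that by (auto simp: stable_subordinator_def)
  have "\<forall>\<^sub>F t in at_right s. t = H j t \<omega>"
    using eventually_at_right_less[of s] by eventually_elim (use s H_eq in auto)
  then have "((\<lambda>s. H j s \<omega>) \<longlongrightarrow> s) (at_right s)"
    by (rule Lim_transform_eventually[OF tendsto_ident_at])
  then show ?thesis using H_eq[OF s] by simp
next
  case False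
  then have "levy_process P (H j)" using H[OF j] by (auto simp: stable_subordinator_def)
  then show ?thesis using \<omega> s by (simp add: levy_process_def continuous_within)
qed

lemma subordinator_right_cont: "\<omega> \<in> space P \<Longrightarrow> s \<ge> 0 \<Longrightarrow> ((\<lambda>s. subordinator s \<omega>) \<longlongrightarrow> subordinator s \<omega>) (at_right s)"
  unfolding subordinator_def by (intro tendsto_sum tendsto_mult tendsto_const H_right_cont)

lemma H_0: assumes j: "j \<in> {1..N}" shows "AE \<omega> in P. H j 0 \<omega> = 0"
proof (cases "nu j = 1")
  case True
  then show ?thesis using H[OF j] by (auto simp: stable_subordinator_def)
next
  case False
  then have "levy_process P (H j)" using H[OF j] by (auto simp: stable_subordinator_def)
  then show ?thesis by (simp add: levy_process_def)
qed

lemma subordinator_0: "AE \<omega> in P. subordinator 0 \<omega> = 0"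
proof -
  have "AE \<omega> in P. \<forall>j\<in>{1..N}. H j 0 \<omega> = 0"
    by (rule AE_finite_allI) (auto intro: H_0)
  then show ?thesis by eventually_elim (simp add: subordinator_def)
qed

lemma H_laplace:
  assumes j: "j \<in> {1..N}" and s: "s \<ge> 0" and z: "z > 0"
  shows "expectation (\<lambda>\<omega>. exp (- z * H j s \<omega>)) = exp (- s * z powr nu j)"
proof (cases "nu j = 1")
  case True
  then have "expectation (\<lambda>\<omega>. exp (- z * H j s \<omega>)) = expectation (\<lambda>\<omega>. exp (- z * s))"
    using H[OF j] s by (intro Bochner_Integration.integral_cong) (auto simp: stable_subordinator_def)
  then show ?thesis using True z by (simp add: prob_space mult.commute)
next
  case False
  then show ?thesis using H[OF j] s z by (auto simp: stable_subordinator_def)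
qed

text \<open>By independence of the summands the transform is a product. For \<open>mu j > 0\<close>, the scaling constant
  \<open>mu j powr (1 / nu j)\<close> contributes \<open>mu j\<close> to the exponent.\<close>

lemma subordinator_laplace:
  assumes s: "s \<ge> 0" and z: "z > 0"
  shows "expectation (\<lambda>\<omega>. exp (- z * subordinator s \<omega>)) = exp (- s * \<phi> z)"
proof -
  define c where "c j = z * mu j powr (1 / nu j)" for j
  define X where "X j \<omega> = exp (- c j * H j s \<omega>)" for j \<omega>
  have c: "c j \<ge> 0" for j using z by (simp add: c_def)
  have X_exp: "expectation (X j) = exp (- s * (mu j * z powr nu j))" if j: "j \<in> {1..N}" for j
  proof (cases "mu j = 0")
    case True
    then show ?thesis by (simp add: X_def[abs_def] c_def prob_space)
  next
    case False
    then have mu: "mu j > 0" using mu_nonneg[OF j] by simp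
    then have "c j > 0" using z by (simp add: c_def)
    then have "expectation (X j) = exp (- s * c j powr nu j)"
      unfolding X_def[abs_def] by (rule H_laplace[OF j s])
    also have "c j powr nu j = mu j * z powr nu j"
      using mu z nu_pos[OF j] by (simp add: c_def powr_mult powr_powr)
    finally show ?thesis .
  qed
  have indep: "indep_vars (\<lambda>_. borel) X {1..N}"
  proof -
    have "indep_vars (\<lambda>_. borel) (\<lambda>j \<omega>. (\<lambda>x. exp (- c j * x s)) (trajectory (H j) \<omega>)) {1..N}"
    proof (rule indep_vars_compose2[OF H_indep])
      have [measurable]: "(\<lambda>x. x s) \<in> borel_measurable (PiM {0..} (\<lambda>_. borel :: real measure))"
        by (rule measurable_component_singleton) (use s in simp)
      show "(\<lambda>x. exp (- c j * x s)) \<in> borel_measurable (PiM {0..} (\<lambda>_. borel))" for j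
        by measurable
    qed
    moreover have "(\<lambda>j \<omega>. (\<lambda>x. exp (- c j * x s)) (trajectory (H j) \<omega>)) = X"
      using s by (simp add: X_def fun_eq_iff trajectory_def)
    ultimately show ?thesis by simp
  qed
  have "integrable P (X j)" if j: "j \<in> {1..N}" for j
  proof (rule integrable_const_bound[where B = 1])
    show "X j \<in> borel_measurable P"
      unfolding X_def[abs_def] using H_measurable[OF j s] by measurable
    show "AE \<omega> in P. norm (X j \<omega>) \<le> 1"
      using H_0[OF j] AE_space
    proof eventually_elim
      case (elim \<omega>)
      then have "H j s \<omega> \<ge> 0" using H_mono[OF j elim(2), of 0 s] s by simp
      then show ?case using c[of j] by (simp add: X_def)
    qed
  qed
  then have "expectation (\<lambda>\<omega>. \<Prod>j\<in>{1..N}. X j \<omega>) = (\<Prod>j\<in>{1..N}. expectation (X j))"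
    by (intro indep_vars_lebesgue_integral indep) auto
  moreover have "(\<Prod>j\<in>{1..N}. X j \<omega>) = exp (- z * subordinator s \<omega>)" for \<omega>
    by (simp add: X_def exp_sum[symmetric] subordinator_def c_def sum_distrib_left sum_negf mult_ac)
  moreover have "(\<Prod>j\<in>{1..N}. expectation (X j)) = exp (- s * \<phi> z)"
  proof -
    have "(\<Prod>j\<in>{1..N}. expectation (X j)) = (\<Prod>j\<in>{1..N}. exp (- s * (mu j * z powr nu j)))"
      by (rule prod.cong[OF refl X_exp])
    then show ?thesis by (simp add: exp_sum[symmetric] \<phi>_def sum_distrib_left sum_negf)
  qed
  ultimately show ?thesis by simp
qed

lemma exp_subordinator_integrable: "s \<ge> 0 \<Longrightarrow> z > 0 \<Longrightarrow> integrable P (\<lambda>\<omega>. exp (- z * subordinator s \<omega>))"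
  using subordinator_laplace[of s z] not_integrable_integral_eq[of P "\<lambda>\<omega>. exp (- z * subordinator s \<omega>)"] by force

text \<open>The almost sure event on which the path starts at 0 and is unbounded, so that its inverse is finite.\<close>

definition regular_paths :: "'a set" where
  "regular_paths = {\<omega> \<in> space P. subordinator 0 \<omega> = 0 \<and> (\<forall>m::nat. \<exists>i::nat. real m \<le> subordinator (real i) \<omega>)}"

lemma regular_paths_sets [measurable]: "regular_paths \<in> sets P"
  unfolding regular_paths_def by measurable

text \<open>A path below \<open>m\<close> at all times satisfies \<open>exp (- subordinator i) > exp (- m)\<close> for all \<open>i\<close>, while the
  expectation \<open>exp (- i * \<phi> 1)\<close> of the left-hand side tends to 0.\<close>

lemma AE_regular_paths: "AE \<omega> in P. \<omega> \<in> regular_paths"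
proof -
  have "AE \<omega> in P. \<exists>i::nat. real m \<le> subordinator (real i) \<omega>" for m :: nat
  proof -
    define A where "A = {\<omega> \<in> space P. \<forall>i::nat. subordinator (real i) \<omega> < real m}"
    have A: "A \<in> sets P" unfolding A_def by measurable
    have bound: "prob A * exp (- real m) \<le> exp (- \<phi> 1) ^ i" for i :: nat
    proof -
      have int: "integrable P (\<lambda>\<omega>. exp (- 1 * subordinator (real i) \<omega>))"
        by (rule exp_subordinator_integrable) simp_all
      have "prob A * exp (- real m) = expectation (\<lambda>\<omega>. exp (- real m) * indicator A \<omega>)"
        using A by simp
      also have "\<dots> \<le> expectation (\<lambda>\<omega>. exp (- 1 * subordinator (real i) \<omega>))"
      proof (rule integral_mono)
        show "exp (- real m) * indicator A \<omega> \<le> exp (- 1 * subordinator (real i) \<omega>)" if "\<omega> \<in> space P" for \<omega>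
          using that by (auto simp: A_def indicator_def less_imp_le)
        show "integrable P (\<lambda>\<omega>. exp (- real m) * indicator A \<omega>)"
          by (intro integrable_mult_right integrable_real_indicator A) (simp add: less_top[symmetric])
      qed (rule int)
      also have "\<dots> = exp (- \<phi> 1) ^ i"
        using subordinator_laplace[of "real i" 1] by (simp add: exp_of_nat_mult[symmetric])
      finally show ?thesis .
    qed
    have "(\<lambda>i. exp (- \<phi> 1) ^ i) \<longlonglongrightarrow> 0"
      using \<phi>_pos[of 1] by (intro LIMSEQ_power_zero) simp
    then have "prob A * exp (- real m) \<le> 0"
      by (rule LIMSEQ_le_const) (use bound in auto)
    then have "prob A = 0"
      by (metis exp_gt_zero measure_nonneg mult_le_0_iff not_less order_antisym)
    then have "AE \<omega> in P. \<omega> \<notin> A"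
      using A by (simp add: prob_eq_0)
    then show ?thesis
      using AE_space by eventually_elim (auto simp: A_def not_less)
  qed
  then have "AE \<omega> in P. \<forall>m::nat. \<exists>i::nat. real m \<le> subordinator (real i) \<omega>"
    by (simp add: AE_all_countable)
  then show ?thesis
    using subordinator_0 AE_space by eventually_elim (auto simp: regular_paths_def)
qed

lemma T_nonneg: "T t \<omega> \<ge> 0"
  by (simp add: inverse_process_def)

text \<open>The infimum in the definition of the inverse is attained, by right-continuity of the path.\<close>

lemma T_le_iff:
  assumes \<omega>: "\<omega> \<in> regular_paths" and t: "t > 0" and a: "a \<ge> 0"
  shows "T t \<omega> \<le> a \<longleftrightarrow> t \<le> subordinator a \<omega>"
proof -
  define R where "R = {s. 0 < s \<and> subordinator s \<omega> \<ge> t}"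
  define I where "I = (INF s\<in>R. ennreal s)"
  have T_eq: "T t \<omega> = enn2real I" using t by (simp add: inverse_process_def I_def R_def subordinator_def)
  have sp: "\<omega> \<in> space P" using \<omega> by (simp add: regular_paths_def)
  obtain m :: nat where m: "t \<le> real m" using real_arch_simple by blast
  obtain i :: nat where i: "real m \<le> subordinator (real i) \<omega>" using \<omega> by (auto simp: regular_paths_def)
  have "real i > 0" using i m t \<omega> by (cases "i = 0") (auto simp: regular_paths_def)
  then have "real i \<in> R" using i m by (simp add: R_def)
  then have "I \<le> ennreal (real i)" unfolding I_def by (rule INF_lower)
  then have I_fin: "I < top" by (rule le_less_trans) simp
  then have I_T: "I = ennreal (T t \<omega>)" by (simp add: T_eq)
  show ?thesis
  proof
    assume "t \<le> subordinator a \<omega>"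
    show "T t \<omega> \<le> a"
    proof (rule field_le_epsilon)
      fix e :: real assume e: "e > 0"
      have "t \<le> subordinator (a + e) \<omega>" using subordinator_mono[OF sp a, of "a + e"] e \<open>t \<le> subordinator a \<omega>\<close> by simp
      then have "a + e \<in> R" using a e by (simp add: R_def)
      then have "I \<le> ennreal (a + e)" unfolding I_def by (rule INF_lower)
      then show "T t \<omega> \<le> a + e" using a e by (simp add: I_T ennreal_le_iff del: ennreal_plus)
    qed
  next
    assume T_le: "T t \<omega> \<le> a"
    have "t \<le> subordinator b \<omega>" if "b > a" for b
    proof -
      have "I < ennreal b" using T_le that a by (simp add: I_T ennreal_less_iff T_nonneg)
      then obtain s where "s \<in> R" "ennreal s < ennreal b" unfolding I_def by (auto simp: INF_less_iff)
      then have "0 < s" "t \<le> subordinator s \<omega>" "s < b" by (auto simp: R_def ennreal_less_iff)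
      then show ?thesis using subordinator_mono[OF sp, of s b] by simp
    qed
    then have "\<forall>\<^sub>F b in at_right a. t \<le> subordinator b \<omega>"
      by (auto simp: eventually_at_right_less intro: eventually_mono[OF eventually_at_right_less[of a]])
    then show "t \<le> subordinator a \<omega>"
      by (rule tendsto_lowerbound[OF subordinator_right_cont[OF sp a]]) simp
  qed
qed

lemma T_left_cont:
  assumes \<omega>: "\<omega> \<in> regular_paths" and t: "t > 0"
  shows "((\<lambda>t. T t \<omega>) \<longlongrightarrow> T t \<omega>) (at_left t)"
proof (rule order_tendstoI)
  fix a assume a: "a < T t \<omega>"
  show "\<forall>\<^sub>F u in at_left t. a < T u \<omega>"
  proof (cases "a \<ge> 0")
    case True
    then have subordinator_less: "subordinator a \<omega> < t" using T_le_iff[OF \<omega> t True] a by simp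
    have "\<forall>\<^sub>F u in at_left t. max 0 (subordinator a \<omega>) < u"
      using subordinator_less t by (intro eventually_at_leftI[of "max 0 (subordinator a \<omega>)"]) auto
    then show ?thesis
    proof eventually_elim
      case (elim u)
      then show ?case using T_le_iff[OF \<omega>, of u a] True by simp
    qed
  next
    case False
    then show ?thesis using T_nonneg by (intro always_eventually allI) (metis less_le_trans not_le)
  qed
next
  fix a assume a: "T t \<omega> < a"
  have "\<forall>\<^sub>F u in at_left t. 0 < u \<and> u < t"
    using t by (intro eventually_at_leftI[of 0]) auto
  then show "\<forall>\<^sub>F u in at_left t. T u \<omega> < a"
  proof eventually_elim
    case (elim u)
    have "t \<le> subordinator (T t \<omega>) \<omega>" using T_le_iff[OF \<omega> t T_nonneg[of t \<omega>]] by simp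
    then have "T u \<omega> \<le> T t \<omega>" using T_le_iff[OF \<omega>, of u "T t \<omega>"] T_nonneg elim by simp
    then show ?case using a by simp
  qed
qed

text \<open>As a function of time and path, with a default value outside the regular paths and the positive times. There
  \<open>T_le_iff\<close> fails, and with it the description of the level sets on which joint measurability rests.\<close>

definition regular_inverse :: "real \<times> 'a \<Rightarrow> real" where
  "regular_inverse = (\<lambda>(t, \<omega>). if t > 0 \<and> \<omega> \<in> regular_paths then T t \<omega> else 0)"

lemma regular_inverse_le_iff:
  "a \<ge> 0 \<Longrightarrow> regular_inverse (t, \<omega>) \<le> a \<longleftrightarrow> (t > 0 \<and> \<omega> \<in> regular_paths \<longrightarrow> t \<le> subordinator a \<omega>)"
  by (auto simp: regular_inverse_def T_le_iff)

text \<open>Fix the path and average over an exponential time \<open>\<tau>\<close> of rate \<open>z\<close>: the event \<open>T \<tau> \<le> a\<close> is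
  \<open>\<tau> \<le> subordinator a\<close>, of probability \<open>1 - exp (- z * subordinator a)\<close>. Then average over the paths.\<close>

lemma regular_inverse_exponential:
  assumes z: "z > 0"
  shows "distributed (density lborel (exponential_density z) \<Otimes>\<^sub>M P) lborel regular_inverse (exponential_density (\<phi> z))"
proof -
  define D where "D = density lborel (exponential_density z)"
  interpret D: prob_space D
    unfolding D_def using z by (rule prob_space_exponential_density)
  interpret DP: pair_prob_space D P ..
  have sets_D [measurable_cong]: "sets D = sets borel" by (simp add: D_def)
  have space_D: "space D = UNIV" by (simp add: D_def)
  have le_set: "{w \<in> space (D \<Otimes>\<^sub>M P). regular_inverse w \<le> a} \<in> sets (D \<Otimes>\<^sub>M P)" for a
  proof (cases "a \<ge> 0")
    case True
    have "{w \<in> space (D \<Otimes>\<^sub>M P). regular_inverse w \<le> a} =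
        {w \<in> space (D \<Otimes>\<^sub>M P). fst w > 0 \<and> snd w \<in> regular_paths \<longrightarrow> fst w \<le> subordinator a (snd w)}"
      using regular_inverse_le_iff[OF True] by auto
    also have "\<dots> \<in> sets (D \<Otimes>\<^sub>M P)" using True by measurable
    finally show ?thesis .
  next
    case False
    then have "\<not> regular_inverse w \<le> a" for w
      using T_nonneg by (auto simp: regular_inverse_def split: prod.splits) (metis order_trans)
    then show ?thesis by simp
  qed
  have "distributed (D \<Otimes>\<^sub>M P) lborel regular_inverse (exponential_density (\<phi> z))"
  proof (rule exponential_distributedI)
    show "regular_inverse \<in> borel_measurable (D \<Otimes>\<^sub>M P)"
      by (rule borel_measurable_iff_le[THEN iffD2]) (use le_set in auto)
    show "\<phi> z > 0" by (rule \<phi>_pos[OF z])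
    fix a :: real assume a: "a \<ge> 0"
    have "emeasure (D \<Otimes>\<^sub>M P) {w \<in> space (D \<Otimes>\<^sub>M P). regular_inverse w \<le> a} =
        (\<integral>\<^sup>+\<omega>. emeasure D ((\<lambda>t. (t, \<omega>)) -` {w \<in> space (D \<Otimes>\<^sub>M P). regular_inverse w \<le> a}) \<partial>P)"
      by (rule DP.emeasure_pair_measure_alt2[OF le_set])
    also have "\<dots> = (\<integral>\<^sup>+\<omega>. ennreal (1 - exp (- z * subordinator a \<omega>)) \<partial>P)"
    proof (rule nn_integral_cong_AE)
      show "AE \<omega> in P. emeasure D ((\<lambda>t. (t, \<omega>)) -` {w \<in> space (D \<Otimes>\<^sub>M P). regular_inverse w \<le> a}) = ennreal (1 - exp (- z * subordinator a \<omega>))"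
        using AE_regular_paths
      proof eventually_elim
        case (elim \<omega>)
        then have sp: "\<omega> \<in> space P" and subordinator_nonneg: "subordinator a \<omega> \<ge> 0"
          using subordinator_mono[of \<omega> 0 a] a by (auto simp: regular_paths_def)
        have "(\<lambda>t. (t, \<omega>)) -` {w \<in> space (D \<Otimes>\<^sub>M P). regular_inverse w \<le> a} = {..subordinator a \<omega>}"
          using regular_inverse_le_iff[OF a] elim sp subordinator_nonneg by (auto simp: space_pair_measure space_D)
        moreover have "emeasure D {..subordinator a \<omega>} = ennreal (erlang_CDF 0 z (subordinator a \<omega>))"
          unfolding D_def using nn_integral_erlang_density[OF z, of 0 "subordinator a \<omega>"]
          by (simp add: emeasure_density)
        ultimately show ?case using subordinator_nonneg by (simp add: erlang_CDF_def)
      qed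
    qed
    also have "\<dots> = ennreal (expectation (\<lambda>\<omega>. 1 - exp (- z * subordinator a \<omega>)))"
    proof (rule nn_integral_eq_integral)
      show "integrable P (\<lambda>\<omega>. 1 - exp (- z * subordinator a \<omega>))"
        by (intro Bochner_Integration.integrable_diff exp_subordinator_integrable a z) simp
      show "AE \<omega> in P. 0 \<le> 1 - exp (- z * subordinator a \<omega>)"
        using AE_regular_paths
      proof eventually_elim
        case (elim \<omega>)
        then have "subordinator a \<omega> \<ge> 0" using subordinator_mono[of \<omega> 0 a] a by (auto simp: regular_paths_def)
        then show ?case using z by simp
      qed
    qed
    also have "expectation (\<lambda>\<omega>. 1 - exp (- z * subordinator a \<omega>)) = 1 - exp (- a * \<phi> z)"
      using subordinator_laplace[OF a z] exp_subordinator_integrable[OF a z] by (simp add: prob_space)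
    finally show "emeasure (D \<Otimes>\<^sub>M P) {w \<in> space (D \<Otimes>\<^sub>M P). regular_inverse w \<le> a} = 1 - ennreal (exp (- a * \<phi> z))"
      by (simp add: ennreal_minus ennreal_1[symmetric] del: ennreal_1)
  qed
  then show ?thesis by (simp add: D_def)
qed

text \<open>Up to the factor \<open>z\<close>, the Laplace transform of \<open>t \<mapsto> E g(T t)\<close> is the expectation of \<open>g\<close> at the
  inverse evaluated at an exponential time, and that time is exponential of rate \<open>\<phi> z\<close>.\<close>

lemma has_laplace_expectation_T:
  assumes z: "z > 0" and g [measurable]: "g \<in> borel_measurable borel" and g_le: "\<And>x. \<bar>g x\<bar> \<le> 1"
    and g_lap: "has_laplace g (\<phi> z) y"
    and T [measurable]: "\<And>t. t > 0 \<Longrightarrow> T t \<in> borel_measurable P"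
  shows "has_laplace (\<lambda>t. expectation (\<lambda>\<omega>. g (T t \<omega>))) z (\<phi> z / z * y)"
proof -
  define D where "D = density lborel (exponential_density z)"
  interpret D: prob_space D
    unfolding D_def using z by (rule prob_space_exponential_density)
  interpret DP: pair_prob_space D P ..
  have sets_D [measurable_cong]: "sets D = sets borel" by (simp add: D_def)
  have dist: "distributed (D \<Otimes>\<^sub>M P) lborel regular_inverse (exponential_density (\<phi> z))"
    using regular_inverse_exponential[OF z] by (simp add: D_def)
  have regular_inverse_meas [measurable]: "regular_inverse \<in> borel_measurable (D \<Otimes>\<^sub>M P)"
    using distributed_measurable[OF dist] by simp
  have regular_inverse_meas' [measurable]: "regular_inverse \<in> borel_measurable (borel \<Otimes>\<^sub>M P)"
    using regular_inverse_meas by (simp add: measurable_def sets_D cong: sets_pair_measure_cong)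
  define h where "h t = expectation (\<lambda>\<omega>. g (regular_inverse (t, \<omega>)))" for t
  have h_meas [measurable]: "h \<in> borel_measurable borel"
    unfolding h_def by measurable
  have h_eq: "h t = expectation (\<lambda>\<omega>. g (T t \<omega>))" if "t > 0" for t
    unfolding h_def
  proof (rule integral_cong_AE)
    show "AE \<omega> in P. g (regular_inverse (t, \<omega>)) = g (T t \<omega>)"
      using AE_regular_paths by eventually_elim (use that in \<open>simp add: regular_inverse_def\<close>)
  qed (use that in measurable)
  have h_le: "\<bar>h t\<bar> \<le> 1" for t
  proof -
    have "\<bar>h t\<bar> \<le> expectation (\<lambda>\<omega>. \<bar>g (regular_inverse (t, \<omega>))\<bar>)"
      unfolding h_def by (rule integral_abs_bound)
    also have "\<dots> \<le> 1"
      by (rule integral_le_const) (auto intro!: integrable_const_bound[where B = 1] simp: g_le)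
    finally show ?thesis .
  qed
  have h_lap: "has_laplace h z (LINT t|lborel. indicator {0<..} t * (exp (- z * t) * h t))"
    by (rule bounded_has_laplace[OF z h_meas h_le])
  have exp_dens: "(LINT t|lborel. exponential_density l t * u t) =
      l * (LINT t|lborel. indicator {0<..} t * (exp (- l * t) * u t))"
    if [measurable]: "u \<in> borel_measurable borel" for l and u :: "real \<Rightarrow> real"
  proof -
    have "(LINT t|lborel. exponential_density l t * u t) =
        (LINT t|lborel. l * (indicator {0<..} t * (exp (- l * t) * u t)))"
    proof (rule integral_cong_AE)
      show "AE t in lborel. exponential_density l t * u t = l * (indicator {0<..} t * (exp (- l * t) * u t))"
        using AE_lborel_singleton[of "0::real"]
        by eventually_elim (auto simp: exponential_density_def indicator_def mult.commute)
    qed measurable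
    then show ?thesis by simp
  qed
  have "(LINT x|lborel. exponential_density (\<phi> z) x * g x) = integral\<^sup>L (D \<Otimes>\<^sub>M P) (\<lambda>w. g (regular_inverse w))"
    by (rule distributed_integral[OF dist]) (use \<phi>_pos[OF z] in \<open>auto simp: exponential_density_nonneg\<close>)
  also have "\<dots> = (LINT t|D. h t)"
    unfolding h_def
    by (rule DP.integral_fst'[symmetric]) (auto intro!: DP.integrable_const_bound[where B = 1] simp: g_le)
  also have "\<dots> = (LINT t|lborel. exponential_density z t * h t)"
    unfolding D_def by (rule integral_real_density) (use z in \<open>auto simp: exponential_density_nonneg\<close>)
  finally have "\<phi> z * y = z * (LINT t|lborel. indicator {0<..} t * (exp (- z * t) * h t))"
    using g_lap by (simp add: exp_dens has_laplace_def has_bochner_integral_iff)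
  then have "has_laplace h z (\<phi> z / z * y)"
    using h_lap z by (simp add: field_simps)
  then show ?thesis
    by (subst has_laplace_cong[where g = h]) (simp_all add: h_eq)
qed

end

section \<open>The time-changed process and its fractional equation\<close>

locale time_changed_counting = generalized_counting P k lam M + subordinator_sum P N mu nu H
  for P :: "'a measure" and k :: nat and lam :: "nat \<Rightarrow> real" and M :: "real \<Rightarrow> 'a \<Rightarrow> nat"
    and N :: nat and mu nu :: "nat \<Rightarrow> real" and H :: "nat \<Rightarrow> real \<Rightarrow> 'a \<Rightarrow> real" +
  assumes MT_indep: "indep_var (PiM {0..} (\<lambda>_. borel)) (trajectory (\<lambda>t \<omega>. real (M t \<omega>)))
                     (PiM {0..} (\<lambda>_. borel)) (trajectory T)"
begin

definition tc_prob :: "nat \<Rightarrow> real \<Rightarrow> real" where "tc_prob n t = \<P>(\<omega> in P. M (T t \<omega>) \<omega> = n)"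

lemma indep_M_T:
  assumes "s \<ge> 0" "t \<ge> 0"
  shows "indep_var borel (\<lambda>\<omega>. real (M s \<omega>)) borel (T t)"
proof -
  have "indep_var borel ((\<lambda>x. x s) \<circ> trajectory (\<lambda>t \<omega>. real (M t \<omega>))) borel ((\<lambda>x. x t) \<circ> trajectory T)"
    by (rule indep_var_compose[OF MT_indep]) (use assms in \<open>auto intro: measurable_component_singleton\<close>)
  then show ?thesis using assms by (simp add: comp_def trajectory_def)
qed

lemma T_measurable: "t \<ge> 0 \<Longrightarrow> T t \<in> borel_measurable P"
  using indep_var_rv2[OF indep_M_T[of 0 t]] by simp

lemma tc_prob_eq: "t \<ge> 0 \<Longrightarrow> tc_prob n t = expectation (\<lambda>\<omega>. state_prob n (T t \<omega>))"
  unfolding tc_prob_def by (rule time_change) (auto intro: T_measurable T_nonneg indep_M_T)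

lemma tc_prob_has_laplace: "z > 0 \<Longrightarrow> has_laplace (tc_prob n) z (\<phi> z / z * state_laplace n (\<phi> z))"
proof -
  assume z: "z > 0"
  have "has_laplace (\<lambda>t. expectation (\<lambda>\<omega>. state_prob n (T t \<omega>))) z (\<phi> z / z * state_laplace n (\<phi> z))"
    by (rule has_laplace_expectation_T[OF z state_prob_measurable])
       (auto intro: state_prob_has_laplace \<phi>_pos z T_measurable simp: state_prob_bounds abs_of_nonneg)
  then show "has_laplace (tc_prob n) z (\<phi> z / z * state_laplace n (\<phi> z))"
    by (subst has_laplace_cong[where g = "\<lambda>t. expectation (\<lambda>\<omega>. state_prob n (T t \<omega>))"]) (simp_all add: tc_prob_eq)
qed

lemma tc_prob_left_cont:
  assumes t: "t > 0"
  shows "(tc_prob n \<longlongrightarrow> tc_prob n t) (at_left t)"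
proof (rule tendsto_at_left_sequentially[OF t])
  fix u :: "nat \<Rightarrow> real"
  assume u: "\<And>i. u i < t" "\<And>i. 0 < u i" "u \<longlonglongrightarrow> t"
  have "filterlim u (at_left t) sequentially"
    using u(3) by (simp add: filterlim_at u(1) less_imp_neq[OF u(1)])
  have "(\<lambda>i. expectation (\<lambda>\<omega>. state_prob n (T (u i) \<omega>))) \<longlonglongrightarrow> expectation (\<lambda>\<omega>. state_prob n (T t \<omega>))"
  proof (rule integral_dominated_convergence[where w = "\<lambda>_. 1"])
    show "AE \<omega> in P. (\<lambda>i. state_prob n (T (u i) \<omega>)) \<longlonglongrightarrow> state_prob n (T t \<omega>)"
      using AE_regular_paths
    proof eventually_elim
      case (elim \<omega>)
      have "(\<lambda>i. T (u i) \<omega>) \<longlonglongrightarrow> T t \<omega>"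
        by (rule filterlim_compose[OF T_left_cont[OF elim t]]) fact
      then show ?case by (rule isCont_tendsto_compose[OF state_prob_isCont])
    qed
    show "(\<lambda>\<omega>. state_prob n (T t \<omega>)) \<in> borel_measurable P"
      by (rule measurable_compose[OF T_measurable state_prob_measurable]) (use t in simp)
    show "(\<lambda>\<omega>. state_prob n (T (u i) \<omega>)) \<in> borel_measurable P" for i
      by (rule measurable_compose[OF T_measurable state_prob_measurable]) (use u(2)[of i] in simp)
  qed (auto simp: state_prob_bounds abs_of_nonneg)
  then show "(\<lambda>i. tc_prob n (u i)) \<longlonglongrightarrow> tc_prob n t"
    using u t by (simp add: tc_prob_eq less_imp_le)
qed

lemma tc_prob_0: "tc_prob n 0 = (if n = 0 then 1 else 0)"
  using state_prob_0[of n] by (simp add: tc_prob_eq inverse_process_def prob_space)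

text \<open>Induction along the recursion; each step multiplies by \<open>1 / (\<phi> z + \<Sum>j. lam j)\<close>, which
  contributes the exponents of at least \<open>\<beta>\<close>.\<close>

lemma state_laplace_has_frac_expansion:
  assumes z0: "z0 > 0" and \<beta>: "\<beta> > 0"
    and R: "has_frac_expansion \<beta> z0 B (\<lambda>z. 1 / (\<phi> z + (\<Sum>j=1..k. lam j)))"
    and lam: "\<And>j. j \<in> {1..k} \<Longrightarrow> lam j > 0"
  shows "\<exists>B. has_frac_expansion \<beta> z0 B (\<lambda>z. state_laplace n (\<phi> z))"
proof (induction n rule: less_induct)
  case (less n)
  define Lam where "Lam = (\<Sum>j=1..k. lam j)"
  have Lam: "Lam \<ge> 0" unfolding Lam_def by (intro sum_nonneg less_imp_le lam)
  have "\<exists>C. \<forall>i. i < n \<longrightarrow> has_frac_expansion \<beta> z0 (C i) (\<lambda>z. state_laplace i (\<phi> z))"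
    using less.IH by (intro choice) blast
  then obtain C where C: "\<And>i. i < n \<Longrightarrow> has_frac_expansion \<beta> z0 (C i) (\<lambda>z. state_laplace i (\<phi> z))" by blast
  define V where "V z = (if n = 0 then 1 else 0) * 1 + (\<Sum>j=1..min n k. lam j * state_laplace (n - j) (\<phi> z))" for z
  define B' where "B' = \<bar>if n = 0 then 1 else 0\<bar> * 1 + (\<Sum>j=1..min n k. \<bar>lam j\<bar> * C (n - j))"
  have V: "has_frac_expansion 0 z0 B' V"
    unfolding V_def B'_def
  proof (intro has_frac_expansion_add has_frac_expansion_sum has_frac_expansion_cmult has_frac_expansion_1)
    show "has_frac_expansion 0 z0 (C (n - j)) (\<lambda>z. state_laplace (n - j) (\<phi> z))" if "j \<in> {1..min n k}" for j
      by (rule has_frac_expansion_mono[OF C]) (use that \<beta> in auto)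
  qed (use z0 in auto)
  have "has_frac_expansion (\<beta> + 0) z0 (B * B') (\<lambda>z. 1 / (\<phi> z + Lam) * V z)"
    by (intro has_frac_expansion_mult V) (use R \<beta> z0 in \<open>auto simp: Lam_def\<close>)
  moreover have "state_laplace n (\<phi> z) = 1 / (\<phi> z + Lam) * V z" if "z \<ge> z0" for z
  proof -
    have pos: "\<phi> z > 0" by (rule \<phi>_pos) (use that z0 in simp)
    have "(\<phi> z + Lam) * state_laplace n (\<phi> z) = V z"
      using state_laplace_recursion[OF pos, of n] unfolding V_def Lam_def by simp
    then show ?thesis using pos Lam by (simp add: field_simps)
  qed
  ultimately show ?case by (auto elim!: has_frac_expansion_mono)
qed

text \<open>With \<open>W(z) = \<phi>(z) * Q\<^sub>n(\<phi>(z)) - q\<^sub>n(0)\<close>, for \<open>Q\<^sub>n\<close> the transform of the state probability \<open>q\<^sub>n\<close>, the fractional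
  power series of \<open>W\<close> is \<open>p\<^sub>n - q\<^sub>n(0)\<close>. Its Caputo derivative of order \<open>nu j\<close> has the transform
  \<open>z powr nu j * W z / z\<close>, so the left-hand side of the equation has the transform \<open>\<phi> z * W z / z\<close>. By
  \<open>state_laplace_recursion\<close> this is the transform of the right-hand side as well.\<close>

lemma fractional_equation:
  assumes munu: "\<And>j. j \<in> {1..N} \<Longrightarrow> mu j > 0 \<and> 0 < nu j \<and> nu j < 1"
    and lam: "\<And>j. j \<in> {1..k} \<Longrightarrow> lam j > 0" and k: "k \<ge> 1"
    and t: "t > 0"
  shows "\<forall>j\<in>{1..N}. caputo_differentiable (nu j) (tc_prob n) t"
    and "(\<Sum>j=1..N. mu j * caputo_derivative (nu j) (tc_prob n) t) =
           - (\<Sum>j=1..k. lam j) * tc_prob n t + (\<Sum>j=1..min n k. lam j * tc_prob (n - j) t)"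
proof -
  define Lam where "Lam = (\<Sum>j=1..k. lam j)"
  have Lam: "Lam > 0" unfolding Lam_def by (intro sum_pos lam) (use k in auto)
  have ne: "{1..N} \<noteq> {}" using mu_pos by auto
  obtain \<beta> z0 B where \<beta>: "\<beta> > 0" and z0: "z0 > 0" and nu_le: "\<And>j. j \<in> {1..N} \<Longrightarrow> nu j \<le> \<beta>"
    and "has_frac_expansion \<beta> z0 B (\<lambda>z. 1 / ((\<Sum>j\<in>{1..N}. mu j * z powr nu j) + Lam))"
    using has_frac_expansion_inverse_multi_term[of "{1..N}" mu nu Lam] munu ne Lam by auto
  then have R: "has_frac_expansion \<beta> z0 B (\<lambda>z. 1 / (\<phi> z + (\<Sum>j=1..k. lam j)))"
    by (simp add: \<phi>_def Lam_def)
  have "\<exists>C. \<forall>i. has_frac_expansion \<beta> z0 (C i) (\<lambda>z. state_laplace i (\<phi> z))"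
    using state_laplace_has_frac_expansion[OF z0 \<beta> R lam] by (intro choice) blast
  then obtain C where C: "\<And>i. has_frac_expansion \<beta> z0 (C i) (\<lambda>z. state_laplace i (\<phi> z))" by blast
  define W where "W z = - Lam * state_laplace n (\<phi> z) + (\<Sum>j=1..min n k. lam j * state_laplace (n - j) (\<phi> z))" for z
  have W_eq: "\<phi> z * state_laplace n (\<phi> z) = state_prob n 0 + W z" if "z > 0" for z
    using state_laplace_recursion[OF \<phi>_pos[OF that], of n] by (simp add: W_def Lam_def state_prob_0 algebra_simps)
  define B' where "B' = \<bar>- Lam\<bar> * C n + (\<Sum>j=1..min n k. \<bar>lam j\<bar> * C (n - j))"
  have "has_frac_expansion \<beta> z0 B' W"
    unfolding W_def B'_def
    by (intro has_frac_expansion_add has_frac_expansion_sum has_frac_expansion_cmult C) (use \<beta> z0 in auto)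
  then obtain c a :: "nat \<Rightarrow> real" where a_ge: "\<And>i. a i \<ge> \<beta>"
    and summ: "summable (\<lambda>i. \<bar>c i\<bar> * z0 powr (- a i))"
    and W: "\<And>z. z \<ge> z0 \<Longrightarrow> W z = (\<Sum>i. c i * z powr (- a i))"
    unfolding has_frac_expansion_def by blast
  interpret F: frac_power_series c a z0
    using z0 summ order_trans[OF less_imp_le[OF \<beta>] a_ge] by unfold_locales auto
  have prob_series: "tc_prob n s = state_prob n 0 + F.series s" if s: "s > 0" for s
  proof (rule laplace_eq_imp_eq[where ?z0.0 = z0 and F = "\<lambda>z. \<phi> z / z * state_laplace n (\<phi> z)"
        and f = "tc_prob n" and g = "\<lambda>s. state_prob n 0 + F.series s"])
    fix z assume z: "z > z0"
    then have z_pos: "z > 0" using z0 by simp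
    show "has_laplace (tc_prob n) z (\<phi> z / z * state_laplace n (\<phi> z))" by (rule tc_prob_has_laplace[OF z_pos])
    have "has_laplace (\<lambda>t. state_prob n 0 * frac_monomial 0 t + F.series t) z (state_prob n 0 * (z powr (- 0) / z) + W z / z)"
      unfolding W[OF less_imp_le[OF z]]
      by (intro has_laplace_add has_laplace_cmult frac_monomial_has_laplace F.has_laplace_series z z_pos) simp
    moreover have "state_prob n 0 * (z powr (- 0) / z) + W z / z = \<phi> z / z * state_laplace n (\<phi> z)"
      using W_eq[OF z_pos] z_pos by (simp add: field_simps)
    ultimately show "has_laplace (\<lambda>s. state_prob n 0 + F.series s) z (\<phi> z / z * state_laplace n (\<phi> z))"
      by (subst has_laplace_cong[where g = "\<lambda>t. state_prob n 0 * frac_monomial 0 t + F.series t"])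
         (simp_all add: frac_monomial_def)
  next
    have "isCont F.series s" by (rule F.series_isCont[OF s])
    then show "((\<lambda>s. state_prob n 0 + F.series s) \<longlongrightarrow> state_prob n 0 + F.series s) (at_left s)"
      by (intro tendsto_intros) (simp add: continuous_at_imp_continuous_at_within continuous_within[symmetric])
  qed (use s tc_prob_left_cont in auto)
  have nu_c: "0 < nu j" "nu j < 1" "nu j \<le> \<beta>" if "j \<in> {1..N}" for j
    using munu[OF that] nu_le[OF that] by auto
  show "\<forall>j\<in>{1..N}. caputo_differentiable (nu j) (tc_prob n) t"
    using F.caputo_series(1)[OF a_ge nu_c t prob_series] by blast
  define D where "D j = frac_power_series.series c (\<lambda>i. a i - nu j)" for j
  have D: "frac_power_series c (\<lambda>i. a i - nu j) z0" if j: "j \<in> {1..N}" for j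
    by (rule F.shift_exponents) (rule order_trans[OF nu_c(3)[OF j] a_ge])
  have D_lap: "has_laplace (D j) z (z powr nu j * W z / z)" if j: "j \<in> {1..N}" and z: "z > z0" for j z
  proof -
    interpret Dj: frac_power_series c "\<lambda>i. a i - nu j" z0 by (rule D[OF j])
    have "has_laplace (D j) z ((\<Sum>i. c i * z powr (- (a i - nu j))) / z)"
      unfolding D_def by (rule Dj.has_laplace_series[OF z])
    also have "(\<Sum>i. c i * z powr (- (a i - nu j))) = z powr nu j * W z"
    proof -
      have "c i * z powr (- (a i - nu j)) = z powr nu j * (c i * z powr (- a i))" for i
        using z z0 by (simp add: powr_diff powr_minus field_simps)
      then show ?thesis
        unfolding W[OF less_imp_le[OF z]] by (simp only: suminf_mult[OF F.summable_signed[OF less_imp_le[OF z]]])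
    qed
    finally show ?thesis .
  qed
  have "(\<Sum>j=1..N. mu j * D j t) = - Lam * tc_prob n t + (\<Sum>j=1..min n k. lam j * tc_prob (n - j) t)"
  proof (rule laplace_eq_imp_eq[where ?z0.0 = z0 and F = "\<lambda>z. \<phi> z / z * W z"
        and f = "\<lambda>t. \<Sum>j=1..N. mu j * D j t"
        and g = "\<lambda>t. - Lam * tc_prob n t + (\<Sum>j=1..min n k. lam j * tc_prob (n - j) t)"])
    fix z assume z: "z > z0"
    have "has_laplace (\<lambda>t. \<Sum>j=1..N. mu j * D j t) z (\<Sum>j=1..N. mu j * (z powr nu j * W z / z))"
      by (intro has_laplace_sum has_laplace_cmult D_lap z)
    also have "(\<Sum>j=1..N. mu j * (z powr nu j * W z / z)) = \<phi> z / z * W z"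
      unfolding \<phi>_def sum_divide_distrib sum_distrib_right by (intro sum.cong) simp_all
    finally show "has_laplace (\<lambda>t. \<Sum>j=1..N. mu j * D j t) z (\<phi> z / z * W z)" .
    have "has_laplace (\<lambda>t. - Lam * tc_prob n t + (\<Sum>j=1..min n k. lam j * tc_prob (n - j) t)) z
        (- Lam * (\<phi> z / z * state_laplace n (\<phi> z)) + (\<Sum>j=1..min n k. lam j * (\<phi> z / z * state_laplace (n - j) (\<phi> z))))"
      by (intro has_laplace_add has_laplace_sum has_laplace_cmult tc_prob_has_laplace) (use z z0 in auto)
    moreover have "- Lam * (x * A) + (\<Sum>j=1..min n k. lam j * (x * B j)) =
        x * (- Lam * A + (\<Sum>j=1..min n k. lam j * B j))" for x A and B :: "nat \<Rightarrow> real"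
      by (simp add: sum_distrib_left algebra_simps)
    ultimately show "has_laplace (\<lambda>t. - Lam * tc_prob n t + (\<Sum>j=1..min n k. lam j * tc_prob (n - j) t)) z (\<phi> z / z * W z)"
      unfolding W_def by (simp only:)
  next
    have "isCont (D j) t" if "j \<in> {1..N}" for j
      unfolding D_def by (rule frac_power_series.series_isCont[OF D[OF that] t])
    then have "isCont (\<lambda>t. \<Sum>j=1..N. mu j * D j t) t"
      by (intro continuous_intros) auto
    then show "((\<lambda>t. \<Sum>j=1..N. mu j * D j t) \<longlongrightarrow> (\<Sum>j=1..N. mu j * D j t)) (at_left t)"
      by (simp add: isCont_def filterlim_at_split)
    show "((\<lambda>t. - Lam * tc_prob n t + (\<Sum>j=1..min n k. lam j * tc_prob (n - j) t)) \<longlongrightarrow>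
        - Lam * tc_prob n t + (\<Sum>j=1..min n k. lam j * tc_prob (n - j) t)) (at_left t)"
      by (intro tendsto_intros tc_prob_left_cont[OF t])
  qed (rule t)
  moreover have "caputo_derivative (nu j) (tc_prob n) t = D j t" if "j \<in> {1..N}" for j
    unfolding D_def by (rule F.caputo_series(2)[OF a_ge nu_c[OF that] t prob_series])
  ultimately show "(\<Sum>j=1..N. mu j * caputo_derivative (nu j) (tc_prob n) t) =
           - (\<Sum>j=1..k. lam j) * tc_prob n t + (\<Sum>j=1..min n k. lam j * tc_prob (n - j) t)"
    by (simp add: Lam_def)
qed

end

section \<open>Weighted compositions\<close>

text \<open>The coefficient of \<open>x ^ n\<close> in \<open>(\<Sum>j=1..k. w j * x ^ j) ^ r\<close>. For nonnegative weights of sum 1, it is the probability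
  that \<open>r\<close> independent jumps add up to \<open>n\<close>.\<close>

definition composition_weight :: "nat \<Rightarrow> (nat \<Rightarrow> real) \<Rightarrow> nat \<Rightarrow> nat \<Rightarrow> real" where
  "composition_weight k w n r =
     (\<Sum>\<alpha>\<in>weighted_compositions k r n. multinomial k r \<alpha> * (\<Prod>j=1..k. w j ^ \<alpha> j))"

lemma composition_weight_eq_0:
  assumes "r > n" shows "composition_weight k w n r = 0"
proof -
  have "weighted_compositions k r n = {}"
  proof (rule equals0I)
    fix \<alpha> assume "\<alpha> \<in> weighted_compositions k r n"
    then have "(\<Sum>j=1..k. \<alpha> j) = r" "(\<Sum>j=1..k. j * \<alpha> j) = n"
      by (auto simp: weighted_compositions_def)
    moreover have "(\<Sum>j=1..k. \<alpha> j) \<le> (\<Sum>j=1..k. j * \<alpha> j)"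
      by (rule sum_mono) auto
    ultimately show False using assms by simp
  qed
  then show ?thesis by (simp add: composition_weight_def)
qed

lemma composition_weight_0: "composition_weight k w n 0 = (if n = 0 then 1 else 0)"
proof -
  have "weighted_compositions k 0 n = (if n = 0 then {\<lambda>j\<in>{1..k}. 0} else {})"
    by (auto simp: weighted_compositions_def PiE_def extensional_def fun_eq_iff)
  then show ?thesis by (simp add: composition_weight_def multinomial_def)
qed

text \<open>Split off one of the \<open>r + 1\<close> parts. As \<open>\<Sum>j. \<alpha> j = r + 1\<close>, the multinomial coefficient is the sum over \<open>j\<close> of
  those with \<open>\<alpha> j\<close> lowered by 1, and lowering \<open>\<alpha> j\<close> is a bijection onto the compositions of \<open>n - j\<close>.\<close>

lemma composition_weight_Suc:
  "composition_weight k w n (Suc r) = (\<Sum>j=1..min n k. w j * composition_weight k w (n - j) r)"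
proof -
  define X where "X r \<alpha> = multinomial k r \<alpha> * (\<Prod>j=1..k. w j ^ \<alpha> j)" for r \<alpha>
  have X_eq: "X r \<alpha> = fact r * (\<Prod>j=1..k. w j ^ \<alpha> j / fact (\<alpha> j))" for r \<alpha>
    by (simp add: X_def multinomial_def prod_dividef)
  have step: "w j * X r (\<alpha>(j := \<alpha> j - 1)) = fact r * real (\<alpha> j) * (\<Prod>i=1..k. w i ^ \<alpha> i / fact (\<alpha> i))"
    if j: "j \<in> {1..k}" and pos: "\<alpha> j \<ge> 1" for j \<alpha>
  proof -
    have rest: "(\<Prod>i\<in>{1..k} - {j}. w i ^ (\<alpha>(j := \<alpha> j - 1)) i / fact ((\<alpha>(j := \<alpha> j - 1)) i)) =
        (\<Prod>i\<in>{1..k} - {j}. w i ^ \<alpha> i / fact (\<alpha> i))"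
      by (rule prod.cong) auto
    obtain b where b: "\<alpha> j = Suc b" using pos by (cases "\<alpha> j") auto
    have "w j * (w j ^ b / fact b) = real (Suc b) * (w j ^ Suc b / fact (Suc b))"
      unfolding fact_Suc power_Suc by (simp del: of_nat_Suc)
    moreover have "(\<Prod>i=1..k. w i ^ (\<alpha>(j := \<alpha> j - 1)) i / fact ((\<alpha>(j := \<alpha> j - 1)) i)) =
        w j ^ b / fact b * (\<Prod>i\<in>{1..k} - {j}. w i ^ \<alpha> i / fact (\<alpha> i))"
      using prod.remove[OF finite_atLeastAtMost j, of "\<lambda>i. w i ^ (\<alpha>(j := \<alpha> j - 1)) i / fact ((\<alpha>(j := \<alpha> j - 1)) i)"]
      unfolding rest b by simp
    moreover have "(\<Prod>i=1..k. w i ^ \<alpha> i / fact (\<alpha> i)) =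
        w j ^ Suc b / fact (Suc b) * (\<Prod>i\<in>{1..k} - {j}. w i ^ \<alpha> i / fact (\<alpha> i))"
      using prod.remove[OF finite_atLeastAtMost j, of "\<lambda>i. w i ^ \<alpha> i / fact (\<alpha> i)"]
      unfolding b by simp
    moreover have "w j * (F * (A * R)) = F * S * (B * R)" if "w j * A = S * B" for F A R S B
    proof -
      have "w j * (F * (A * R)) = (w j * A) * (F * R)" by simp
      then show ?thesis unfolding that by simp
    qed
    ultimately show ?thesis unfolding X_eq b by (simp only:)
  qed
  have split: "X (Suc r) \<alpha> = (\<Sum>j\<in>{1..k}. if \<alpha> j \<ge> 1 then w j * X r (\<alpha>(j := \<alpha> j - 1)) else 0)"
    if \<alpha>: "\<alpha> \<in> weighted_compositions k (Suc r) n" for \<alpha>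
  proof -
    have "(\<Sum>j\<in>{1..k}. if \<alpha> j \<ge> 1 then w j * X r (\<alpha>(j := \<alpha> j - 1)) else 0) =
        (\<Sum>j\<in>{1..k}. fact r * real (\<alpha> j) * (\<Prod>i=1..k. w i ^ \<alpha> i / fact (\<alpha> i)))"
      by (rule sum.cong) (use step in auto)
    also have "\<dots> = fact r * real (\<Sum>j=1..k. \<alpha> j) * (\<Prod>i=1..k. w i ^ \<alpha> i / fact (\<alpha> i))"
      by (simp add: sum_distrib_left sum_distrib_right)
    also have "(\<Sum>j=1..k. \<alpha> j) = Suc r" using \<alpha> by (simp add: weighted_compositions_def)
    finally show ?thesis by (simp add: X_eq mult_ac)
  qed
  have inner: "(\<Sum>\<alpha>\<in>weighted_compositions k (Suc r) n. if \<alpha> j \<ge> 1 then w j * X r (\<alpha>(j := \<alpha> j - 1)) else 0) =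
      (if j \<le> n then w j * composition_weight k w (n - j) r else 0)"
    if j: "j \<in> {1..k}" for j
  proof -
    have sum_j: "(\<Sum>i=1..k. f i) = f j + (\<Sum>i\<in>{1..k} - {j}. f i)" for f :: "nat \<Rightarrow> nat"
      by (rule sum.remove) (use j in auto)
    have upd1: "(\<Sum>i=1..k. (\<alpha>(j := b)) i) = b + (\<Sum>i\<in>{1..k} - {j}. \<alpha> i)" for \<alpha> :: "nat \<Rightarrow> nat" and b
      unfolding sum_j by (auto intro!: sum.cong)
    have upd2: "(\<Sum>i=1..k. i * (\<alpha>(j := b)) i) = j * b + (\<Sum>i\<in>{1..k} - {j}. i * \<alpha> i)" for \<alpha> :: "nat \<Rightarrow> nat" and b
      unfolding sum_j by (auto intro!: sum.cong)
    have PiE_upd: "\<alpha>(j := b) \<in> {1..k} \<rightarrow>\<^sub>E UNIV" if "\<alpha> \<in> {1..k} \<rightarrow>\<^sub>E UNIV" for \<alpha> :: "nat \<Rightarrow> nat" and b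
      using that j by (auto simp: PiE_def extensional_def)
    have down: "\<alpha>(j := \<alpha> j - 1) \<in> weighted_compositions k r (n - j) \<and> j \<le> n"
      if \<alpha>: "\<alpha> \<in> weighted_compositions k (Suc r) n" and pos: "\<alpha> j \<ge> 1" for \<alpha>
    proof -
      obtain b where b: "\<alpha> j = Suc b" using pos by (cases "\<alpha> j") auto
      have "(\<Sum>i=1..k. \<alpha> i) = Suc r" "(\<Sum>i=1..k. i * \<alpha> i) = n"
        using \<alpha> by (auto simp: weighted_compositions_def)
      then have "Suc b + (\<Sum>i\<in>{1..k} - {j}. \<alpha> i) = Suc r" "j * Suc b + (\<Sum>i\<in>{1..k} - {j}. i * \<alpha> i) = n"
        unfolding sum_j b by simp_all
      then show ?thesis
        unfolding weighted_compositions_def mem_Collect_eq upd1 upd2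
        using \<alpha> b PiE_upd by (auto simp: weighted_compositions_def)
    qed
    have up: "\<alpha>(j := Suc (\<alpha> j)) \<in> weighted_compositions k (Suc r) n"
      if \<alpha>: "\<alpha> \<in> weighted_compositions k r (n - j)" and "j \<le> n" for \<alpha>
    proof -
      have "(\<Sum>i=1..k. \<alpha> i) = r" "(\<Sum>i=1..k. i * \<alpha> i) = n - j"
        using \<alpha> by (auto simp: weighted_compositions_def)
      then have "\<alpha> j + (\<Sum>i\<in>{1..k} - {j}. \<alpha> i) = r" "j * \<alpha> j + (\<Sum>i\<in>{1..k} - {j}. i * \<alpha> i) = n - j"
        unfolding sum_j by simp_all
      then show ?thesis
        unfolding weighted_compositions_def mem_Collect_eq upd1 upd2
        using \<alpha> PiE_upd \<open>j \<le> n\<close> by (auto simp: weighted_compositions_def)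
    qed
    have "(\<Sum>\<alpha>\<in>weighted_compositions k (Suc r) n. if \<alpha> j \<ge> 1 then w j * X r (\<alpha>(j := \<alpha> j - 1)) else 0) =
        (\<Sum>\<alpha>\<in>{\<alpha> \<in> weighted_compositions k (Suc r) n. \<alpha> j \<ge> 1}. w j * X r (\<alpha>(j := \<alpha> j - 1)))"
      by (rule sum.inter_filter[symmetric]) (rule finite_weighted_compositions)
    also have "\<dots> = (if j \<le> n then w j * composition_weight k w (n - j) r else 0)"
    proof (cases "j \<le> n")
      case True
      have "(\<Sum>\<alpha>\<in>{\<alpha> \<in> weighted_compositions k (Suc r) n. \<alpha> j \<ge> 1}. w j * X r (\<alpha>(j := \<alpha> j - 1))) =
          (\<Sum>\<alpha>\<in>weighted_compositions k r (n - j). w j * X r \<alpha>)"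
        by (rule sum.reindex_bij_witness[where i = "\<lambda>\<alpha>. \<alpha>(j := Suc (\<alpha> j))" and j = "\<lambda>\<alpha>. \<alpha>(j := \<alpha> j - 1)"])
           (use down up True in auto)
      then show ?thesis using True by (simp add: composition_weight_def X_def sum_distrib_left)
    next
      case False
      then have "{\<alpha> \<in> weighted_compositions k (Suc r) n. \<alpha> j \<ge> 1} = {}" using down by auto
      then show ?thesis using False by (simp only: sum.empty if_False)
    qed
    finally show ?thesis .
  qed
  have "composition_weight k w n (Suc r) = (\<Sum>\<alpha>\<in>weighted_compositions k (Suc r) n. X (Suc r) \<alpha>)"
    by (simp add: composition_weight_def X_def)
  also have "\<dots> = (\<Sum>j\<in>{1..k}. \<Sum>\<alpha>\<in>weighted_compositions k (Suc r) n.
      if \<alpha> j \<ge> 1 then w j * X r (\<alpha>(j := \<alpha> j - 1)) else 0)"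
    by (subst sum.swap) (rule sum.cong[OF refl split])
  also have "\<dots> = (\<Sum>j\<in>{1..k}. if j \<le> n then w j * composition_weight k w (n - j) r else 0)"
    by (rule sum.cong[OF refl inner])
  also have "\<dots> = (\<Sum>j=1..min n k. w j * composition_weight k w (n - j) r)"
    by (rule sum.mono_neutral_cong_right) auto
  finally show ?thesis .
qed

text \<open>Comparison of \<open>state_laplace_recursion\<close> with \<open>composition_weight_Suc\<close>, in powers of
  \<open>x = Lam / (y + Lam)\<close>. The factor \<open>Lam ^ r / (y + Lam) ^ Suc r\<close> is the transform of
  \<open>exp (- Lam * s) * (Lam * s) ^ r / fact r\<close>, the probability of exactly \<open>r\<close> jumps up to time \<open>s\<close>.\<close>

lemma (in generalized_counting) state_laplace_closed_form:
  assumes Lam: "Lam = (\<Sum>j=1..k. lam j)" "Lam > 0" and y: "y > 0"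
  shows "state_laplace n y = (\<Sum>r=0..n. composition_weight k (\<lambda>j. lam j / Lam) n r * (Lam ^ r / (y + Lam) ^ Suc r))"
proof (induction n rule: less_induct)
  case (less n)
  define w where "w j = lam j / Lam" for j
  define x where "x = Lam / (y + Lam)"
  have yL: "y + Lam > 0" using y Lam by simp
  have term_eq: "Lam ^ r / (y + Lam) ^ Suc r = x ^ r / (y + Lam)" for r
    by (simp add: x_def power_divide)
  have IH: "lam j * state_laplace (n - j) y = (\<Sum>r<n. w j * composition_weight k w (n - j) r * x ^ Suc r)"
    if j: "j \<in> {1..min n k}" for j
  proof -
    have "n - j < n" using j by auto
    have "lam j * state_laplace (n - j) y = (\<Sum>r=0..n - j. lam j * (composition_weight k w (n - j) r * (x ^ r / (y + Lam))))"
      unfolding less.IH[OF \<open>n - j < n\<close>] term_eq w_def by (rule sum_distrib_left)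
    also have "\<dots> = (\<Sum>r=0..n - j. w j * composition_weight k w (n - j) r * x ^ Suc r)"
      using Lam(2) by (intro sum.cong) (simp_all add: w_def x_def)
    also have "\<dots> = (\<Sum>r<n. w j * composition_weight k w (n - j) r * x ^ Suc r)"
      using j by (intro sum.mono_neutral_left) (auto simp: composition_weight_eq_0)
    finally show ?thesis .
  qed
  have "(y + Lam) * state_laplace n y = (if n = 0 then 1 else 0) + (\<Sum>j=1..min n k. \<Sum>r<n. w j * composition_weight k w (n - j) r * x ^ Suc r)"
  proof -
    have "(\<Sum>j=1..min n k. lam j * state_laplace (n - j) y) =
        (\<Sum>j=1..min n k. \<Sum>r<n. w j * composition_weight k w (n - j) r * x ^ Suc r)"
      by (rule sum.cong[OF refl IH])
    then show ?thesis using state_laplace_recursion[OF y, of n] unfolding Lam(1)[symmetric] by (simp only:)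
  qed
  also have "(\<Sum>j=1..min n k. \<Sum>r<n. w j * composition_weight k w (n - j) r * x ^ Suc r) =
      (\<Sum>r<n. composition_weight k w n (Suc r) * x ^ Suc r)"
    by (subst sum.swap) (simp add: composition_weight_Suc sum_distrib_right)
  also have "(if n = 0 then 1 else 0) + (\<Sum>r<n. composition_weight k w n (Suc r) * x ^ Suc r) =
      (\<Sum>r=0..n. composition_weight k w n r * x ^ r)"
  proof -
    have "(\<Sum>r=0..n. f r) = f 0 + (\<Sum>r<n. f (Suc r))" for f :: "nat \<Rightarrow> real"
      by (simp only: atLeast0AtMost lessThan_Suc_atMost[symmetric] sum.lessThan_Suc_shift)
    from this[of "\<lambda>r. composition_weight k w n r * x ^ r"] show ?thesis
      by (simp only: composition_weight_0 power_0 mult_1_right)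
  qed
  finally have "state_laplace n y = (\<Sum>r=0..n. composition_weight k w n r * x ^ r) / (y + Lam)"
    using yL by (simp add: field_simps)
  then show ?case unfolding term_eq w_def sum_divide_distrib by simp
qed

section \<open>Laplace transforms of multivariate Mittag-Leffler functions\<close>

lemma pochhammer_binomial_series:
  fixes x g :: real
  assumes x: "\<bar>x\<bar> < 1" and g: "g > 0"
  shows "(\<lambda>n. pochhammer g n / fact n * x ^ n) summable_on UNIV"
    and "(\<Sum>\<^sub>\<infinity>n. pochhammer g n / fact n * x ^ n) = (1 - x) powr (- g)"
proof -
  have sums: "(\<lambda>n. pochhammer g n / fact n * y ^ n) sums (1 - y) powr (- g)" if "\<bar>y\<bar> < 1" for y
  proof -
    have "(- g gchoose n) * (- y) ^ n = pochhammer g n / fact n * y ^ n" for n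
    proof -
      have "(- g gchoose n) * (- y) ^ n = ((- 1) ^ n * pochhammer g n / fact n) * ((- 1) ^ n * y ^ n)"
        by (simp only: gbinomial_pochhammer minus_minus power_minus[of y])
      also have "\<dots> = ((- 1) ^ n * (- 1) ^ n) * (pochhammer g n / fact n * y ^ n)"
        by (simp only: divide_inverse mult_ac)
      also have "(- 1 :: real) ^ n * (- 1) ^ n = 1"
        by (simp only: power_mult_distrib[symmetric]) simp
      finally show ?thesis by simp
    qed
    then show ?thesis using gen_binomial_real[of "- y" "- g"] that by simp
  qed
  have "\<bar>pochhammer g n / fact n * x ^ n\<bar> = pochhammer g n / fact n * \<bar>x\<bar> ^ n" for n
    using g by (simp add: abs_mult power_abs pochhammer_nonneg abs_of_nonneg)
  then have "summable (\<lambda>n. norm (pochhammer g n / fact n * x ^ n))"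
    using sums[of "\<bar>x\<bar>"] x by (simp add: sums_iff)
  then have "((\<lambda>n. pochhammer g n / fact n * x ^ n) has_sum (1 - x) powr (- g)) UNIV"
    by (rule norm_summable_imp_has_sum) (rule sums[OF x])
  then show "(\<lambda>n. pochhammer g n / fact n * x ^ n) summable_on UNIV"
    "(\<Sum>\<^sub>\<infinity>n. pochhammer g n / fact n * x ^ n) = (1 - x) powr (- g)"
    by (auto simp: summable_on_def infsumI)
qed

lemma pochhammer_product_series:
  fixes x g :: "nat \<Rightarrow> real"
  assumes x: "\<And>l. l \<in> {1..L} \<Longrightarrow> \<bar>x l\<bar> < 1" and g: "\<And>l. l \<in> {1..L} \<Longrightarrow> g l > 0"
  shows "(\<lambda>\<kappa>. \<Prod>l=1..L. pochhammer (g l) (\<kappa> l) / fact (\<kappa> l) * x l ^ \<kappa> l) summable_on ({1..L} \<rightarrow>\<^sub>E UNIV)"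
    and "(\<Sum>\<^sub>\<infinity>\<kappa>\<in>{1..L} \<rightarrow>\<^sub>E UNIV. \<Prod>l=1..L. pochhammer (g l) (\<kappa> l) / fact (\<kappa> l) * x l ^ \<kappa> l) =
           (\<Prod>l=1..L. (1 - x l) powr (- g l))"
proof -
  have prod: "(\<Sum>\<^sub>\<infinity>\<kappa>\<in>{1..L} \<rightarrow>\<^sub>E UNIV. \<Prod>l=1..L. pochhammer (g l) (\<kappa> l) / fact (\<kappa> l) * y l ^ \<kappa> l) =
           (\<Prod>l=1..L. (1 - y l) powr (- g l))"
    if y: "\<And>l. l \<in> {1..L} \<Longrightarrow> \<bar>y l\<bar> < 1" for y
  proof -
    have "(\<Sum>\<^sub>\<infinity>\<kappa>\<in>{1..L} \<rightarrow>\<^sub>E UNIV. \<Prod>l=1..L. pochhammer (g l) (\<kappa> l) / fact (\<kappa> l) * y l ^ \<kappa> l) =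
        (\<Prod>l=1..L. \<Sum>\<^sub>\<infinity>n. pochhammer (g l) n / fact n * y l ^ n)"
    proof (rule infsum_prod_PiE_abs)
      fix l assume l: "l \<in> {1..L}"
      show "(\<lambda>n. norm (pochhammer (g l) n / fact n * y l ^ n)) summable_on UNIV"
        using pochhammer_binomial_series(1)[OF y[OF l] g[OF l]]
        by (rule summable_on_iff_abs_summable_on_real[THEN iffD1])
    qed simp
    also have "\<dots> = (\<Prod>l=1..L. (1 - y l) powr (- g l))"
      by (rule prod.cong[OF refl]) (use pochhammer_binomial_series(2) y g in auto)
    finally show ?thesis .
  qed
  show "(\<Sum>\<^sub>\<infinity>\<kappa>\<in>{1..L} \<rightarrow>\<^sub>E UNIV. \<Prod>l=1..L. pochhammer (g l) (\<kappa> l) / fact (\<kappa> l) * x l ^ \<kappa> l) =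
           (\<Prod>l=1..L. (1 - x l) powr (- g l))"
    by (rule prod[OF x])
  have "(\<Prod>l=1..L. (1 - \<bar>x l\<bar>) powr (- g l)) \<noteq> 0"
  proof -
    have "1 - \<bar>x l\<bar> > 0" if "l \<in> {1..L}" for l using x[OF that] by simp
    then have "(1 - \<bar>x l\<bar>) powr (- g l) > 0" if "l \<in> {1..L}" for l
      using that by (simp add: less_imp_neq[symmetric])
    then show ?thesis using prod_pos[of "{1..L}" "\<lambda>l. (1 - \<bar>x l\<bar>) powr (- g l)"] by simp
  qed
  then have nz: "(\<Sum>\<^sub>\<infinity>\<kappa>\<in>{1..L} \<rightarrow>\<^sub>E UNIV. \<Prod>l=1..L. pochhammer (g l) (\<kappa> l) / fact (\<kappa> l) * \<bar>x l\<bar> ^ \<kappa> l) \<noteq> 0"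
    using prod[of "\<lambda>l. \<bar>x l\<bar>"] x by simp
  \<comment> \<open>A divergent unordered sum has the default value 0, so a nonzero value shows convergence.\<close>
  have "(\<lambda>\<kappa>. \<Prod>l=1..L. pochhammer (g l) (\<kappa> l) / fact (\<kappa> l) * \<bar>x l\<bar> ^ \<kappa> l) summable_on ({1..L} \<rightarrow>\<^sub>E UNIV)"
    using nz infsum_not_exists by blast
  moreover have "norm (\<Prod>l=1..L. pochhammer (g l) (\<kappa> l) / fact (\<kappa> l) * x l ^ \<kappa> l) =
      (\<Prod>l=1..L. pochhammer (g l) (\<kappa> l) / fact (\<kappa> l) * \<bar>x l\<bar> ^ \<kappa> l)" for \<kappa>
    unfolding real_norm_def abs_prod
    by (rule prod.cong[OF refl]) (use g in \<open>simp add: abs_mult power_abs pochhammer_nonneg abs_of_nonneg\<close>)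
  ultimately have "(\<lambda>\<kappa>. norm (\<Prod>l=1..L. pochhammer (g l) (\<kappa> l) / fact (\<kappa> l) * x l ^ \<kappa> l)) summable_on ({1..L} \<rightarrow>\<^sub>E UNIV)"
    by simp
  then show "(\<lambda>\<kappa>. \<Prod>l=1..L. pochhammer (g l) (\<kappa> l) / fact (\<kappa> l) * x l ^ \<kappa> l) summable_on ({1..L} \<rightarrow>\<^sub>E UNIV)"
    by (rule abs_summable_summable)
qed

text \<open>The multiple series is a fractional power series with one term for each multi-index. Its expansion at
  infinity factorises into binomial series in \<open>eta l * z powr (- v)\<close>, and \<open>z0\<close> is large enough for these to converge.\<close>

lemma mittag_leffler_transform:
  fixes g eta :: "nat \<Rightarrow> real"
  assumes v: "v > 0" and d: "d \<ge> 0" and g: "\<And>l. l \<in> {1..L} \<Longrightarrow> g l > 0"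
    and z0: "z0 > 0" and eta: "\<And>l. l \<in> {1..L} \<Longrightarrow> \<bar>eta l\<bar> < z0 powr v"
  shows "t > 0 \<Longrightarrow> isCont (\<lambda>t. t powr d * mittag_leffler v (d + 1) L g (\<lambda>l. eta l * t powr v)) t"
    and "z > z0 \<Longrightarrow> has_laplace (\<lambda>t. t powr d * mittag_leffler v (d + 1) L g (\<lambda>l. eta l * t powr v)) z
           (z powr (- d) * (\<Prod>l=1..L. (1 - eta l * z powr (- v)) powr (- g l)) / z)"
proof -
  define I :: "(nat \<Rightarrow> nat) set" where "I = {1..L} \<rightarrow>\<^sub>E UNIV"
  define C where "C \<kappa> = (\<Prod>l=1..L. pochhammer (g l) (\<kappa> l) / fact (\<kappa> l) * eta l ^ \<kappa> l)" for \<kappa>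
  define A where "A \<kappa> = v * (\<Sum>l=1..L. real (\<kappa> l)) + d" for \<kappa>
  have I: "countable I" unfolding I_def by (rule countable_PiE) auto
  have A: "A \<kappa> \<ge> 0" for \<kappa> using v d by (simp add: A_def sum_nonneg)
  have monomial: "z powr (- A \<kappa>) = z powr (- d) * (\<Prod>l=1..L. (z powr (- v)) ^ \<kappa> l)" if "z > 0" for z \<kappa>
  proof -
    have "(\<Prod>l=1..L. (z powr (- v)) ^ \<kappa> l) = (z powr (- v)) ^ (\<Sum>l=1..L. \<kappa> l)"
      by (simp add: power_sum)
    also have "\<dots> = z powr (- v * (\<Sum>l=1..L. real (\<kappa> l)))"
      using that by (simp add: powr_realpow[symmetric] powr_powr)
    finally show ?thesis using that by (simp add: A_def powr_add[symmetric] algebra_simps)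
  qed
  have term_eq: "C \<kappa> * z powr (- A \<kappa>) =
      z powr (- d) * (\<Prod>l=1..L. pochhammer (g l) (\<kappa> l) / fact (\<kappa> l) * (eta l * z powr (- v)) ^ \<kappa> l)" if "z > 0" for z \<kappa>
  proof -
    have "C \<kappa> * (\<Prod>l=1..L. (z powr (- v)) ^ \<kappa> l) =
        (\<Prod>l=1..L. pochhammer (g l) (\<kappa> l) / fact (\<kappa> l) * (eta l * z powr (- v)) ^ \<kappa> l)"
      unfolding C_def prod.distrib[symmetric] by (rule prod.cong) (simp_all add: power_mult_distrib)
    then show ?thesis unfolding monomial[OF that] by (metis mult.left_commute)
  qed
  have small: "\<bar>eta l * z powr (- v)\<bar> < 1" if "z \<ge> z0" "l \<in> {1..L}" for z l
  proof -
    have "\<bar>eta l\<bar> < z powr v"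
      using eta[OF that(2)] powr_mono2[of v z0 z] that z0 v by simp
    then show ?thesis using that z0 by (simp add: abs_mult powr_minus field_simps)
  qed
  have summ: "(\<lambda>\<kappa>. C \<kappa> * z powr (- A \<kappa>)) summable_on I" if "z \<ge> z0" for z
    using pochhammer_product_series(1)[of L "\<lambda>l. eta l * z powr (- v)" g] small[OF that] g that z0
    by (simp add: term_eq I_def summable_on_cmult_right)
  have total: "(\<Sum>\<^sub>\<infinity>\<kappa>\<in>I. C \<kappa> * z powr (- A \<kappa>)) = z powr (- d) * (\<Prod>l=1..L. (1 - eta l * z powr (- v)) powr (- g l))"
    if "z \<ge> z0" for z
    using pochhammer_product_series[of L "\<lambda>l. eta l * z powr (- v)" g] small[OF that] g that z0
    by (simp add: term_eq I_def infsum_cmult_right)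
  obtain c a :: "nat \<Rightarrow> real" where a: "\<And>n. a n \<ge> 0"
    and abs_ca: "\<And>h. (\<lambda>i. \<bar>C i\<bar> * h (A i) :: real) summable_on I \<Longrightarrow> summable (\<lambda>n. \<bar>c n\<bar> * h (a n)) \<and>
          infsum (\<lambda>i. \<bar>C i\<bar> * h (A i)) I = (\<Sum>n. \<bar>c n\<bar> * h (a n))"
    and ca: "\<And>h. (\<lambda>i. C i * h (A i) :: real) summable_on I \<Longrightarrow>
          infsum (\<lambda>i. C i * h (A i)) I = (\<Sum>n. c n * h (a n))"
    by (rule enumerate_expansion[OF I, of 0 A C]) (use A in auto)
  have abs_summ: "(\<lambda>\<kappa>. \<bar>C \<kappa>\<bar> * z0 powr (- A \<kappa>)) summable_on I"
    using summable_on_iff_abs_summable_on_real[THEN iffD1, OF summ[OF order_refl]] by (simp add: abs_mult)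
  interpret F: frac_power_series c a z0
    using z0 a abs_ca[of "\<lambda>x. z0 powr (- x)"] abs_summ by unfold_locales auto
  have series_eq: "t powr d * mittag_leffler v (d + 1) L g (\<lambda>l. eta l * t powr v) = F.series t" if t: "t > 0" for t
  proof -
    have "(\<lambda>\<kappa>. C \<kappa> * frac_monomial (A \<kappa>) t) summable_on I"
    proof (rule abs_summable_summable, rule Infinite_Sum.abs_summable_on_comparison_test')
      show "(\<lambda>\<kappa>. \<bar>C \<kappa>\<bar> * z0 powr (- A \<kappa>) * exp (z0 * t)) summable_on I"
        by (rule summable_on_cmult_left[OF abs_summ])
      show "norm (C \<kappa> * frac_monomial (A \<kappa>) t) \<le> \<bar>C \<kappa>\<bar> * z0 powr (- A \<kappa>) * exp (z0 * t)" for \<kappa>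
        using frac_monomial_le[OF A z0 t, of \<kappa>] frac_monomial_nonneg[of "A \<kappa>" t] A[of \<kappa>]
        by (simp add: abs_mult mult.assoc mult_left_mono)
    qed
    then have "(\<Sum>\<^sub>\<infinity>\<kappa>\<in>I. C \<kappa> * frac_monomial (A \<kappa>) t) = F.series t"
      unfolding F.series_def by (rule ca)
    moreover have "C \<kappa> * frac_monomial (A \<kappa>) t = t powr d *
        ((\<Prod>l=1..L. pochhammer (g l) (\<kappa> l)) / Gamma (v * (\<Sum>l=1..L. real (\<kappa> l)) + (d + 1))
        * (\<Prod>l=1..L. (eta l * t powr v) ^ \<kappa> l / fact (\<kappa> l)))" for \<kappa>
    proof -
      have "t powr A \<kappa> = t powr d * (\<Prod>l=1..L. (t powr v) ^ \<kappa> l)"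
      proof -
        have "(\<Prod>l=1..L. (t powr v) ^ \<kappa> l) = (t powr v) ^ (\<Sum>l=1..L. \<kappa> l)"
          by (simp add: power_sum)
        also have "\<dots> = t powr (v * (\<Sum>l=1..L. real (\<kappa> l)))"
          using t by (simp add: powr_realpow[symmetric] powr_powr)
        finally show ?thesis using t by (simp add: A_def powr_add)
      qed
      moreover have "A \<kappa> + 1 = v * (\<Sum>l=1..L. real (\<kappa> l)) + (d + 1)" by (simp add: A_def)
      ultimately show ?thesis
        by (simp add: frac_monomial_def C_def rGamma_inverse_Gamma power_mult_distrib prod.distrib prod_dividef divide_inverse mult_ac add.assoc)
    qed
    ultimately have "(\<Sum>\<^sub>\<infinity>\<kappa>\<in>I. t powr d *
        ((\<Prod>l=1..L. pochhammer (g l) (\<kappa> l)) / Gamma (v * (\<Sum>l=1..L. real (\<kappa> l)) + (d + 1))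
        * (\<Prod>l=1..L. (eta l * t powr v) ^ \<kappa> l / fact (\<kappa> l)))) = F.series t"
      by (simp only:)
    then show ?thesis
      unfolding mittag_leffler_def I_def infsum_cmult_right' .
  qed
  show "isCont (\<lambda>t. t powr d * mittag_leffler v (d + 1) L g (\<lambda>l. eta l * t powr v)) t" if t: "t > 0"
  proof -
    have "\<forall>\<^sub>F s in nhds t. s powr d * mittag_leffler v (d + 1) L g (\<lambda>l. eta l * s powr v) = F.series s"
      using eventually_nhds_in_open[of "{0<..}" t] t by (auto elim!: eventually_mono simp: series_eq)
    then show ?thesis by (rule isCont_cong[THEN iffD2]) (rule F.series_isCont[OF t])
  qed
  show "has_laplace (\<lambda>t. t powr d * mittag_leffler v (d + 1) L g (\<lambda>l. eta l * t powr v)) z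
           (z powr (- d) * (\<Prod>l=1..L. (1 - eta l * z powr (- v)) powr (- g l)) / z)" if z: "z > z0"
  proof -
    have "has_laplace F.series z ((\<Sum>i. c i * z powr (- a i)) / z)" by (rule F.has_laplace_series[OF z])
    also have "(\<Sum>i. c i * z powr (- a i)) = z powr (- d) * (\<Prod>l=1..L. (1 - eta l * z powr (- v)) powr (- g l))"
      using ca[of "\<lambda>x. z powr (- x)"] summ[of z] total[of z] z by simp
    finally show ?thesis by (subst has_laplace_cong[where g = F.series]) (simp_all add: series_eq)
  qed
qed

text \<open>Divide by \<open>x ^ N\<close> and let \<open>x\<close> tend to infinity. This fixes the value of the explicit formula at time 0.\<close>

lemma leading_coefficient_of_product:
  fixes mu eta :: "nat \<Rightarrow> real" and m :: "nat \<Rightarrow> nat"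
  assumes eq: "\<And>x. (\<Sum>j=1..N. mu j * x ^ j) + Lam = (\<Prod>j=1..L. (x - eta j) ^ m j)"
    and m: "(\<Sum>j=1..L. m j) = N" and N: "N \<ge> 1"
  shows "mu N = 1"
proof -
  have pow: "((\<lambda>x::real. x ^ j / x ^ N) \<longlongrightarrow> (if j = N then 1 else 0)) at_top" if "j \<le> N" for j
  proof (cases "j = N")
    case True
    have "\<forall>\<^sub>F x::real in at_top. x ^ j / x ^ N = 1"
      using eventually_gt_at_top[of 0] by eventually_elim (simp add: True)
    then show ?thesis using True by (simp add: tendsto_eventually)
  next
    case False
    then have "((\<lambda>x::real. inverse (x ^ (N - j))) \<longlongrightarrow> 0) at_top"
      using that by (intro tendsto_inverse_0_at_top filterlim_pow_at_top filterlim_ident) auto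
    moreover have "\<forall>\<^sub>F x::real in at_top. inverse (x ^ (N - j)) = x ^ j / x ^ N"
      using eventually_gt_at_top[of 0] by eventually_elim (simp add: power_diff that field_simps)
    ultimately have "((\<lambda>x::real. x ^ j / x ^ N) \<longlongrightarrow> 0) at_top"
      by (rule Lim_transform_eventually)
    then show ?thesis using False by simp
  qed
  have "((\<lambda>x. (\<Sum>j=1..N. mu j * (x ^ j / x ^ N)) + Lam * (x ^ 0 / x ^ N)) \<longlongrightarrow>
      (\<Sum>j=1..N. mu j * (if j = N then 1 else 0)) + Lam * (if 0 = N then 1 else 0)) at_top"
    by (intro tendsto_intros pow) auto
  moreover have "(\<Sum>j=1..N. mu j * (if j = N then 1 else 0)) = mu N"
    using N by (simp add: if_distrib[of "\<lambda>x. _ * x"] sum.delta cong: if_cong)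
  moreover have "(\<Sum>j=1..N. mu j * (x ^ j / x ^ N)) + Lam * (x ^ 0 / x ^ N) =
      ((\<Sum>j=1..N. mu j * x ^ j) + Lam) / x ^ N" for x
    by (simp add: add_divide_distrib sum_divide_distrib)
  ultimately have lim1: "((\<lambda>x. ((\<Sum>j=1..N. mu j * x ^ j) + Lam) / x ^ N) \<longlongrightarrow> mu N) at_top"
    using N by simp
  have "((\<lambda>x. \<Prod>j=1..L. (1 - eta j * inverse x) ^ m j) \<longlongrightarrow> (\<Prod>j=1..L. (1 - eta j * 0) ^ m j)) at_top"
    by (intro tendsto_prod tendsto_power tendsto_diff tendsto_mult tendsto_const
        tendsto_inverse_0_at_top filterlim_ident)
  moreover have "\<forall>\<^sub>F x in at_top. (\<Prod>j=1..L. (1 - eta j * inverse x) ^ m j) = ((\<Sum>j=1..N. mu j * x ^ j) + Lam) / x ^ N"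
    using eventually_gt_at_top[of 0]
  proof eventually_elim
    case (elim x)
    have "(\<Prod>j=1..L. (1 - eta j * inverse x) ^ m j) = (\<Prod>j=1..L. (x - eta j) ^ m j / x ^ m j)"
    proof (rule prod.cong[OF refl])
      fix j
      have "1 - eta j * inverse x = (x - eta j) / x" using elim by (simp add: field_simps)
      then show "(1 - eta j * inverse x) ^ m j = (x - eta j) ^ m j / x ^ m j"
        by (simp only: power_divide)
    qed
    also have "\<dots> = (\<Prod>j=1..L. (x - eta j) ^ m j) / x ^ N"
      by (simp only: prod_dividef power_sum[symmetric] m)
    finally show ?case by (simp only: eq)
  qed
  ultimately have "((\<lambda>x. ((\<Sum>j=1..N. mu j * x ^ j) + Lam) / x ^ N) \<longlongrightarrow> (\<Prod>j=1..L. (1 - eta j * 0) ^ m j)) at_top"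
    by (rule Lim_transform_eventually)
  from tendsto_unique[OF _ lim1 this] show ?thesis by simp
qed

lemma mittag_leffler_at_0: "mittag_leffler v b L g (\<lambda>_. 0) = 1 / Gamma b"
proof -
  define \<kappa>0 :: "nat \<Rightarrow> nat" where "\<kappa>0 = (\<lambda>l\<in>{1..L}. 0)"
  have "mittag_leffler v b L g (\<lambda>_. 0) = (\<Sum>\<^sub>\<infinity>\<kappa>\<in>{\<kappa>0}. 1 / Gamma b)"
    unfolding mittag_leffler_def
  proof (rule infsum_cong_neutral)
    fix \<kappa> assume \<kappa>: "\<kappa> \<in> ({1..L} \<rightarrow>\<^sub>E UNIV) - {\<kappa>0}"
    have "\<exists>l\<in>{1..L}. \<kappa> l \<noteq> 0"
    proof (rule ccontr)
      assume "\<not> (\<exists>l\<in>{1..L}. \<kappa> l \<noteq> 0)"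
      then have "\<kappa> = \<kappa>0" using \<kappa> by (auto simp: \<kappa>0_def PiE_def extensional_def fun_eq_iff)
      then show False using \<kappa> by simp
    qed
    then have "(\<Prod>j=1..L. (0::real) ^ \<kappa> j / fact (\<kappa> j)) = 0"
      by (auto simp: prod_zero_iff)
    then show "(\<Prod>j=1..L. pochhammer (g j) (\<kappa> j)) / Gamma (v * (\<Sum>j=1..L. real (\<kappa> j)) + b) *
        (\<Prod>j=1..L. (0::real) ^ \<kappa> j / fact (\<kappa> j)) = 0"
      by (simp only: mult_zero_right)
  next
    fix \<kappa> assume "\<kappa> \<in> ({1..L} \<rightarrow>\<^sub>E UNIV) \<inter> {\<kappa>0}"
    then have "\<kappa> l = 0" if "l \<in> {1..L}" for l using that by (auto simp: \<kappa>0_def)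
    then show "(\<Prod>j=1..L. pochhammer (g j) (\<kappa> j)) / Gamma (v * (\<Sum>j=1..L. real (\<kappa> j)) + b) *
        (\<Prod>j=1..L. (0::real) ^ \<kappa> j / fact (\<kappa> j)) = 1 / Gamma b"
      by simp
  qed (auto simp: \<kappa>0_def)
  then show ?thesis by simp
qed

text \<open>At time 0 the factor \<open>rpow 0 (\<delta> j - 1)\<close> vanishes unless \<open>\<delta> j = 1\<close>, which happens only for \<open>r = 0\<close> and \<open>j = N\<close>.\<close>

lemma p_explicit_at_0:
  assumes v: "v > 0" and N: "N \<ge> 1" and muN: "mu N = 1"
  shows "p_explicit Lam N mu v L m eta r 0 = (if r = 0 then 1 else 0)"
proof -
  define \<delta> where "\<delta> j = v * (real N * (real r + 1) - real j) + 1" for j :: nat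
  define E where "E j = mittag_leffler v (\<delta> j) L (\<lambda>l. real (m l) * (real r + 1)) (\<lambda>l. eta l * 0 powr v)" for j
  have "mu j * rpow 0 (\<delta> j - 1) * E j = (if r = 0 \<and> j = N then 1 else 0)" if j: "j \<in> {1..N}" for j
  proof (cases "r = 0 \<and> j = N")
    case True
    then have "\<delta> j = 1" by (simp add: \<delta>_def)
    then have "E j = 1" using mittag_leffler_at_0[of v 1 L] by (simp add: E_def)
    then show ?thesis using True muN \<open>\<delta> j = 1\<close> by (simp add: rpow_def)
  next
    case False
    have "real j < real N * (real r + 1)"
    proof (cases "r = 0")
      case True then show ?thesis using False j by simp
    next
      case r: False
      have "real N * 1 < real N * (real r + 1)" using r N by (intro mult_strict_left_mono) auto
      moreover have "real j \<le> real N" using j by simp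
      ultimately show ?thesis by linarith
    qed
    then have "\<delta> j - 1 > 0" using v by (simp add: \<delta>_def)
    then show ?thesis using False by (simp add: rpow_def)
  qed
  then have "(\<Sum>j=1..N. mu j * rpow 0 (\<delta> j - 1) * E j) = (\<Sum>j=1..N. if r = 0 \<and> j = N then 1 else 0)"
    by (rule sum.cong[OF refl])
  also have "\<dots> = (if r = 0 then 1 else 0)"
    using N by (cases "r = 0") (simp_all add: sum.delta)
  finally show ?thesis
    unfolding p_explicit_def Let_def \<delta>_def E_def by simp
qed

text \<open>With \<open>y = z powr v\<close>, the product of the binomial factors is \<open>(y ^ N / (\<Phi> + Lam)) ^ (r + 1)\<close> for
  \<open>\<Phi> = \<Sum>j. mu j * y ^ j\<close>, by the factorisation. The exponents \<open>\<delta> j\<close> are such that the powers of \<open>y\<close> cancel and leave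
  \<open>mu j * y ^ j\<close>; these sum up to \<open>\<Phi>\<close>.\<close>

lemma p_explicit_transform:
  assumes v: "v > 0" and Lam: "Lam > 0" and mu: "\<And>j. j \<in> {1..N} \<Longrightarrow> mu j \<ge> 0"
    and m: "\<And>l. l \<in> {1..L} \<Longrightarrow> m l \<ge> 1" "(\<Sum>j=1..L. m j) = N"
    and eq: "\<And>x. (\<Sum>j=1..N. mu j * x ^ j) + Lam = (\<Prod>j=1..L. (x - eta j) ^ m j)"
    and z0: "z0 > 0" and eta: "\<And>l. l \<in> {1..L} \<Longrightarrow> \<bar>eta l\<bar> < z0 powr v"
  shows "t > 0 \<Longrightarrow> isCont (p_explicit Lam N mu v L m eta r) t"
    and "z > z0 \<Longrightarrow> has_laplace (p_explicit Lam N mu v L m eta r) z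
           (Lam ^ r * ((\<Sum>j=1..N. mu j * (z powr v) ^ j) / z / ((\<Sum>j=1..N. mu j * (z powr v) ^ j) + Lam) ^ Suc r))"
proof -
  define d where "d j = v * (real N * (real r + 1) - real j)" for j :: nat
  define g where "g l = real (m l) * (real r + 1)" for l
  define E where "E j t = t powr d j * mittag_leffler v (d j + 1) L g (\<lambda>l. eta l * t powr v)" for j t
  define F where "F t = Lam ^ r * (\<Sum>j=1..N. mu j * E j t)" for t
  have p_E: "p_explicit Lam N mu v L m eta r t = F t" if "t > 0" for t
  proof -
    have "rpow t (d j + 1 - 1) = t powr d j" for j using that by (simp add: rpow_def)
    then show ?thesis
      unfolding p_explicit_def Let_def d_def[symmetric] g_def[symmetric] F_def E_def by (simp add: mult.assoc)
  qed
  have d_nonneg: "d j \<ge> 0" if j: "j \<in> {1..N}" for j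
  proof -
    have "real j \<le> real N * 1" using j by simp
    also have "\<dots> \<le> real N * (real r + 1)" by (intro mult_left_mono) auto
    finally show ?thesis using v by (simp add: d_def)
  qed
  have g_pos: "g l > 0" if "l \<in> {1..L}" for l
    using m(1)[OF that] by (simp add: g_def)
  show "isCont (p_explicit Lam N mu v L m eta r) t" if t: "t > 0"
  proof -
    have "isCont (E j) t" if "j \<in> {1..N}" for j
      unfolding E_def[abs_def]
      by (rule mittag_leffler_transform(1)[OF v d_nonneg[OF that] g_pos z0 eta t])
    then have "isCont F t" unfolding F_def by (intro continuous_intros) auto
    moreover have "\<forall>\<^sub>F s in nhds t. p_explicit Lam N mu v L m eta r s = F s"
      using eventually_nhds_in_open[of "{0<..}" t] t by (auto elim!: eventually_mono simp: p_E)
    ultimately show ?thesis by (simp add: isCont_cong)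
  qed
  show "has_laplace (p_explicit Lam N mu v L m eta r) z
           (Lam ^ r * ((\<Sum>j=1..N. mu j * (z powr v) ^ j) / z / ((\<Sum>j=1..N. mu j * (z powr v) ^ j) + Lam) ^ Suc r))"
    if z: "z > z0"
  proof -
    define y where "y = z powr v"
    define \<Phi> where "\<Phi> = (\<Sum>j=1..N. mu j * y ^ j)"
    have z_pos: "z > 0" using z z0 by simp
    have y: "y > 0" using z_pos by (simp add: y_def)
    have eta_y: "\<bar>eta l\<bar> < y" if "l \<in> {1..L}" for l
      using eta[OF that] powr_mono2[of v z0 z] z z0 v by (simp add: y_def)
    have \<Phi>: "\<Phi> \<ge> 0" unfolding \<Phi>_def using mu y by (intro sum_nonneg) auto
    have "(\<Prod>l=1..L. (1 - eta l * z powr (- v)) powr (- g l)) = (\<Prod>l=1..L. 1 / ((y - eta l) ^ m l / y ^ m l) ^ Suc r)"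
    proof (rule prod.cong[OF refl])
      fix l assume l: "l \<in> {1..L}"
      have b: "1 - eta l * z powr (- v) = (y - eta l) / y" "(y - eta l) / y > 0"
        using y eta_y[OF l] by (auto simp: y_def powr_minus field_simps)
      have g_eq: "g l = real (m l * Suc r)" by (simp add: g_def algebra_simps)
      have "((y - eta l) / y) powr (- g l) = 1 / ((y - eta l) / y) powr (g l)"
        by (rule powr_minus_divide)
      also have "((y - eta l) / y) powr (g l) = ((y - eta l) / y) ^ (m l * Suc r)"
        unfolding g_eq by (rule powr_realpow[OF b(2)])
      finally have "((y - eta l) / y) powr (- g l) = 1 / ((y - eta l) / y) ^ (m l * Suc r)" .
      then show "(1 - eta l * z powr (- v)) powr (- g l) = 1 / ((y - eta l) ^ m l / y ^ m l) ^ Suc r"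
        unfolding b(1) by (simp only: power_mult power_divide)
    qed
    also have "\<dots> = 1 / ((\<Prod>l=1..L. (y - eta l) ^ m l) / y ^ N) ^ Suc r"
    proof -
      have "(\<Prod>l=1..L. (y - eta l) ^ m l / y ^ m l) = (\<Prod>l=1..L. (y - eta l) ^ m l) / y ^ N"
        by (simp only: prod_dividef power_sum[symmetric] m(2))
      moreover have "(\<Prod>l=1..L. 1 / X l ^ Suc r) = 1 / (\<Prod>l=1..L. X l) ^ Suc r" for X :: "nat \<Rightarrow> real"
        by (simp only: prod_dividef prod.neutral_const prod_power_distrib)
      ultimately show ?thesis by (simp only:)
    qed
    also have "(\<Prod>l=1..L. (y - eta l) ^ m l) = \<Phi> + Lam"
      unfolding \<Phi>_def by (rule eq[symmetric])
    finally have prod_eq: "(\<Prod>l=1..L. (1 - eta l * z powr (- v)) powr (- g l)) = (y ^ N) ^ Suc r / (\<Phi> + Lam) ^ Suc r"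
      by (simp only: power_divide) simp
    have pow_eq: "z powr (- d j) = y ^ j / (y ^ N) ^ Suc r" for j
    proof -
      have "- d j = v * real j - v * real (N * Suc r)" by (simp add: d_def algebra_simps)
      then have "z powr (- d j) = (z powr v) powr real j / (z powr v) powr real (N * Suc r)"
        by (simp only: powr_diff powr_powr)
      also have "\<dots> = y ^ j / y ^ (N * Suc r)"
        using y by (simp only: y_def[symmetric] powr_realpow)
      finally show ?thesis by (simp only: power_mult)
    qed
    have "has_laplace F z (Lam ^ r * (\<Sum>j=1..N. mu j * (z powr (- d j) *
        (\<Prod>l=1..L. (1 - eta l * z powr (- v)) powr (- g l)) / z)))"
      unfolding F_def
    proof (intro has_laplace_cmult has_laplace_sum)
      fix j assume j: "j \<in> {1..N}"
      show "has_laplace (E j) z (z powr (- d j) * (\<Prod>l=1..L. (1 - eta l * z powr (- v)) powr (- g l)) / z)"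
        unfolding E_def[abs_def]
        by (rule mittag_leffler_transform(2)[OF v d_nonneg[OF j] g_pos z0 eta z])
    qed
    also have "(\<Sum>j=1..N. mu j * (z powr (- d j) * (\<Prod>l=1..L. (1 - eta l * z powr (- v)) powr (- g l)) / z)) =
        (\<Sum>j=1..N. mu j * y ^ j / z / (\<Phi> + Lam) ^ Suc r)"
    proof (rule sum.cong[OF refl])
      fix j
      have "(y ^ N) ^ Suc r \<noteq> 0" using y by simp
      then have cancel: "y ^ j / (y ^ N) ^ Suc r * ((y ^ N) ^ Suc r / (\<Phi> + Lam) ^ Suc r) = y ^ j / (\<Phi> + Lam) ^ Suc r"
        by (simp del: power_Suc power_eq_0_iff)
      show "mu j * (z powr (- d j) * (\<Prod>l=1..L. (1 - eta l * z powr (- v)) powr (- g l)) / z) =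
          mu j * y ^ j / z / (\<Phi> + Lam) ^ Suc r"
        unfolding prod_eq pow_eq cancel by simp
    qed
    also have "\<dots> = \<Phi> / z / (\<Phi> + Lam) ^ Suc r"
      by (simp only: \<Phi>_def[symmetric] sum_divide_distrib[symmetric])
    finally have "has_laplace F z (Lam ^ r * (\<Phi> / z / (\<Phi> + Lam) ^ Suc r))" .
    then show ?thesis
      unfolding \<Phi>_def y_def
      by (subst has_laplace_cong[where g = F]) (simp_all add: p_E)
  qed
qed

section \<open>The state probabilities in terms of Mittag-Leffler functions\<close>

lemma (in time_changed_counting) mittag_leffler_formula:
  assumes lam: "\<And>j. j \<in> {1..k} \<Longrightarrow> lam j > 0" and k: "k \<ge> 1" and N: "N \<ge> 1"
    and Lam_def: "Lam = (\<Sum>j=1..k. lam j)"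
    and v: "v > 0" and nu: "\<And>j. j \<in> {1..N} \<Longrightarrow> nu j = real j * v"
    and m: "\<And>l. l \<in> {1..L} \<Longrightarrow> m l \<ge> 1" "(\<Sum>j=1..L. m j) = N"
    and eq: "\<And>x. (\<Sum>j=1..N. mu j * x ^ j) + Lam = (\<Prod>j=1..L. (x - eta j) ^ m j)"
    and t: "t \<ge> 0"
  shows "tc_prob n t = (\<Sum>r=0..n. composition_weight k (\<lambda>j. lam j / Lam) n r * p_explicit Lam N mu v L m eta r t)"
proof (cases "t = 0")
  case True
  have "mu N = 1" by (rule leading_coefficient_of_product[OF eq m(2) N])
  then have "(\<Sum>r=0..n. composition_weight k (\<lambda>j. lam j / Lam) n r * p_explicit Lam N mu v L m eta r 0) =
      (\<Sum>r=0..n. if r = 0 then composition_weight k (\<lambda>j. lam j / Lam) n 0 else 0)"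
    by (intro sum.cong) (simp_all add: p_explicit_at_0[OF v N])
  also have "\<dots> = tc_prob n 0" by (simp add: sum.delta composition_weight_0 tc_prob_0)
  finally show ?thesis using True by simp
next
  case False
  then have t0: "t > 0" using t by simp
  have Lam: "Lam > 0" unfolding Lam_def by (intro sum_pos lam) (use k in auto)
  \<comment> \<open>Beyond \<open>z0\<close>, \<open>z powr v\<close> exceeds all \<open>\<bar>eta l\<bar>\<close>, so that the binomial series converge.\<close>
  define B where "B = 1 + (\<Sum>l=1..L. \<bar>eta l\<bar>)"
  define z0 where "z0 = B powr (1 / v)"
  have B: "B > 0" unfolding B_def by (intro add_pos_nonneg sum_nonneg) auto
  have z0: "z0 > 0" using B by (simp add: z0_def)
  have "z0 powr v = B" using B v by (simp add: z0_def powr_powr)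
  moreover have "\<bar>eta l\<bar> < B" if "l \<in> {1..L}" for l
    using member_le_sum[of l "{1..L}" "\<lambda>l. \<bar>eta l\<bar>"] that by (simp add: B_def)
  ultimately have eta: "\<bar>eta l\<bar> < z0 powr v" if "l \<in> {1..L}" for l using that by simp
  have \<phi>_eq: "\<phi> z = (\<Sum>j=1..N. mu j * (z powr v) ^ j)" if "z > 0" for z
    unfolding \<phi>_def
  proof (rule sum.cong[OF refl])
    fix j assume "j \<in> {1..N}"
    then show "mu j * z powr nu j = mu j * (z powr v) ^ j"
      using that by (simp add: nu powr_realpow[symmetric] powr_powr mult.commute)
  qed
  note transform = p_explicit_transform[where mu = mu, OF v Lam mu_nonneg m eq z0 eta]
  define F where "F t = (\<Sum>r=0..n. composition_weight k (\<lambda>j. lam j / Lam) n r * p_explicit Lam N mu v L m eta r t)" for t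
  have "tc_prob n t = F t"
  proof (rule laplace_eq_imp_eq[where ?z0.0 = z0 and F = "\<lambda>z. \<phi> z / z * state_laplace n (\<phi> z)" and f = "tc_prob n"
        and g = F])
    fix z assume z: "z > z0"
    then have z_pos: "z > 0" using z0 by simp
    show "has_laplace (tc_prob n) z (\<phi> z / z * state_laplace n (\<phi> z))" by (rule tc_prob_has_laplace[OF z_pos])
    have "has_laplace F z
        (\<Sum>r=0..n. composition_weight k (\<lambda>j. lam j / Lam) n r * (Lam ^ r * (\<phi> z / z / (\<phi> z + Lam) ^ Suc r)))"
      unfolding \<phi>_eq[OF z_pos] F_def
      by (intro has_laplace_sum has_laplace_cmult transform(2) z)
    also have "(\<Sum>r=0..n. composition_weight k (\<lambda>j. lam j / Lam) n r * (Lam ^ r * (\<phi> z / z / (\<phi> z + Lam) ^ Suc r))) =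
        \<phi> z / z * state_laplace n (\<phi> z)"
      unfolding state_laplace_closed_form[OF Lam_def Lam \<phi>_pos[OF z_pos]] sum_distrib_left
      by (rule sum.cong) (simp_all del: power_Suc)
    finally show "has_laplace F z
        (\<phi> z / z * state_laplace n (\<phi> z))" .
  next
    have "isCont F t"
      unfolding F_def by (intro continuous_intros transform(1) t0)
    then show "(F \<longlongrightarrow> F t) (at_left t)"
      by (simp add: isCont_def filterlim_at_split)
  qed (use t0 tc_prob_left_cont in auto)
  then show ?thesis by (simp only: F_def)
qed

theorem theorem15:
  fixes P :: "'a measure"
    and k N :: nat
    and lam mu nu :: "nat \<Rightarrow> real"
    and Lam :: real
    and M :: "real \<Rightarrow> 'a \<Rightarrow> nat"
    and H :: "nat \<Rightarrow> real \<Rightarrow> 'a \<Rightarrow> real"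
    and T :: "real \<Rightarrow> 'a \<Rightarrow> real"
    and p :: "nat \<Rightarrow> real \<Rightarrow> real"
  assumes P: "prob_space P"
    and kN: "k \<ge> 1" "N \<ge> 1"
    and lam_pos: "\<And>j. j \<in> {1..k} \<Longrightarrow> lam j > 0"
    and Lam_def: "Lam = (\<Sum>j=1..k. lam j)"
    and M: "generalized_counting_process P k lam M"
    and mu_nonneg: "\<And>j. j \<in> {1..N} \<Longrightarrow> mu j \<ge> 0"
    and H: "\<And>j. j \<in> {1..N} \<Longrightarrow> stable_subordinator P (nu j) (H j)"
    and H_indep: "prob_space.indep_vars P (\<lambda>_. PiM {0..} (\<lambda>_. borel)) (\<lambda>j. trajectory (H j)) {1..N}"
    and T_def: "T = inverse_process N mu nu H"
    and MT_indep: "prob_space.indep_var P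
                     (PiM {0..} (\<lambda>_. borel)) (trajectory (\<lambda>t \<omega>. real (M t \<omega>)))
                     (PiM {0..} (\<lambda>_. borel)) (trajectory T)"
    and p_def: "p = (\<lambda>n t. \<P>(\<omega> in P. M (T t \<omega>) \<omega> = n))"
  shows "((\<forall>j\<in>{1..N}. mu j > 0 \<and> 0 < nu j \<and> nu j < 1) \<longrightarrow>
            (\<forall>n. \<forall>t>0. (\<forall>j\<in>{1..N}. caputo_differentiable (nu j) (p n) t) \<and>
               (\<Sum>j=1..N. mu j * caputo_derivative (nu j) (p n) t)
                 = - Lam * p n t + (\<Sum>j=1..min n k. lam j * p (n - j) t)) \<and>
            p 0 0 = 1 \<and> (\<forall>n\<ge>1. p n 0 = 0))
       \<and> (\<forall>(v::real) (L::nat) (m::nat \<Rightarrow> nat) (eta::nat \<Rightarrow> real).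
            0 < v \<and> v \<le> 1 / real N \<and> (\<forall>j\<in>{1..N}. nu j = real j * v) \<and>
            (\<forall>j\<in>{1..L}. m j \<ge> 1) \<and> (\<Sum>j=1..L. m j) = N \<and>
            (\<forall>x::real. (\<Sum>j=1..N. mu j * x ^ j) + Lam = (\<Prod>j=1..L. (x - eta j) ^ m j)) \<longrightarrow>
            (\<forall>n. \<forall>t\<ge>0. p n t =
               (\<Sum>r=0..n. \<Sum>\<alpha>\<in>weighted_compositions k r n.
                  multinomial k r \<alpha> * (\<Prod>j=1..k. (lam j / Lam) ^ \<alpha> j)
                  * p_explicit Lam N mu v L m eta r t)))"
proof (rule conjI, rule impI)
  interpret prob_space P by (rule P)
  interpret generalized_counting P k lam M by unfold_locales (rule M)
  have tc: "time_changed_counting P k lam M N mu nu H" if "\<exists>j\<in>{1..N}. mu j > 0"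
    using that
    by unfold_locales (rule mu_nonneg H H_indep MT_indep[unfolded T_def] | assumption)+
  show "(\<forall>n. \<forall>t>0. (\<forall>j\<in>{1..N}. caputo_differentiable (nu j) (p n) t) \<and>
               (\<Sum>j=1..N. mu j * caputo_derivative (nu j) (p n) t)
                 = - Lam * p n t + (\<Sum>j=1..min n k. lam j * p (n - j) t)) \<and>
            p 0 0 = 1 \<and> (\<forall>n\<ge>1. p n 0 = 0)"
    if munu: "\<forall>j\<in>{1..N}. mu j > 0 \<and> 0 < nu j \<and> nu j < 1"
  proof -
    interpret C: time_changed_counting P k lam M N mu nu H
      by (rule tc) (use munu kN in \<open>auto intro!: bexI[of _ 1]\<close>)
    have p: "p = C.tc_prob" by (simp add: p_def C.tc_prob_def T_def fun_eq_iff)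
    note equation = C.fractional_equation[OF bspec[OF munu] lam_pos kN(1), folded Lam_def]
    show ?thesis
      unfolding p
    proof (intro conjI allI impI)
      show "C.tc_prob 0 0 = 1" by (simp add: C.tc_prob_0)
      show "C.tc_prob n 0 = 0" if "n \<ge> 1" for n using that by (simp add: C.tc_prob_0)
    qed (rule equation; assumption)+
  qed
  show "\<forall>(v::real) (L::nat) (m::nat \<Rightarrow> nat) (eta::nat \<Rightarrow> real).
            0 < v \<and> v \<le> 1 / real N \<and> (\<forall>j\<in>{1..N}. nu j = real j * v) \<and>
            (\<forall>j\<in>{1..L}. m j \<ge> 1) \<and> (\<Sum>j=1..L. m j) = N \<and>
            (\<forall>x::real. (\<Sum>j=1..N. mu j * x ^ j) + Lam = (\<Prod>j=1..L. (x - eta j) ^ m j)) \<longrightarrow>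
            (\<forall>n. \<forall>t\<ge>0. p n t =
               (\<Sum>r=0..n. \<Sum>\<alpha>\<in>weighted_compositions k r n.
                  multinomial k r \<alpha> * (\<Prod>j=1..k. (lam j / Lam) ^ \<alpha> j)
                  * p_explicit Lam N mu v L m eta r t))"
  proof (intro allI impI, elim conjE)
    fix v :: real and L :: nat and m :: "nat \<Rightarrow> nat" and eta :: "nat \<Rightarrow> real" and n :: nat and t :: real
    assume v: "0 < v" and nu: "\<forall>j\<in>{1..N}. nu j = real j * v" and m: "\<forall>j\<in>{1..L}. m j \<ge> 1" "(\<Sum>j=1..L. m j) = N"
      and eq: "\<forall>x::real. (\<Sum>j=1..N. mu j * x ^ j) + Lam = (\<Prod>j=1..L. (x - eta j) ^ m j)"
      and t: "t \<ge> 0"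
    have "mu N = 1" by (rule leading_coefficient_of_product[OF spec[OF eq] m(2) kN(2)])
    then interpret C: time_changed_counting P k lam M N mu nu H
      by (intro tc) (use kN in \<open>auto intro!: bexI[of _ N]\<close>)
    have "p n t = C.tc_prob n t" by (simp add: p_def C.tc_prob_def T_def)
    also have "\<dots> = (\<Sum>r=0..n. composition_weight k (\<lambda>j. lam j / Lam) n r * p_explicit Lam N mu v L m eta r t)"
      by (rule C.mittag_leffler_formula[OF lam_pos kN Lam_def v _ _ m(2) spec[OF eq] t]) (use nu m in auto)
    finally show "p n t = (\<Sum>r=0..n. \<Sum>\<alpha>\<in>weighted_compositions k r n.
                  multinomial k r \<alpha> * (\<Prod>j=1..k. (lam j / Lam) ^ \<alpha> j)
                  * p_explicit Lam N mu v L m eta r t)"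
      by (simp only: composition_weight_def sum_distrib_right)
  qed
qed

end
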